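(* Let $p$ be a prime and let $\mathcal{F}$ be a saturated fusion system on a finite $p$-group $S$. Then for every $\mathcal{F}^c$-restricted Mackey functor $M=(M^*,M_* )\colon \mathcal{O}(\mathcal{F}^c)\to \mathbb{Z}_{(p)}\text{-}\mathsf{Mod}$ for $\mathcal{F}$ over $\mathbb{Z}_{(p)}$, the contravariant part $M^*$ is acyclic, i.e. $\varprojlim^i_{\mathcal{O}(\mathcal{F}^c)} M^*=0$ for all $i>0$.
   Context: A fusion system $\mathcal{F}$ on a finite $p$-group $S$ is a category whose objects are all subgroups of $S$, whose morphisms are injective group homomorphisms (composed as usual), such that $\mathrm{Hom}_{\mathcal{F}}(P,Q)$ contains all maps $c_x|_P\colon P\to Q$, $u\mapsto xux^{-1}$, with $x\in S$ and $xPx^{-1}\le Q$, and such that each $\varphi\in \mathrm{Hom}_{\mathcal{F}}(P,Q)$ factors as an $\mathcal{F}$-isomorphism $P\to\varphi(P)$ followed by the inclusion. Subgroups are $\mathcal{F}$-conjugate if they are isomorphic in $\mathcal{F}$. A subgroup $P\le S$ is fully normalized (resp. fully centralized) if $|N_S(P)|\ge |N_S(P')|$ (resp. $|C_S(P)|\ge|C_S(P')|$) for every $\mathcal{F}$-conjugate $P'$ of $P$. $\mathcal{F}$ is saturated if (I) each fully normalized $P$ is fully centralized and $\mathrm{Aut}_S(P)$ (the group of automorphisms induced by conjugation by $N_S(P)$) is a Sylow $p$-subgroup of $\mathrm{Aut}_{\mathcal{F}}(P)$; (II) if $\varphi\in\mathrm{Hom}_{\mathcal{F}}(P,S)$ and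 $\varphi(P)$ is fully centralized, then $\varphi$ extends to a morphism in $\mathrm{Hom}_{\mathcal{F}}(N_\varphi,S)$, where $N_\varphi=\{g\in N_S(P)\mid \varphi c_g\varphi^{-1}\in \mathrm{Aut}_S(\varphi(P))\}$. A subgroup $P\le S$ is $\mathcal{F}$-centric if $C_S(P')\le P'$ for every $\mathcal{F}$-conjugate $P'$ of $P$; $\mathcal{F}^c$ denotes the collection of $\mathcal{F}$-centric subgroups. The orbit category $\mathcal{O}(\mathcal{F})$ has as objects all subgroups of $S$ and morphisms $\mathrm{Hom}_{\mathcal{O}(\mathcal{F})}(P,Q)=\mathrm{Inn}(Q)\backslash \mathrm{Hom}_{\mathcal{F}}(P,Q)$ ($\mathrm{Inn}(Q)$ acting by post-composition); $[\varphi]$ denotes the class of $\varphi$. $\mathcal{O}(\mathcal{F}^c)$ is its full subcategory on $\mathcal{F}^c$. For $Q\le P$, $\iota_Q^P\colon Q\to P$ is the inclusion; ${}^xR=xRx^{-1}$ and $c_x(u)=xux^{-1}$. For a commutative ring $k$, an $\mathcal{F}^c$-restricted Mackey functor for $\mathcal{F}$ over $k$ is a pair $M=(M^*,M_* )\colon\mathcal{O}(\mathcal{F}^c)\to k\text{-}\mathsf{Mod}$ (with $k\text{-}\mathsf{Mod}$ the category of $k$-modules) such that: (1) $M^*$ is a contravariant functor, $M_*$ is a covariant functor, and $M^*(P)=M_*(P)=:M(P)$ for all $P\in\mathcal{F}^c$; (2) $M^*([\alpha])=M_*([\alpha]^{-1})$ for every isomorphism $[\alpha]$ in $\mathcal{O}(\mathcal{F}^c)$;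 (3) for all $Q,R\le P$ in $\mathcal{F}^c$, $$M^*([\iota^P_Q])\circ M_*([\iota^P_R])=\sum_{x} M_*([\iota^Q_{Q\cap{}^xR}])\circ M^*([\iota^{{}^xR}_{Q\cap{}^xR}])\circ M_*([c_x|_R]),$$ where $x$ runs over those elements of a set of representatives of the double cosets $Q\backslash P/R$ for which $Q\cap{}^xR\in\mathcal{F}^c$ (and $c_x|_R$ is regarded as an isomorphism $R\to{}^xR$). $\varprojlim^i_{\mathcal{O}(\mathcal{F}^c)}$ denotes the $i$-th right derived functor of the inverse limit on contravariant functors from $\mathcal{O}(\mathcal{F}^c)$ to modules. *)

theory Defs
  imports "HOL-Algebra.Algebra"
begin

section \<open>Module-valued functors on small categories\<close>

record ('o, 'a) category =
  Obj :: "'o set"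
  Hom :: "'o \<Rightarrow> 'o \<Rightarrow> 'a set"
  Comp :: "'o \<Rightarrow> 'o \<Rightarrow> 'o \<Rightarrow> 'a \<Rightarrow> 'a \<Rightarrow> 'a"  \<comment> \<open>\<open>Comp C x y z g f\<close> is $g \circ f$ for $f \colon x \to y$, $g \colon y \to z$\<close>
  Ide :: "'o \<Rightarrow> 'a"

definition inverse_arrows :: "('o, 'a) category \<Rightarrow> 'o \<Rightarrow> 'o \<Rightarrow> 'a \<Rightarrow> 'a \<Rightarrow> bool" where
  "inverse_arrows C x y f g \<longleftrightarrow>
     f \<in> Hom C x y \<and> g \<in> Hom C y x \<and> Comp C x y x g f = Ide C x \<and> Comp C y x y f g = Ide C y"

definition full_subcategory :: "('o, 'a) category \<Rightarrow> 'o set \<Rightarrow> ('o, 'a) category" where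
  "full_subcategory C A = C\<lparr>Obj := A\<rparr>"

definition linear_maps ::
    "('k, 'x) ring_scheme \<Rightarrow> ('k, 'm) module \<Rightarrow> ('k, 'n) module \<Rightarrow> ('m \<Rightarrow> 'n) set" where
  "linear_maps k M N =
     {f \<in> hom (add_monoid M) (add_monoid N).
        \<forall>r\<in>carrier k. \<forall>v\<in>carrier M. f (r \<odot>\<^bsub>M\<^esub> v) = r \<odot>\<^bsub>N\<^esub> f v}"

text \<open>The same record serves for both variances: for an arrow \<open>a \<in> Hom C x y\<close>, the map
  \<open>Ar M x y a\<close> goes from \<open>Ob M y\<close> to \<open>Ob M x\<close> in the contravariant case and from \<open>Ob M x\<close> to
  \<open>Ob M y\<close> in the covariant case. Maps between modules matter only on the carriers, so all
  equations between them are stated pointwise on carriers.\<close>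

record ('o, 'a, 'k, 'm) mod_functor =
  Ob :: "'o \<Rightarrow> ('k, 'm) module"
  Ar :: "'o \<Rightarrow> 'o \<Rightarrow> 'a \<Rightarrow> 'm \<Rightarrow> 'm"

definition covariant_functor ::
    "('o, 'a) category \<Rightarrow> ('k, 'x) ring_scheme \<Rightarrow> ('o, 'a, 'k, 'm) mod_functor \<Rightarrow> bool" where
  "covariant_functor C k M \<longleftrightarrow>
     (\<forall>x\<in>Obj C. module k (Ob M x)) \<and>
     (\<forall>x\<in>Obj C. \<forall>y\<in>Obj C. \<forall>a\<in>Hom C x y. Ar M x y a \<in> linear_maps k (Ob M x) (Ob M y)) \<and>
     (\<forall>x\<in>Obj C. \<forall>v\<in>carrier (Ob M x). Ar M x x (Ide C x) v = v) \<and>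
     (\<forall>x\<in>Obj C. \<forall>y\<in>Obj C. \<forall>z\<in>Obj C. \<forall>a\<in>Hom C x y. \<forall>b\<in>Hom C y z. \<forall>v\<in>carrier (Ob M x).
        Ar M x z (Comp C x y z b a) v = Ar M y z b (Ar M x y a v))"

definition contravariant_functor ::
    "('o, 'a) category \<Rightarrow> ('k, 'x) ring_scheme \<Rightarrow> ('o, 'a, 'k, 'm) mod_functor \<Rightarrow> bool" where
  "contravariant_functor C k M \<longleftrightarrow>
     (\<forall>x\<in>Obj C. module k (Ob M x)) \<and>
     (\<forall>x\<in>Obj C. \<forall>y\<in>Obj C. \<forall>a\<in>Hom C x y. Ar M x y a \<in> linear_maps k (Ob M y) (Ob M x)) \<and>
     (\<forall>x\<in>Obj C. \<forall>v\<in>carrier (Ob M x). Ar M x x (Ide C x) v = v) \<and>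
     (\<forall>x\<in>Obj C. \<forall>y\<in>Obj C. \<forall>z\<in>Obj C. \<forall>a\<in>Hom C x y. \<forall>b\<in>Hom C y z. \<forall>v\<in>carrier (Ob M z).
        Ar M x z (Comp C x y z b a) v = Ar M x y a (Ar M y z b v))"

definition natural_maps ::
    "('o, 'a) category \<Rightarrow> ('k, 'x) ring_scheme \<Rightarrow> ('o, 'a, 'k, 'm) mod_functor
      \<Rightarrow> ('o, 'a, 'k, 'n) mod_functor \<Rightarrow> ('o \<Rightarrow> 'm \<Rightarrow> 'n) set" where
    \<comment> \<open>natural transformations of contravariant functors\<close>
  "natural_maps C k M N =
     {\<eta>. (\<forall>x\<in>Obj C. \<eta> x \<in> linear_maps k (Ob M x) (Ob N x)) \<and>
         (\<forall>x\<in>Obj C. \<forall>y\<in>Obj C. \<forall>a\<in>Hom C x y. \<forall>v\<in>carrier (Ob M y).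
            \<eta> x (Ar M x y a v) = Ar N x y a (\<eta> y v))}"

section \<open>Higher limits\<close>

text \<open>Injective objects of the category of contravariant functors from \<open>C\<close> to the \<open>k\<close>-modules
  with elements in the type \<open>'n\<close> (a natural transformation is a monomorphism iff it is objectwise
  injective). If \<open>'n\<close> is infinite and \<open>k\<close> and the hom-sets of \<open>C\<close> are countable, then every
  subfunctor of a representable functor \<open>k[Hom C - x]\<close> has an isomorphic copy with elements in
  \<open>'n\<close>, so that by Baer's criterion such an object is injective with respect to functors of
  arbitrary size.\<close>

definition injective_functor ::
    "('o, 'a) category \<Rightarrow> ('k, 'x) ring_scheme \<Rightarrow> ('o, 'a, 'k, 'n) mod_functor \<Rightarrow> bool" where
  "injective_functor C k J \<longleftrightarrow>
     contravariant_functor C k J \<and>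
     (\<forall>(A :: ('o, 'a, 'k, 'n) mod_functor) (B :: ('o, 'a, 'k, 'n) mod_functor).
        contravariant_functor C k A \<longrightarrow> contravariant_functor C k B \<longrightarrow>
        (\<forall>j\<in>natural_maps C k A B. \<forall>f\<in>natural_maps C k A J.
           (\<forall>x\<in>Obj C. inj_on (j x) (carrier (Ob A x))) \<longrightarrow>
           (\<exists>g\<in>natural_maps C k B J. \<forall>x\<in>Obj C. \<forall>v\<in>carrier (Ob A x). g x (j x v) = f x v)))"

definition injective_resolution ::
    "('o, 'a) category \<Rightarrow> ('k, 'x) ring_scheme \<Rightarrow> ('o, 'a, 'k, 'm) mod_functor
      \<Rightarrow> (nat \<Rightarrow> ('o, 'a, 'k, 'n) mod_functor) \<Rightarrow> ('o \<Rightarrow> 'm \<Rightarrow> 'n) \<Rightarrow> (nat \<Rightarrow> 'o \<Rightarrow> 'n \<Rightarrow> 'n) \<Rightarrow> bool"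
    \<comment> \<open>$0 \to M \xrightarrow{e} J^0 \xrightarrow{d^0} J^1 \xrightarrow{d^1} \cdots$ is exact, with all $J^n$ injective\<close>
  where
  "injective_resolution C k M J e d \<longleftrightarrow>
     contravariant_functor C k M \<and>
     (\<forall>n. injective_functor C k (J n)) \<and>
     e \<in> natural_maps C k M (J 0) \<and>
     (\<forall>n. d n \<in> natural_maps C k (J n) (J (Suc n))) \<and>
     (\<forall>x\<in>Obj C.
        inj_on (e x) (carrier (Ob M x)) \<and>
        e x ` carrier (Ob M x) = a_kernel (Ob (J 0) x) (Ob (J 1) x) (d 0 x) \<and>
        (\<forall>n. d n x ` carrier (Ob (J n) x) =
             a_kernel (Ob (J (Suc n)) x) (Ob (J (Suc (Suc n))) x) (d (Suc n) x)))"

text \<open>The inverse limit of a contravariant functor, as the module of compatible families.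
  The fields \<open>mult\<close> and \<open>one\<close> of a module record carry no meaning.\<close>

definition limit :: "('o, 'a) category \<Rightarrow> ('o, 'a, 'k, 'm) mod_functor \<Rightarrow> ('k, 'o \<Rightarrow> 'm) module" where
  "limit C M =
     \<lparr>carrier = {s \<in> (\<Pi>\<^sub>E x\<in>Obj C. carrier (Ob M x)).
         \<forall>x\<in>Obj C. \<forall>y\<in>Obj C. \<forall>a\<in>Hom C x y. Ar M x y a (s y) = s x},
      monoid.mult = undefined, one = undefined,
      ring.zero = (\<lambda>x\<in>Obj C. \<zero>\<^bsub>Ob M x\<^esub>),
      ring.add = (\<lambda>s t. \<lambda>x\<in>Obj C. s x \<oplus>\<^bsub>Ob M x\<^esub> t x),
      module.smult = (\<lambda>r s. \<lambda>x\<in>Obj C. r \<odot>\<^bsub>Ob M x\<^esub> s x)\<rparr>"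

definition limit_map :: "('o, 'a) category \<Rightarrow> ('o \<Rightarrow> 'm \<Rightarrow> 'n) \<Rightarrow> ('o \<Rightarrow> 'm) \<Rightarrow> ('o \<Rightarrow> 'n)" where
  "limit_map C \<eta> s = (\<lambda>x\<in>Obj C. \<eta> x (s x))"

text \<open>The additive group underlying the \<open>i\<close>-th cohomology module of a cochain complex of modules.\<close>

definition cohomology ::
    "(nat \<Rightarrow> ('k, 'm) module) \<Rightarrow> (nat \<Rightarrow> 'm \<Rightarrow> 'm) \<Rightarrow> nat \<Rightarrow> 'm set monoid" where
  "cohomology K d i =
     (K i)\<lparr>carrier := a_kernel (K i) (K (Suc i)) (d i)\<rparr>
       A_Mod (case i of 0 \<Rightarrow> {\<zero>\<^bsub>K 0\<^esub>} | Suc j \<Rightarrow> d j ` carrier (K j))"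

text \<open>The value at \<open>M\<close> of the \<open>i\<close>-th right derived functor of the inverse limit, computed from an
  injective resolution \<open>J, d\<close> of \<open>M\<close>. Statements about it are meant for all injective resolutions.
  When \<open>k\<close> is countable and Noetherian and \<open>C\<close> is finite, each \<open>M\<close> has one with elements in \<open>'n\<close>,
  for every infinite type \<open>'n\<close> into which the modules \<open>Ob M x\<close> inject.\<close>

definition higher_limit ::
    "('o, 'a) category \<Rightarrow> (nat \<Rightarrow> ('o, 'a, 'k, 'n) mod_functor) \<Rightarrow> (nat \<Rightarrow> 'o \<Rightarrow> 'n \<Rightarrow> 'n)
      \<Rightarrow> nat \<Rightarrow> ('o \<Rightarrow> 'n) set monoid" where
  "higher_limit C J d i = cohomology (\<lambda>n. limit C (J n)) (\<lambda>n. limit_map C (d n)) i"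

section \<open>Fusion systems\<close>

text \<open>Group homomorphisms defined on a subgroup \<open>P\<close> are represented by functions that are
  extensional on \<open>P\<close>.\<close>

definition conj_map :: "('g, 'x) monoid_scheme \<Rightarrow> 'g \<Rightarrow> 'g set \<Rightarrow> 'g \<Rightarrow> 'g" where
  "conj_map S x P = (\<lambda>u\<in>P. x \<otimes>\<^bsub>S\<^esub> u \<otimes>\<^bsub>S\<^esub> inv\<^bsub>S\<^esub> x)"

definition incl :: "'g set \<Rightarrow> 'g \<Rightarrow> 'g" where
  "incl P = (\<lambda>u\<in>P. u)"

definition centralizer :: "('g, 'x) monoid_scheme \<Rightarrow> 'g set \<Rightarrow> 'g set" where
  "centralizer S P = {g \<in> carrier S. \<forall>u\<in>P. g \<otimes>\<^bsub>S\<^esub> u = u \<otimes>\<^bsub>S\<^esub> g}"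

definition sylow_subgroup :: "nat \<Rightarrow> ('g, 'x) monoid_scheme \<Rightarrow> 'g set \<Rightarrow> bool" where
  "sylow_subgroup p G H \<longleftrightarrow> subgroup H G \<and> card H = p ^ multiplicity p (order G)"

type_synonym 'g fusion = "'g set \<Rightarrow> 'g set \<Rightarrow> ('g \<Rightarrow> 'g) set"
  \<comment> \<open>the assignment $(P, Q) \mapsto \mathrm{Hom}_{\mathcal F}(P, Q)$, meaningful on subgroups only\<close>

definition fusion_category :: "('g, 'x) monoid_scheme \<Rightarrow> 'g fusion \<Rightarrow> ('g set, 'g \<Rightarrow> 'g) category" where
  "fusion_category S F =
     \<lparr>Obj = {P. subgroup P S}, Hom = F, Comp = (\<lambda>P Q R \<psi> \<phi>. compose P \<psi> \<phi>), Ide = incl\<rparr>"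

definition fusion_isos :: "('g, 'x) monoid_scheme \<Rightarrow> 'g fusion \<Rightarrow> 'g set \<Rightarrow> 'g set \<Rightarrow> ('g \<Rightarrow> 'g) set" where
  "fusion_isos S F P Q = {\<phi>. \<exists>\<psi>. inverse_arrows (fusion_category S F) P Q \<phi> \<psi>}"

definition fusion_system :: "nat \<Rightarrow> ('g, 'x) monoid_scheme \<Rightarrow> 'g fusion \<Rightarrow> bool" where
  "fusion_system p S F \<longleftrightarrow>
     group S \<and> finite (carrier S) \<and> (\<exists>n. order S = p ^ n) \<and>
     (\<forall>P Q. subgroup P S \<longrightarrow> subgroup Q S \<longrightarrow>
        F P Q \<subseteq> extensional P \<inter> mon (S\<lparr>carrier := P\<rparr>) (S\<lparr>carrier := Q\<rparr>)) \<and>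
     (\<forall>P Q R. subgroup P S \<longrightarrow> subgroup Q S \<longrightarrow> subgroup R S \<longrightarrow>
        (\<forall>\<phi>\<in>F P Q. \<forall>\<psi>\<in>F Q R. compose P \<psi> \<phi> \<in> F P R)) \<and>
     (\<forall>P Q. subgroup P S \<longrightarrow> subgroup Q S \<longrightarrow>
        (\<forall>x\<in>carrier S. conj_map S x P ` P \<subseteq> Q \<longrightarrow> conj_map S x P \<in> F P Q)) \<and>
     (\<forall>P Q. subgroup P S \<longrightarrow> subgroup Q S \<longrightarrow> (\<forall>\<phi>\<in>F P Q. \<phi> \<in> fusion_isos S F P (\<phi> ` P)))"

definition conjugates :: "('g, 'x) monoid_scheme \<Rightarrow> 'g fusion \<Rightarrow> 'g set \<Rightarrow> 'g set set" where
  "conjugates S F P = {Q. subgroup Q S \<and> fusion_isos S F P Q \<noteq> {}}"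

definition fully_normalized :: "('g, 'x) monoid_scheme \<Rightarrow> 'g fusion \<Rightarrow> 'g set \<Rightarrow> bool" where
  "fully_normalized S F P \<longleftrightarrow>
     subgroup P S \<and> (\<forall>Q\<in>conjugates S F P. card (normalizer S Q) \<le> card (normalizer S P))"

definition fully_centralized :: "('g, 'x) monoid_scheme \<Rightarrow> 'g fusion \<Rightarrow> 'g set \<Rightarrow> bool" where
  "fully_centralized S F P \<longleftrightarrow>
     subgroup P S \<and> (\<forall>Q\<in>conjugates S F P. card (centralizer S Q) \<le> card (centralizer S P))"

definition Aut_S :: "('g, 'x) monoid_scheme \<Rightarrow> 'g set \<Rightarrow> ('g \<Rightarrow> 'g) set" where
  "Aut_S S P = (\<lambda>g. conj_map S g P) ` normalizer S P"

definition Aut_F :: "'g fusion \<Rightarrow> 'g set \<Rightarrow> ('g \<Rightarrow> 'g) monoid" where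
  "Aut_F F P = BijGroup P\<lparr>carrier := F P P\<rparr>"

definition extender :: "('g, 'x) monoid_scheme \<Rightarrow> 'g set \<Rightarrow> ('g \<Rightarrow> 'g) \<Rightarrow> 'g set" where
    \<comment> \<open>the group $N_\varphi$; the function on $\varphi(P)$ below is $\varphi c_g \varphi^{-1}$\<close>
  "extender S P \<phi> =
     {g \<in> normalizer S P. (\<lambda>y\<in>\<phi> ` P. \<phi> (conj_map S g P (inv_into P \<phi> y))) \<in> Aut_S S (\<phi> ` P)}"

definition saturated :: "nat \<Rightarrow> ('g, 'x) monoid_scheme \<Rightarrow> 'g fusion \<Rightarrow> bool" where
  "saturated p S F \<longleftrightarrow>
     (\<forall>P. fully_normalized S F P \<longrightarrow>
        fully_centralized S F P \<and> sylow_subgroup p (Aut_F F P) (Aut_S S P)) \<and>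
     (\<forall>P. subgroup P S \<longrightarrow> (\<forall>\<phi>\<in>F P (carrier S). fully_centralized S F (\<phi> ` P) \<longrightarrow>
        (\<exists>\<psi>\<in>F (extender S P \<phi>) (carrier S). \<forall>u\<in>P. \<psi> u = \<phi> u)))"

definition centrics :: "('g, 'x) monoid_scheme \<Rightarrow> 'g fusion \<Rightarrow> 'g set set" where
  "centrics S F = {P. subgroup P S \<and> (\<forall>Q\<in>conjugates S F P. centralizer S Q \<subseteq> Q)}"

section \<open>Orbit categories and Mackey functors\<close>

definition orbit_class :: "('g, 'x) monoid_scheme \<Rightarrow> 'g set \<Rightarrow> 'g set \<Rightarrow> ('g \<Rightarrow> 'g) \<Rightarrow> ('g \<Rightarrow> 'g) set" where
    \<comment> \<open>the class of $\varphi \in \mathrm{Hom}_{\mathcal F}(P, Q)$ modulo $\mathrm{Inn}(Q)$\<close>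
  "orbit_class S P Q \<phi> = (\<lambda>q. compose P (conj_map S q Q) \<phi>) ` Q"

text \<open>The pairwise composites of the elements of two classes form the class of the composite.\<close>

definition orbit_category ::
    "('g, 'x) monoid_scheme \<Rightarrow> 'g fusion \<Rightarrow> ('g set, ('g \<Rightarrow> 'g) set) category" where
  "orbit_category S F =
     \<lparr>Obj = {P. subgroup P S},
      Hom = (\<lambda>P Q. orbit_class S P Q ` F P Q),
      Comp = (\<lambda>P Q R b a. {compose P \<psi> \<phi> | \<psi> \<phi>. \<psi> \<in> b \<and> \<phi> \<in> a}),
      Ide = (\<lambda>P. orbit_class S P P (incl P))\<rparr>"

definition centric_orbit_category ::
    "('g, 'x) monoid_scheme \<Rightarrow> 'g fusion \<Rightarrow> ('g set, ('g \<Rightarrow> 'g) set) category" where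
  "centric_orbit_category S F = full_subcategory (orbit_category S F) (centrics S F)"

definition double_coset_reps ::
    "('g, 'x) monoid_scheme \<Rightarrow> 'g set \<Rightarrow> 'g set \<Rightarrow> 'g set \<Rightarrow> 'g set \<Rightarrow> bool" where
    \<comment> \<open>\<open>D\<close> is a set of representatives of $Q \backslash P / R$\<close>
  "double_coset_reps S P Q R D \<longleftrightarrow>
     D \<subseteq> P \<and> (\<forall>y\<in>P. \<exists>!x. x \<in> D \<and> y \<in> Q <#>\<^bsub>S\<^esub> (x <#\<^bsub>S\<^esub> R))"

definition mackey_functor ::
    "('g, 'x) monoid_scheme \<Rightarrow> 'g fusion \<Rightarrow> ('k, 'y) ring_scheme
      \<Rightarrow> ('g set, ('g \<Rightarrow> 'g) set, 'k, 'm) mod_functor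
      \<Rightarrow> ('g set, ('g \<Rightarrow> 'g) set, 'k, 'm) mod_functor \<Rightarrow> bool"
    \<comment> \<open>\<open>U\<close> is the contravariant part $M^*$ and \<open>L\<close> the covariant part $M_*$\<close>
  where
  "mackey_functor S F k U L \<longleftrightarrow>
     (let C = centric_orbit_category S F in
      contravariant_functor C k U \<and> covariant_functor C k L \<and>
      (\<forall>P\<in>Obj C. Ob U P = Ob L P) \<and>
      (\<forall>P\<in>Obj C. \<forall>Q\<in>Obj C. \<forall>a b. inverse_arrows C P Q a b \<longrightarrow>
         (\<forall>v\<in>carrier (Ob U Q). Ar U P Q a v = Ar L Q P b v)) \<and>
      (\<forall>P\<in>Obj C. \<forall>Q\<in>Obj C. \<forall>R\<in>Obj C. \<forall>D.
         Q \<subseteq> P \<longrightarrow> R \<subseteq> P \<longrightarrow> double_coset_reps S P Q R D \<longrightarrow>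
         (\<forall>v\<in>carrier (Ob U R).
            Ar U Q P (orbit_class S Q P (incl Q)) (Ar L R P (orbit_class S R P (incl R)) v) =
            finsum (Ob U Q)
              (\<lambda>x. let T = conj_map S x R ` R in
                Ar L (Q \<inter> T) Q (orbit_class S (Q \<inter> T) Q (incl (Q \<inter> T)))
                  (Ar U (Q \<inter> T) T (orbit_class S (Q \<inter> T) T (incl (Q \<inter> T)))
                    (Ar L R T (orbit_class S R T (conj_map S x R)) v)))
              {x \<in> D. Q \<inter> conj_map S x R ` R \<in> Obj C})))"

definition Z_localized :: "nat \<Rightarrow> rat ring" where
  "Z_localized p =
     \<lparr>carrier = {of_int a / of_int b | a b. \<not> int p dvd b}, monoid.mult = (*), one = 1, ring.zero = 0, ring.add = (+)\<rparr>"

end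

theory Submission
  imports Defs
begin

text \<open>
  Write \<open>C\<close> for the centric orbit category. Saturation implies that products of \<open>S\<close> with an object
  \<open>P\<close> exist in the category of formal coproducts of objects of \<open>C\<close>: a pair of a centric \<open>Q \<le> P\<close> and a
  class of morphisms \<open>Q \<rightarrow> S\<close> lies below a unique maximal such pair, and the \<open>P\<close>-orbits of maximal
  pairs are the summands of \<open>S \<times> P\<close>. Extending a functor \<open>M\<close> additively, the complex obtained from
  \<open>M(S \<times> -)\<close> by taking limits is that of the values at \<open>S\<close>, so \<open>M(S \<times> -)\<close> is acyclic. For a Mackey
  functor the restrictions and transfers along \<open>S \<times> P \<rightarrow> P\<close> are natural (double coset formula);
  their composite \<open>\<tau>\<close> acts on \<open>M(P)\<close> as multiplication by the number of morphisms \<open>P \<rightarrow> S\<close> in \<open>C\<close> up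
  to transfers from smaller subgroups. This number is prime to \<open>p\<close>, because it is congruent modulo
  \<open>p\<close> to the order of the outer automorphism group of \<open>S\<close>, so \<open>\<tau>\<close> has a natural left inverse and \<open>M\<close>
  is a retract of \<open>M(S \<times> -)\<close>.
\<close>

section \<open>Linear and natural maps\<close>

text \<open>Injectivity of the given \<open>J n\<close> is known only against functors with values
  in the type \<open>'n\<close>, whereas \<open>families\<close> has functions as values; as C is
  finite and \<open>'n\<close> infinite, these can be encoded in \<open>'n\<close>. The retraction
  is then lifted to cochain maps from \<open>families C x (J n)\<close> to \<open>J n\<close>, which
  needs \<open>families\<close> to be exact: a limit over \<open>pairs\<close> is only left exact in
  general, but the product decomposition turns it into a finite product of values. A cocycle in the
  limits has a primitive at the object S; pulled back along first projections, this becomes a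
  compatible family without further choices, and the lifted retraction carries it back.

  Centricity acts through one fact: an element centralizing the image of a centric subgroup lies in
  that image. This makes extensions unique up to conjugation in S and separates the double cosets.
  Finally, filter M by vanishing on small subgroups: \<tau> acts on each layer by an integer prime
  to p, so a left inverse up to a unit is a polynomial in \<tau>.\<close>

lemma moduleD:
  assumes "module k M"
  shows "cring k" "abelian_group M"
  using assms by (auto simp: module_def)

lemma (in abelian_group) minus_eq_zero_iff:
  assumes "a \<in> carrier G" "b \<in> carrier G"
  shows "a \<ominus> b = \<zero> \<longleftrightarrow> a = b"
proof
  assume "a \<ominus> b = \<zero>"
  then show "a = b" using assms minus_equality[of a "\<ominus> b"] by (simp add: a_minus_def)
qed (use assms in \<open>simp add: a_minus_def r_neg\<close>)

lemma linear_mapsI: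
  assumes "\<And>v. v \<in> carrier M \<Longrightarrow> f v \<in> carrier N"
    and "\<And>v w. v \<in> carrier M \<Longrightarrow> w \<in> carrier M \<Longrightarrow> f (v \<oplus>\<^bsub>M\<^esub> w) = f v \<oplus>\<^bsub>N\<^esub> f w"
    and "\<And>r v. r \<in> carrier k \<Longrightarrow> v \<in> carrier M \<Longrightarrow> f (r \<odot>\<^bsub>M\<^esub> v) = r \<odot>\<^bsub>N\<^esub> f v"
  shows "f \<in> linear_maps k M N"
  using assms by (auto simp: linear_maps_def hom_def)

lemma linear_closed: "f \<in> linear_maps k M N \<Longrightarrow> v \<in> carrier M \<Longrightarrow> f v \<in> carrier N"
  and linear_add: "f \<in> linear_maps k M N \<Longrightarrow> v \<in> carrier M \<Longrightarrow> w \<in> carrier M \<Longrightarrow>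
    f (v \<oplus>\<^bsub>M\<^esub> w) = f v \<oplus>\<^bsub>N\<^esub> f w"
  and linear_smult: "f \<in> linear_maps k M N \<Longrightarrow> r \<in> carrier k \<Longrightarrow> v \<in> carrier M \<Longrightarrow>
    f (r \<odot>\<^bsub>M\<^esub> v) = r \<odot>\<^bsub>N\<^esub> f v"
  by (auto simp: linear_maps_def hom_def)

context
  fixes k M N f
  assumes M: "module k M" and N: "module k N" and f: "f \<in> linear_maps k M N"
begin

interpretation M: module k M by (rule M)
interpretation N: module k N by (rule N)

lemma linear_zero: "f \<zero>\<^bsub>M\<^esub> = \<zero>\<^bsub>N\<^esub>"
proof -
  have "f (\<zero>\<^bsub>M\<^esub> \<oplus>\<^bsub>M\<^esub> \<zero>\<^bsub>M\<^esub>) = f \<zero>\<^bsub>M\<^esub> \<oplus>\<^bsub>N\<^esub> f \<zero>\<^bsub>M\<^esub>"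
    by (rule linear_add[OF f]) auto
  then have "f \<zero>\<^bsub>M\<^esub> = f \<zero>\<^bsub>M\<^esub> \<oplus>\<^bsub>N\<^esub> f \<zero>\<^bsub>M\<^esub>" by simp
  then show ?thesis
    using linear_closed[OF f M.zero_closed] by (metis N.M.add.r_cancel_one')
qed

lemma linear_uminus:
  assumes "v \<in> carrier M"
  shows "f (\<ominus>\<^bsub>M\<^esub> v) = \<ominus>\<^bsub>N\<^esub> f v"
proof -
  have "f (\<ominus>\<^bsub>M\<^esub> v) \<oplus>\<^bsub>N\<^esub> f v = \<zero>\<^bsub>N\<^esub>"
    using linear_add[OF f, of "\<ominus>\<^bsub>M\<^esub> v" v] assms by (simp add: M.l_neg linear_zero)
  then show ?thesis
    using assms by (simp add: N.minus_equality linear_closed[OF f])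
qed

lemma linear_minus:
  assumes "v \<in> carrier M" "w \<in> carrier M"
  shows "f (v \<ominus>\<^bsub>M\<^esub> w) = f v \<ominus>\<^bsub>N\<^esub> f w"
  using assms by (simp add: a_minus_def linear_add[OF f] linear_uminus)

lemma linear_finsum:
  assumes "finite A" "\<And>i. i \<in> A \<Longrightarrow> g i \<in> carrier M"
  shows "f (finsum M g A) = finsum N (\<lambda>i. f (g i)) A"
  using assms
proof (induction rule: finite_induct)
  case empty
  then show ?case by (simp add: linear_zero)
next
  case (insert x F)
  have "finsum M g (insert x F) = g x \<oplus>\<^bsub>M\<^esub> finsum M g F"
    using insert by (intro M.finsum_insert) auto
  moreover have "finsum N (\<lambda>i. f (g i)) (insert x F) = f (g x) \<oplus>\<^bsub>N\<^esub> finsum N (\<lambda>i. f (g i)) F"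
    using insert by (intro N.finsum_insert) (auto intro: linear_closed[OF f])
  moreover have "finsum M g F \<in> carrier M"
    using insert by (intro M.finsum_closed) auto
  ultimately show ?case
    using insert by (simp add: linear_add[OF f])
qed

end

lemma linear_comp:
  assumes "f \<in> linear_maps k M N" "g \<in> linear_maps k N L"
  shows "(\<lambda>v. g (f v)) \<in> linear_maps k M L"
  using assms by (intro linear_mapsI) (auto simp: linear_closed linear_add linear_smult)

lemma linear_id: "(\<lambda>v. v) \<in> linear_maps k M M"
  by (rule linear_mapsI) auto

lemma linear_plus:
  assumes "module k M" "module k N" "f \<in> linear_maps k M N" "g \<in> linear_maps k M N"
  shows "(\<lambda>v. f v \<oplus>\<^bsub>N\<^esub> g v) \<in> linear_maps k M N"
proof -
  interpret N: module k N by fact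
  show ?thesis
    using assms by (intro linear_mapsI)
      (auto simp: linear_closed linear_add linear_smult N.M.a_ac N.smult_r_distr)
qed

lemma linear_diff:
  assumes "module k M" "module k N" "f \<in> linear_maps k M N" "g \<in> linear_maps k M N"
  shows "(\<lambda>v. f v \<ominus>\<^bsub>N\<^esub> g v) \<in> linear_maps k M N"
proof -
  interpret N: module k N by fact
  have [simp]: "r \<odot>\<^bsub>N\<^esub> (\<ominus>\<^bsub>N\<^esub> w) = \<ominus>\<^bsub>N\<^esub> (r \<odot>\<^bsub>N\<^esub> w)" if "r \<in> carrier k" "w \<in> carrier N" for r w
    using that by (simp add: N.smult_r_minus)
  show ?thesis
    using assms by (intro linear_mapsI)
      (auto simp: linear_closed linear_add linear_smult N.M.a_ac N.smult_r_distr a_minus_def N.M.minus_add)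
qed

lemma linear_scale:
  assumes "module k M" "r \<in> carrier k"
  shows "(\<lambda>v. r \<odot>\<^bsub>M\<^esub> v) \<in> linear_maps k M M"
proof -
  interpret M: module k M by fact
  show ?thesis
    using assms by (intro linear_mapsI)
      (auto simp: M.smult_r_distr simp flip: M.smult_assoc1, simp add: M.R.m_comm)
qed

lemma contraD:
  assumes "contravariant_functor C k M"
  shows contra_module: "x \<in> Obj C \<Longrightarrow> module k (Ob M x)"
    and contra_linear: "x \<in> Obj C \<Longrightarrow> y \<in> Obj C \<Longrightarrow> a \<in> Hom C x y \<Longrightarrow>
      Ar M x y a \<in> linear_maps k (Ob M y) (Ob M x)"
    and contra_ide: "x \<in> Obj C \<Longrightarrow> v \<in> carrier (Ob M x) \<Longrightarrow> Ar M x x (Ide C x) v = v"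
    and contra_comp: "x \<in> Obj C \<Longrightarrow> y \<in> Obj C \<Longrightarrow> z \<in> Obj C \<Longrightarrow> a \<in> Hom C x y \<Longrightarrow>
      b \<in> Hom C y z \<Longrightarrow> v \<in> carrier (Ob M z) \<Longrightarrow>
      Ar M x z (Comp C x y z b a) v = Ar M x y a (Ar M y z b v)"
  using assms by (auto simp: contravariant_functor_def)

lemma contra_closed:
  assumes "contravariant_functor C k M" "x \<in> Obj C" "y \<in> Obj C" "a \<in> Hom C x y" "v \<in> carrier (Ob M y)"
  shows "Ar M x y a v \<in> carrier (Ob M x)"
  using assms contra_linear linear_closed by metis

lemma naturalD:
  assumes "\<eta> \<in> natural_maps C k M N"
  shows natural_linear: "x \<in> Obj C \<Longrightarrow> \<eta> x \<in> linear_maps k (Ob M x) (Ob N x)"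
    and natural_natural: "x \<in> Obj C \<Longrightarrow> y \<in> Obj C \<Longrightarrow> a \<in> Hom C x y \<Longrightarrow> v \<in> carrier (Ob M y) \<Longrightarrow>
       \<eta> x (Ar M x y a v) = Ar N x y a (\<eta> y v)"
  using assms by (auto simp: natural_maps_def)

lemma natural_closed:
  "\<eta> \<in> natural_maps C k M N \<Longrightarrow> x \<in> Obj C \<Longrightarrow> v \<in> carrier (Ob M x) \<Longrightarrow> \<eta> x v \<in> carrier (Ob N x)"
  using natural_linear linear_closed by metis

lemma natural_comp:
  assumes "\<eta> \<in> natural_maps C k M N" "\<mu> \<in> natural_maps C k N L"
  shows "(\<lambda>x v. \<mu> x (\<eta> x v)) \<in> natural_maps C k M L"
  using natural_linear[OF assms(1)] natural_linear[OF assms(2)]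
    natural_natural[OF assms(1)] natural_natural[OF assms(2)] natural_closed[OF assms(1)]
  unfolding natural_maps_def by (auto intro: linear_comp)

lemma natural_plus:
  assumes "contravariant_functor C k M" "contravariant_functor C k N"
    "\<eta> \<in> natural_maps C k M N" "\<mu> \<in> natural_maps C k M N"
  shows "(\<lambda>x v. \<eta> x v \<oplus>\<^bsub>Ob N x\<^esub> \<mu> x v) \<in> natural_maps C k M N"
  using natural_linear[OF assms(3)] natural_linear[OF assms(4)]
    natural_natural[OF assms(3)] natural_natural[OF assms(4)]
    natural_closed[OF assms(3)] natural_closed[OF assms(4)]
    contra_module[OF assms(1)] contra_module[OF assms(2)]
  unfolding natural_maps_def
  by (auto intro!: linear_plus simp: linear_add[OF contra_linear[OF assms(2)]])

lemma natural_diff: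
  assumes "contravariant_functor C k M" "contravariant_functor C k N"
    "\<eta> \<in> natural_maps C k M N" "\<mu> \<in> natural_maps C k M N"
  shows "(\<lambda>x v. \<eta> x v \<ominus>\<^bsub>Ob N x\<^esub> \<mu> x v) \<in> natural_maps C k M N"
  using natural_linear[OF assms(3)] natural_linear[OF assms(4)]
    natural_natural[OF assms(3)] natural_natural[OF assms(4)]
    natural_closed[OF assms(3)] natural_closed[OF assms(4)]
    contra_module[OF assms(1)] contra_module[OF assms(2)]
  unfolding natural_maps_def
  by (auto intro!: linear_diff simp: linear_minus[OF contra_module[OF assms(2)] contra_module[OF assms(2)] contra_linear[OF assms(2)]])

lemma natural_scale:
  assumes "contravariant_functor C k M" "r \<in> carrier k"
  shows "(\<lambda>x v. r \<odot>\<^bsub>Ob M x\<^esub> v) \<in> natural_maps C k M M"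
  using assms contra_linear[OF assms(1)] contra_module
  unfolding natural_maps_def by (auto intro!: linear_scale simp: linear_smult[OF contra_linear[OF assms(1)]])

lemma natural_id: "(\<lambda>x v. v) \<in> natural_maps C k M M"
  unfolding natural_maps_def by (auto intro: linear_id)

section \<open>Injectivity against functors whose values lie in another type\<close>

section \<open>Extension of natural maps into injective functors\<close>

text \<open>Operations are read back through the inverse of \<open>h\<close> on all of
  \<open>carrier M\<close>, not just on \<open>A\<close>. A submodule and the whole module therefore
  get literally the same operations, and the inclusion between their copies is the identity
  function.\<close>

definition transport_module :: "('b \<Rightarrow> 'c) \<Rightarrow> ('k, 'b) module \<Rightarrow> 'b set \<Rightarrow> ('k, 'c) module" where
  "transport_module h M A = (let g = inv_into (carrier M) h in
     \<lparr>carrier = h ` A, monoid.mult = undefined, one = undefined, ring.zero = h \<zero>\<^bsub>M\<^esub>,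
      ring.add = (\<lambda>v w. h (g v \<oplus>\<^bsub>M\<^esub> g w)), module.smult = (\<lambda>r v. h (r \<odot>\<^bsub>M\<^esub> g v))\<rparr>)"

lemma abelian_groupI_module:
  assumes "\<zero>\<^bsub>M\<^esub> \<in> carrier M"
    "\<And>u v. u \<in> carrier M \<Longrightarrow> v \<in> carrier M \<Longrightarrow> u \<oplus>\<^bsub>M\<^esub> v \<in> carrier M"
    "\<And>u v. u \<in> carrier M \<Longrightarrow> v \<in> carrier M \<Longrightarrow> u \<oplus>\<^bsub>M\<^esub> v = v \<oplus>\<^bsub>M\<^esub> u"
    "\<And>u v w. u \<in> carrier M \<Longrightarrow> v \<in> carrier M \<Longrightarrow> w \<in> carrier M \<Longrightarrow> u \<oplus>\<^bsub>M\<^esub> v \<oplus>\<^bsub>M\<^esub> w = u \<oplus>\<^bsub>M\<^esub> (v \<oplus>\<^bsub>M\<^esub> w)"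
    "\<And>u. u \<in> carrier M \<Longrightarrow> \<zero>\<^bsub>M\<^esub> \<oplus>\<^bsub>M\<^esub> u = u"
    "\<And>u. u \<in> carrier M \<Longrightarrow> \<exists>v\<in>carrier M. v \<oplus>\<^bsub>M\<^esub> u = \<zero>\<^bsub>M\<^esub>"
  shows "abelian_group M"
  using assms by (intro abelian_groupI) auto

lemma transport_module:
  assumes "module k M" "inj_on h (carrier M)" "A \<subseteq> carrier M" "\<zero>\<^bsub>M\<^esub> \<in> A"
    and add: "\<And>u v. u \<in> A \<Longrightarrow> v \<in> A \<Longrightarrow> u \<oplus>\<^bsub>M\<^esub> v \<in> A"
    and smult: "\<And>r v. r \<in> carrier k \<Longrightarrow> v \<in> A \<Longrightarrow> r \<odot>\<^bsub>M\<^esub> v \<in> A"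
  shows "module k (transport_module h M A)"
proof -
  interpret M: module k M by fact
  have [simp]: "inv_into (carrier M) h (h u) = u" if "u \<in> carrier M" for u
    using assms(2) that by simp
  have A: "u \<in> carrier M" if "u \<in> A" for u using that assms by auto
  \<comment> \<open>Closure under negation comes from closure under scalars: the negative of u is
    its multiple by minus one.\<close>
  have neg: "\<ominus>\<^bsub>M\<^esub> u \<in> A" if "u \<in> A" for u
    using smult[of "\<ominus>\<^bsub>k\<^esub> \<one>\<^bsub>k\<^esub>" u] that A by (simp add: M.smult_l_minus)
  show ?thesis
  proof (rule moduleI)
    show "abelian_group (transport_module h M A)"
    proof (rule abelian_groupI_module, goal_cases)
      case (6 u)
      then obtain u' where u': "u' \<in> A" "u = h u'" by (auto simp: transport_module_def Let_def)
      then have "h (\<ominus>\<^bsub>M\<^esub> u') \<in> carrier (transport_module h M A)"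
        by (auto simp: transport_module_def Let_def neg)
      moreover have "h (\<ominus>\<^bsub>M\<^esub> u') \<oplus>\<^bsub>transport_module h M A\<^esub> u = \<zero>\<^bsub>transport_module h M A\<^esub>"
        using u' A by (simp add: transport_module_def Let_def M.l_neg)
      ultimately show ?case by blast
    qed (use A assms in \<open>auto simp: transport_module_def Let_def M.M.a_ac\<close>)
  qed (use A assms(3) smult add M.R.is_cring in \<open>auto simp: transport_module_def Let_def M.smult_l_distr M.smult_r_distr M.smult_assoc1\<close>)
qed

text \<open>The values of \<open>B\<close> may live in another type than those of the injective functor \<open>J\<close>: an
  encoding of them in the type of \<open>J\<close> is enough.\<close>

lemma injective_extension:
  fixes J :: "('o, 'a, 'k, 'n) mod_functor" and enc :: "'o \<Rightarrow> 'b \<Rightarrow> 'n"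
  assumes J: "injective_functor C k J"
    and A: "contravariant_functor C k A" and B: "contravariant_functor C k B"
    and \<delta>: "\<delta> \<in> natural_maps C k A B" and \<phi>: "\<phi> \<in> natural_maps C k A J"
    and enc: "\<And>x. x \<in> Obj C \<Longrightarrow> inj_on (enc x) (carrier (Ob B x))"
    and ker: "\<And>x v. x \<in> Obj C \<Longrightarrow> v \<in> carrier (Ob A x) \<Longrightarrow> \<delta> x v = \<zero>\<^bsub>Ob B x\<^esub> \<Longrightarrow> \<phi> x v = \<zero>\<^bsub>Ob J x\<^esub>"
  shows "\<exists>g\<in>natural_maps C k B J. \<forall>x\<in>Obj C. \<forall>v\<in>carrier (Ob A x). g x (\<delta> x v) = \<phi> x v"
proof -
  have J': "contravariant_functor C k J" using J by (simp add: injective_functor_def)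
  define dec where "dec x = inv_into (carrier (Ob B x)) (enc x)" for x
  have dec [simp]: "dec x (enc x v) = v" if "x \<in> Obj C" "v \<in> carrier (Ob B x)" for x v
    using enc that by (simp add: dec_def)
  \<comment> \<open>\<open>I\<close> is the image of \<open>\<delta>\<close>; \<open>B'\<close> is a
    copy of \<open>B\<close> inside the type of \<open>J\<close>, and \<open>A'\<close> the copy of
    the image. Injectivity of \<open>J\<close> applies to the inclusion of \<open>A'\<close> in
    \<open>B'\<close>.\<close>
  define I where "I x = \<delta> x ` carrier (Ob A x)" for x
  define ar where "ar x y a v = enc x (Ar B x y a (dec y v))" for x y a v
  define B' where "B' = \<lparr>Ob = (\<lambda>x. transport_module (enc x) (Ob B x) (carrier (Ob B x))), Ar = ar\<rparr>"
  define A' where "A' = \<lparr>Ob = (\<lambda>x. transport_module (enc x) (Ob B x) (I x)), Ar = ar\<rparr>"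
  note Bm = contra_module[OF B] and Am = contra_module[OF A] and Jm = contra_module[OF J']
  note \<delta>l = natural_linear[OF \<delta>]
  note \<phi>l = natural_linear[OF \<phi>]
  note Bl = contra_linear[OF B]
  note Bc = contra_closed[OF B]
  have carB: "carrier (Ob B' x) = enc x ` carrier (Ob B x)"
    and carA: "carrier (Ob A' x) = enc x ` I x" for x
    by (simp_all add: B'_def A'_def transport_module_def Let_def)
  have IB: "v \<in> carrier (Ob B x)" if "x \<in> Obj C" "v \<in> I x" for x v
    using that linear_closed[OF \<delta>l] by (auto simp: I_def)
  have Izero: "\<zero>\<^bsub>Ob B x\<^esub> \<in> I x" if x: "x \<in> Obj C" for x
  proof -
    interpret A: module k "Ob A x" by (rule Am[OF x])
    show ?thesis using linear_zero[OF Am[OF x] Bm[OF x] \<delta>l[OF x]] unfolding I_def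
      by (metis A.zero_closed image_eqI)
  qed
  have Iadd: "u \<oplus>\<^bsub>Ob B x\<^esub> v \<in> I x" if x: "x \<in> Obj C" and uv: "u \<in> I x" "v \<in> I x" for x u v
  proof -
    interpret A: module k "Ob A x" by (rule Am[OF x])
    show ?thesis using uv unfolding I_def by (auto simp flip: linear_add[OF \<delta>l[OF x]])
  qed
  have Ismult: "r \<odot>\<^bsub>Ob B x\<^esub> v \<in> I x" if x: "x \<in> Obj C" and uv: "r \<in> carrier k" "v \<in> I x" for x r v
  proof -
    interpret A: module k "Ob A x" by (rule Am[OF x])
    show ?thesis using uv unfolding I_def by (auto simp flip: linear_smult[OF \<delta>l[OF x]])
  qed
  have Iar: "Ar B x y a v \<in> I x" if "x \<in> Obj C" "y \<in> Obj C" "a \<in> Hom C x y" "v \<in> I y" for x y a v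
    using that natural_natural[OF \<delta>] contra_closed[OF A] unfolding I_def by force
  have B'c: "contravariant_functor C k B'"
    unfolding contravariant_functor_def
  proof (intro conjI ballI)
    fix x assume x: "x \<in> Obj C"
    interpret B: module k "Ob B x" by (rule Bm[OF x])
    show "module k (Ob B' x)"
      unfolding B'_def mod_functor.simps by (rule transport_module) (use x in \<open>auto simp: Bm enc\<close>)
    fix v assume "v \<in> carrier (Ob B' x)"
    then show "Ar B' x x (Ide C x) v = v"
      using x by (auto simp: carB) (simp add: B'_def ar_def contra_ide[OF B])
  next
    fix x y a assume *: "x \<in> Obj C" "y \<in> Obj C" "a \<in> Hom C x y"
    interpret By: module k "Ob B y" by (rule Bm[OF *(2)])
    show "Ar B' x y a \<in> linear_maps k (Ob B' y) (Ob B' x)"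
      using * by (intro linear_mapsI)
        (auto simp: B'_def transport_module_def Let_def ar_def Bc linear_add[OF Bl] linear_smult[OF Bl] dec_def[symmetric])
  next
    fix x y z a b v assume "x \<in> Obj C" "y \<in> Obj C" "z \<in> Obj C" "a \<in> Hom C x y" "b \<in> Hom C y z"
      "v \<in> carrier (Ob B' z)"
    then show "Ar B' x z (Comp C x y z b a) v = Ar B' x y a (Ar B' y z b v)"
      by (auto simp: carB) (simp add: B'_def ar_def contra_comp[OF B] Bc)
  qed
  have A'c: "contravariant_functor C k A'"
    unfolding contravariant_functor_def
  proof (intro conjI ballI)
    fix x assume x: "x \<in> Obj C"
    interpret B: module k "Ob B x" by (rule Bm[OF x])
    show "module k (Ob A' x)"
      unfolding A'_def mod_functor.simps
      by (rule transport_module) (use x in \<open>auto simp: Bm enc IB Izero Iadd Ismult\<close>)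
    fix v assume "v \<in> carrier (Ob A' x)"
    then show "Ar A' x x (Ide C x) v = v"
      using x by (auto simp: carA) (simp add: A'_def ar_def contra_ide[OF B] IB)
  next
    fix x y a assume *: "x \<in> Obj C" "y \<in> Obj C" "a \<in> Hom C x y"
    interpret By: module k "Ob B y" by (rule Bm[OF *(2)])
    show "Ar A' x y a \<in> linear_maps k (Ob A' y) (Ob A' x)"
      using * by (intro linear_mapsI)
        (auto simp: A'_def transport_module_def Let_def ar_def Bc IB Iar Iadd linear_add[OF Bl] linear_smult[OF Bl] dec_def[symmetric])
  next
    fix x y z a b v assume "x \<in> Obj C" "y \<in> Obj C" "z \<in> Obj C" "a \<in> Hom C x y" "b \<in> Hom C y z"
      "v \<in> carrier (Ob A' z)"
    then show "Ar A' x z (Comp C x y z b a) v = Ar A' x y a (Ar A' y z b v)"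
      by (auto simp: carA) (simp add: A'_def ar_def contra_comp[OF B] Bc IB)
  qed
  have j: "(\<lambda>x v. v) \<in> natural_maps C k A' B'"
    unfolding natural_maps_def
    by (auto intro!: linear_mapsI simp: A'_def B'_def transport_module_def Let_def IB)
  define lift where "lift x w = (SOME v. v \<in> carrier (Ob A x) \<and> \<delta> x v = w)" for x w
  have lift: "lift x w \<in> carrier (Ob A x)" "\<delta> x (lift x w) = w" if "w \<in> I x" for x w
  proof -
    have "\<exists>v. v \<in> carrier (Ob A x) \<and> \<delta> x v = w" using that by (auto simp: I_def)
    then show "lift x w \<in> carrier (Ob A x)" "\<delta> x (lift x w) = w"
      unfolding lift_def by (metis (mono_tags, lifting) someI_ex)+
  qed
  \<comment> \<open>The choice made in \<open>lift\<close> is harmless: two preimages differ by an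
    element of the kernel of \<open>\<delta>\<close>, where \<open>\<phi>\<close> vanishes by
    \<open>ker\<close>.\<close>
  have \<phi>eq: "\<phi> x v = \<phi> x w" if "x \<in> Obj C" "v \<in> carrier (Ob A x)" "w \<in> carrier (Ob A x)"
    "\<delta> x v = \<delta> x w" for x v w
  proof -
    interpret A: module k "Ob A x" by (rule Am[OF that(1)])
    interpret B: module k "Ob B x" by (rule Bm[OF that(1)])
    interpret J: module k "Ob J x" by (rule Jm[OF that(1)])
    note lin = \<delta>l[OF that(1)] \<phi>l[OF that(1)]
    have "\<delta> x (v \<ominus>\<^bsub>Ob A x\<^esub> w) = \<zero>\<^bsub>Ob B x\<^esub>"
      using that by (simp add: linear_minus[OF A.module_axioms B.module_axioms lin(1)] linear_closed[OF lin(1)]) (simp add: that linear_closed[OF lin(1)] B.M.r_neg a_minus_def)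
    then have "\<phi> x (v \<ominus>\<^bsub>Ob A x\<^esub> w) = \<zero>\<^bsub>Ob J x\<^esub>" using that by (intro ker) auto
    then show ?thesis
      using that by (simp add: linear_minus[OF A.module_axioms J.module_axioms lin(2)] linear_closed[OF lin(2)] J.M.minus_eq_zero_iff)
  qed
  \<comment> \<open>The map that \<open>\<phi>\<close> induces on the image of
    \<open>\<delta>\<close>, read on the encoded copy.\<close>
  define f where "f x v = \<phi> x (lift x (dec x v))" for x v
  have f: "f x (enc x (\<delta> x v)) = \<phi> x v" if "x \<in> Obj C" "v \<in> carrier (Ob A x)" for x v
  proof -
    have "\<delta> x v \<in> I x" using that by (auto simp: I_def)
    then show ?thesis using that lift[of "\<delta> x v" x] IB by (auto simp: f_def intro: \<phi>eq)
  qed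
  have fnat: "f \<in> natural_maps C k A' J"
    unfolding natural_maps_def mem_Collect_eq
  proof (intro conjI ballI)
    fix x assume x: "x \<in> Obj C"
    interpret A: module k "Ob A x" by (rule Am[OF x])
    have [simp]: "inv_into (carrier (Ob B x)) (enc x) = dec x" by (simp add: dec_def)
    note lin = \<delta>l[OF x] \<phi>l[OF x]
    show "f x \<in> linear_maps k (Ob A' x) (Ob J x)"
    proof (rule linear_mapsI, goal_cases)
      case (1 v)
      then show ?case using x by (auto simp: carA I_def f linear_closed[OF lin(2)])
    next
      case (2 v w)
      then obtain v' w' where *: "v' \<in> carrier (Ob A x)" "w' \<in> carrier (Ob A x)"
        "v = enc x (\<delta> x v')" "w = enc x (\<delta> x w')" by (auto simp: carA I_def)
      then have "v \<oplus>\<^bsub>Ob A' x\<^esub> w = enc x (\<delta> x (v' \<oplus>\<^bsub>Ob A x\<^esub> w'))"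
        using x by (simp add: A'_def transport_module_def Let_def linear_add[OF lin(1)] linear_closed[OF lin(1)])
      then show ?case using * x by (simp add: f linear_add[OF lin(2)])
    next
      case (3 r v)
      then obtain v' where *: "v' \<in> carrier (Ob A x)"
        "v = enc x (\<delta> x v')" by (auto simp: carA I_def)
      then have "r \<odot>\<^bsub>Ob A' x\<^esub> v = enc x (\<delta> x (r \<odot>\<^bsub>Ob A x\<^esub> v'))"
        using x 3 by (simp add: A'_def transport_module_def Let_def linear_smult[OF lin(1)] linear_closed[OF lin(1)])
      then show ?case using * x 3 by (simp add: f linear_smult[OF lin(2)])
    qed
  next
    fix x y a v assume *: "x \<in> Obj C" "y \<in> Obj C" "a \<in> Hom C x y" "v \<in> carrier (Ob A' y)"
    then obtain v' where v': "v' \<in> carrier (Ob A y)" "v = enc y (\<delta> y v')" by (auto simp: carA I_def)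
    then have "Ar A' x y a v = enc x (\<delta> x (Ar A x y a v'))"
      using * by (simp add: A'_def ar_def natural_natural[OF \<delta>] linear_closed[OF \<delta>l])
    then show "f x (Ar A' x y a v) = Ar J x y a (f y v)"
      using * v' by (simp add: f contra_closed[OF A] natural_natural[OF \<phi>])
  qed
  have "\<forall>x\<in>Obj C. inj_on (\<lambda>v. v) (carrier (Ob A' x))" by simp
  then have "\<exists>g\<in>natural_maps C k B' J. \<forall>x\<in>Obj C. \<forall>v\<in>carrier (Ob A' x). g x v = f x v"
    using J[unfolded injective_functor_def, THEN conjunct2, rule_format, OF A'c B'c j fnat] by blast
  then obtain g where g: "g \<in> natural_maps C k B' J"
    "\<And>x v. x \<in> Obj C \<Longrightarrow> v \<in> carrier (Ob A' x) \<Longrightarrow> g x v = f x v"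
    by blast
  have enc_nat: "enc \<in> natural_maps C k B B'"
    unfolding natural_maps_def
    by (auto intro!: linear_mapsI simp: B'_def transport_module_def Let_def ar_def dec_def[symmetric])
  show ?thesis
  proof (intro bexI[of _ "\<lambda>x v. g x (enc x v)"] ballI)
    show "(\<lambda>x v. g x (enc x v)) \<in> natural_maps C k B J" by (rule natural_comp[OF enc_nat g(1)])
    fix x v assume "x \<in> Obj C" "v \<in> carrier (Ob A x)"
    then show "g x (enc x (\<delta> x v)) = \<phi> x v" by (simp add: g(2) carA I_def f)
  qed
qed

section \<open>Limits as modules of compatible families\<close>

section \<open>Limits\<close>

text \<open>The part of a functor on which the module structure of a limit rests: modules and linear
  arrows. For \<open>pairs C x y\<close> it can be checked directly, without treating
  \<open>pairs\<close> as a category in its own right.\<close>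

definition diagram :: "('o, 'a) category \<Rightarrow> ('k, 'x) ring_scheme \<Rightarrow> ('o, 'a, 'k, 'm) mod_functor \<Rightarrow> bool" where
  "diagram C k M \<longleftrightarrow> (\<forall>x\<in>Obj C. module k (Ob M x)) \<and>
     (\<forall>x\<in>Obj C. \<forall>y\<in>Obj C. \<forall>a\<in>Hom C x y. Ar M x y a \<in> linear_maps k (Ob M y) (Ob M x))"

lemma diagramI: "contravariant_functor C k M \<Longrightarrow> diagram C k M"
  by (simp add: contravariant_functor_def diagram_def)

lemma limit_simps:
  "s \<in> carrier (limit C M) \<longleftrightarrow> s \<in> (\<Pi>\<^sub>E x\<in>Obj C. carrier (Ob M x)) \<and>
     (\<forall>x\<in>Obj C. \<forall>y\<in>Obj C. \<forall>a\<in>Hom C x y. Ar M x y a (s y) = s x)"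
  "\<zero>\<^bsub>limit C M\<^esub> = (\<lambda>x\<in>Obj C. \<zero>\<^bsub>Ob M x\<^esub>)"
  "s \<oplus>\<^bsub>limit C M\<^esub> t = (\<lambda>x\<in>Obj C. s x \<oplus>\<^bsub>Ob M x\<^esub> t x)"
  "r \<odot>\<^bsub>limit C M\<^esub> s = (\<lambda>x\<in>Obj C. r \<odot>\<^bsub>Ob M x\<^esub> s x)"
  by (simp_all add: limit_def)

lemma limitD:
  assumes "s \<in> carrier (limit C M)"
  shows "x \<in> Obj C \<Longrightarrow> s x \<in> carrier (Ob M x)"
    and "x \<in> Obj C \<Longrightarrow> y \<in> Obj C \<Longrightarrow> a \<in> Hom C x y \<Longrightarrow> Ar M x y a (s y) = s x"
    and "x \<notin> Obj C \<Longrightarrow> s x = undefined"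
  using assms by (auto simp: limit_simps)

lemma limitI:
  assumes "\<And>x. x \<in> Obj C \<Longrightarrow> f x \<in> carrier (Ob M x)"
    and "\<And>x y a. x \<in> Obj C \<Longrightarrow> y \<in> Obj C \<Longrightarrow> a \<in> Hom C x y \<Longrightarrow> Ar M x y a (f y) = f x"
  shows "(\<lambda>x\<in>Obj C. f x) \<in> carrier (limit C M)"
  using assms by (auto simp: limit_simps)

lemma limit_eqI:
  assumes "s \<in> carrier (limit C M)" "t \<in> carrier (limit C N)" "\<And>x. x \<in> Obj C \<Longrightarrow> s x = t x"
  shows "s = t"
  using assms by (intro ext) (metis limitD(3))

lemma limit_module:
  assumes "cring k" "diagram C k M"
  shows "module k (limit C M)"
proof -
  have mod: "module k (Ob M x)" if "x \<in> Obj C" for x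
    using that assms by (simp add: diagram_def)
  have lin: "Ar M x y a \<in> linear_maps k (Ob M y) (Ob M x)"
    if "x \<in> Obj C" "y \<in> Obj C" "a \<in> Hom C x y" for x y a
    using that assms by (simp add: diagram_def)
  have am: "abelian_monoid (Ob M x)" and ag: "abelian_group (Ob M x)" if "x \<in> Obj C" for x
    using moduleD[OF mod[OF that]] by (auto simp: abelian_group_def)
  have zero: "\<zero>\<^bsub>limit C M\<^esub> \<in> carrier (limit C M)"
    unfolding limit_simps(2)
  proof (rule limitI)
    show "Ar M x y a \<zero>\<^bsub>Ob M y\<^esub> = \<zero>\<^bsub>Ob M x\<^esub>" if "x \<in> Obj C" "y \<in> Obj C" "a \<in> Hom C x y" for x y a
      by (rule linear_zero[OF mod mod lin]) (use that in auto)
  qed (rule abelian_monoid.zero_closed[OF am])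
  have add: "s \<oplus>\<^bsub>limit C M\<^esub> t \<in> carrier (limit C M)"
    if st: "s \<in> carrier (limit C M)" "t \<in> carrier (limit C M)" for s t
    unfolding limit_simps(3)
  proof (rule limitI)
    show "Ar M x y a (s y \<oplus>\<^bsub>Ob M y\<^esub> t y) = s x \<oplus>\<^bsub>Ob M x\<^esub> t x"
      if "x \<in> Obj C" "y \<in> Obj C" "a \<in> Hom C x y" for x y a
      using that st by (simp add: linear_add[OF lin] limitD(1,2)[OF st(1)] limitD(1,2)[OF st(2)])
  qed (use st in \<open>simp add: abelian_monoid.a_closed[OF am] limitD(1)\<close>)
  have smult: "r \<odot>\<^bsub>limit C M\<^esub> s \<in> carrier (limit C M)"
    if rs: "s \<in> carrier (limit C M)" "r \<in> carrier k" for r s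
    unfolding limit_simps(4)
  proof (rule limitI)
    show "Ar M x y a (r \<odot>\<^bsub>Ob M y\<^esub> s y) = r \<odot>\<^bsub>Ob M x\<^esub> s x"
      if "x \<in> Obj C" "y \<in> Obj C" "a \<in> Hom C x y" for x y a
      using that rs by (simp add: linear_smult[OF lin] limitD(1,2)[OF rs(1)])
  qed (use rs in \<open>simp add: module.smult_closed[OF mod] limitD(1)\<close>)
  have ext: "s \<in> extensional (Obj C)" if "s \<in> carrier (limit C M)" for s
    using that by (auto simp: limit_simps PiE_def)
  show ?thesis
  proof (rule moduleI)
    show "abelian_group (limit C M)"
    proof (rule abelian_groupI_module, goal_cases)
      case (3 s t)
      then show ?case unfolding limit_simps(3)
        by (auto intro!: extensionalityI[where A = "Obj C"] simp: abelian_monoid.a_comm[OF am] limitD(1))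
    next
      case (4 s t u)
      then show ?case by (auto intro!: extensionalityI[where A = "Obj C"] simp: limit_simps(2-4) abelian_monoid.a_assoc[OF am] limitD(1))
    next
      case (5 s)
      then show ?case
        by (intro extensionalityI[OF ext[OF add[OF zero 5]] ext[OF 5]])
          (auto simp: limit_simps(2-4) abelian_monoid.l_zero[OF am] limitD(1))
    next
      case (6 s)
      \<comment> \<open>The negative is written as a scalar multiple, so that its compatibility is
        already covered by \<open>smult\<close>.\<close>
      have "(\<ominus>\<^bsub>k\<^esub> \<one>\<^bsub>k\<^esub>) \<odot>\<^bsub>limit C M\<^esub> s \<oplus>\<^bsub>limit C M\<^esub> s = \<zero>\<^bsub>limit C M\<^esub>"
      proof -
        have "(\<ominus>\<^bsub>k\<^esub> \<one>\<^bsub>k\<^esub>) \<odot>\<^bsub>Ob M x\<^esub> s x \<oplus>\<^bsub>Ob M x\<^esub> s x = \<zero>\<^bsub>Ob M x\<^esub>" if x: "x \<in> Obj C" for x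
        proof -
          interpret X: module k "Ob M x" by (rule mod[OF x])
          show ?thesis using limitD(1)[OF 6 x] by (simp add: X.smult_l_minus X.l_neg)
        qed
        then show ?thesis by (auto intro!: extensionalityI[where A = "Obj C"] simp: limit_simps(2-4))
      qed
      moreover have "\<ominus>\<^bsub>k\<^esub> \<one>\<^bsub>k\<^esub> \<in> carrier k"
      proof -
        interpret k: cring k by fact
        show ?thesis by simp
      qed
      ultimately show ?case using smult[OF 6] by blast
    qed (use zero add in auto)
  next
    fix r s t assume "r \<in> carrier k" "s \<in> carrier (limit C M)" "t \<in> carrier (limit C M)"
    then show "r \<odot>\<^bsub>limit C M\<^esub> (s \<oplus>\<^bsub>limit C M\<^esub> t) = r \<odot>\<^bsub>limit C M\<^esub> s \<oplus>\<^bsub>limit C M\<^esub> r \<odot>\<^bsub>limit C M\<^esub> t"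
      by (auto intro!: extensionalityI[where A = "Obj C"] simp: limit_simps(2-4) module.smult_r_distr[OF mod] limitD(1))
  next
    fix r r' s assume "r \<in> carrier k" "r' \<in> carrier k" "s \<in> carrier (limit C M)"
    then show "(r \<oplus>\<^bsub>k\<^esub> r') \<odot>\<^bsub>limit C M\<^esub> s = r \<odot>\<^bsub>limit C M\<^esub> s \<oplus>\<^bsub>limit C M\<^esub> r' \<odot>\<^bsub>limit C M\<^esub> s"
      "(r \<otimes>\<^bsub>k\<^esub> r') \<odot>\<^bsub>limit C M\<^esub> s = r \<odot>\<^bsub>limit C M\<^esub> (r' \<odot>\<^bsub>limit C M\<^esub> s)"
      by (auto intro!: extensionalityI[where A = "Obj C"] simp: limit_simps(2-4) module.smult_l_distr[OF mod]
          module.smult_assoc1[OF mod] limitD(1))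
  next
    fix s assume s: "s \<in> carrier (limit C M)"
    have "\<one>\<^bsub>k\<^esub> \<in> carrier k"
    proof -
      interpret k: cring k by fact
      show ?thesis by simp
    qed
    with s show "\<one>\<^bsub>k\<^esub> \<odot>\<^bsub>limit C M\<^esub> s = s"
      by (intro extensionalityI[OF ext[OF smult] ext])
        (auto simp: limit_simps(2-4) module.smult_one[OF mod] limitD(1))
  qed (use assms smult in auto)
qed

lemma limit_map_closed:
  assumes "\<eta> \<in> natural_maps C k M N" "s \<in> carrier (limit C M)"
  shows "limit_map C \<eta> s \<in> carrier (limit C N)"
  unfolding limit_map_def
  by (rule limitI) (use assms in \<open>auto simp: limitD(1,2) natural_closed simp flip: natural_natural[OF assms(1)]\<close>)

lemma limit_map_linear:
  assumes "\<eta> \<in> natural_maps C k M N"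
  shows "limit_map C \<eta> \<in> linear_maps k (limit C M) (limit C N)"
proof (rule linear_mapsI, goal_cases)
  case 1
  then show ?case by (rule limit_map_closed[OF assms])
next
  case (2 s t)
  then have "\<eta> x (s x \<oplus>\<^bsub>Ob M x\<^esub> t x) = \<eta> x (s x) \<oplus>\<^bsub>Ob N x\<^esub> \<eta> x (t x)" if "x \<in> Obj C" for x
    using that by (intro linear_add[OF natural_linear[OF assms]] limitD(1))
  then show ?case by (auto simp: limit_map_def limit_simps(2-4) intro!: restrict_ext)
next
  case (3 r s)
  then have "\<eta> x (r \<odot>\<^bsub>Ob M x\<^esub> s x) = r \<odot>\<^bsub>Ob N x\<^esub> \<eta> x (s x)" if "x \<in> Obj C" for x
    using that by (intro linear_smult[OF natural_linear[OF assms]] limitD(1))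
  then show ?case by (auto simp: limit_map_def limit_simps(2-4) intro!: restrict_ext)
qed

section \<open>Extending a functor to the product of two objects\<close>

section \<open>The functor of families over a product\<close>

text \<open>Finiteness is part of this notion: with finitely many objects and arrows there are
  finitely many pairs over two objects, so families with values in an infinite type can be encoded
  in that type.\<close>

locale small_category =
  fixes C :: "('o, 'a) category"
  assumes comp_closed: "x \<in> Obj C \<Longrightarrow> y \<in> Obj C \<Longrightarrow> z \<in> Obj C \<Longrightarrow>
      a \<in> Hom C x y \<Longrightarrow> b \<in> Hom C y z \<Longrightarrow> Comp C x y z b a \<in> Hom C x z"
    and comp_assoc: "w \<in> Obj C \<Longrightarrow> x \<in> Obj C \<Longrightarrow> y \<in> Obj C \<Longrightarrow> z \<in> Obj C \<Longrightarrow>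
      a \<in> Hom C w x \<Longrightarrow> b \<in> Hom C x y \<Longrightarrow> c \<in> Hom C y z \<Longrightarrow>
      Comp C w x z (Comp C x y z c b) a = Comp C w y z c (Comp C w x y b a)"
    and ide_closed: "x \<in> Obj C \<Longrightarrow> Ide C x \<in> Hom C x x"
    and ide_left: "x \<in> Obj C \<Longrightarrow> y \<in> Obj C \<Longrightarrow> a \<in> Hom C x y \<Longrightarrow> Comp C x y y (Ide C y) a = a"
    and ide_right: "x \<in> Obj C \<Longrightarrow> y \<in> Obj C \<Longrightarrow> a \<in> Hom C x y \<Longrightarrow> Comp C x x y a (Ide C x) = a"
    and finite_Obj: "finite (Obj C)"
    and finite_Hom: "x \<in> Obj C \<Longrightarrow> y \<in> Obj C \<Longrightarrow> finite (Hom C x y)"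

text \<open>The category of elements of the presheaf \<open>Hom(-, x) \<times> Hom(-, y)\<close>. Its connected components
  having terminal objects means that the product of \<open>x\<close> and \<open>y\<close> exists as a formal coproduct of
  objects of \<open>C\<close>; \<open>product_system\<close> singles out such terminal objects.\<close>

definition pairs :: "('o, 'a) category \<Rightarrow> 'o \<Rightarrow> 'o \<Rightarrow> ('o \<times> 'a \<times> 'a, 'a) category" where
  "pairs C x y =
     \<lparr>Obj = {(w, a, b). w \<in> Obj C \<and> a \<in> Hom C w x \<and> b \<in> Hom C w y},
      Hom = (\<lambda>(w, a, b) (w', a', b'). {c \<in> Hom C w w'. Comp C w w' x a' c = a \<and> Comp C w w' y b' c = b}),
      Comp = (\<lambda>(w, _) (w', _) (w'', _). Comp C w w' w''),
      Ide = (\<lambda>(w, _). Ide C w)\<rparr>"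

definition on_pairs :: "('o, 'a, 'k, 'm) mod_functor \<Rightarrow> ('o \<times> 'a \<times> 'a, 'a, 'k, 'm) mod_functor" where
  "on_pairs M = \<lparr>Ob = (\<lambda>i. Ob M (fst i)), Ar = (\<lambda>i j. Ar M (fst i) (fst j))\<rparr>"

definition product_system ::
    "('o, 'a) category \<Rightarrow> 'o \<Rightarrow> 'o \<Rightarrow> 'i set \<Rightarrow> ('i \<Rightarrow> 'o \<times> 'a \<times> 'a) \<Rightarrow> bool" where
  "product_system C x y K r \<longleftrightarrow> finite K \<and> r ` K \<subseteq> Obj (pairs C x y) \<and>
     (\<forall>u\<in>Obj (pairs C x y). \<exists>!(i, c). i \<in> K \<and> c \<in> Hom (pairs C x y) u (r i))"

text \<open>The value at y is M(x times y) for the additive extension of M to formal coproducts.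
  Defined as a limit over all pairs, it is functorial in y without any choice of summands; a product
  system later identifies it with a finite product of values of M.\<close>

definition families ::
    "('o, 'a) category \<Rightarrow> 'o \<Rightarrow> ('o, 'a, 'k, 'm) mod_functor \<Rightarrow> ('o, 'a, 'k, 'o \<times> 'a \<times> 'a \<Rightarrow> 'm) mod_functor" where
  "families C x M =
     \<lparr>Ob = (\<lambda>y. limit (pairs C x y) (on_pairs M)),
      Ar = (\<lambda>y z g s. \<lambda>(w, a, b)\<in>Obj (pairs C x y). s (w, a, Comp C w y z g b))\<rparr>"

lemma pairs_simps:
  "(w, a, b) \<in> Obj (pairs C x y) \<longleftrightarrow> w \<in> Obj C \<and> a \<in> Hom C w x \<and> b \<in> Hom C w y"
  "c \<in> Hom (pairs C x y) (w, a, b) (w', a', b') \<longleftrightarrow>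
     c \<in> Hom C w w' \<and> Comp C w w' x a' c = a \<and> Comp C w w' y b' c = b"
  "Comp (pairs C x y) i j l = Comp C (fst i) (fst j) (fst l)"
  "Ide (pairs C x y) i = Ide C (fst i)"
  by (auto simp: pairs_def split: prod.splits)

lemma on_pairs_simps:
  "Ob (on_pairs M) i = Ob M (fst i)" "Ar (on_pairs M) i j = Ar M (fst i) (fst j)"
  by (simp_all add: on_pairs_def)

lemma families_simps:
  "Ob (families C x M) y = limit (pairs C x y) (on_pairs M)"
  "Ar (families C x M) y z g s = (\<lambda>(w, a, b)\<in>Obj (pairs C x y). s (w, a, Comp C w y z g b))"
  by (simp_all add: families_def)

lemma familiesD:
  assumes "s \<in> carrier (Ob (families C x M) y)"
  shows "i \<in> Obj (pairs C x y) \<Longrightarrow> s i \<in> carrier (Ob M (fst i))"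
    and "i \<in> Obj (pairs C x y) \<Longrightarrow> j \<in> Obj (pairs C x y) \<Longrightarrow> c \<in> Hom (pairs C x y) i j \<Longrightarrow>
      Ar M (fst i) (fst j) c (s j) = s i"
  using assms limitD[of s "pairs C x y" "on_pairs M"] by (auto simp: families_simps on_pairs_simps)

lemma familiesI:
  assumes "\<And>i. i \<in> Obj (pairs C x y) \<Longrightarrow> f i \<in> carrier (Ob M (fst i))"
    and "\<And>i j c. i \<in> Obj (pairs C x y) \<Longrightarrow> j \<in> Obj (pairs C x y) \<Longrightarrow> c \<in> Hom (pairs C x y) i j \<Longrightarrow>
      Ar M (fst i) (fst j) c (f j) = f i"
  shows "(\<lambda>i\<in>Obj (pairs C x y). f i) \<in> carrier (Ob (families C x M) y)"
  unfolding families_simps by (rule limitI) (use assms in \<open>auto simp: on_pairs_simps\<close>)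

lemma product_systemD:
  assumes "product_system C x y K r"
  shows "finite K" "i \<in> K \<Longrightarrow> r i \<in> Obj (pairs C x y)"
    and "u \<in> Obj (pairs C x y) \<Longrightarrow> \<exists>i\<in>K. \<exists>c. c \<in> Hom (pairs C x y) u (r i)"
    and "u \<in> Obj (pairs C x y) \<Longrightarrow> i \<in> K \<Longrightarrow> c \<in> Hom (pairs C x y) u (r i) \<Longrightarrow>
      j \<in> K \<Longrightarrow> d \<in> Hom (pairs C x y) u (r j) \<Longrightarrow> i = j \<and> c = d"
proof -
  have *: "\<exists>!(i, c). i \<in> K \<and> c \<in> Hom (pairs C x y) u (r i)" if "u \<in> Obj (pairs C x y)" for u
    using assms that by (simp add: product_system_def)
  show "u \<in> Obj (pairs C x y) \<Longrightarrow> \<exists>i\<in>K. \<exists>c. c \<in> Hom (pairs C x y) u (r i)"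
    using *[of u] by auto
  show "u \<in> Obj (pairs C x y) \<Longrightarrow> i \<in> K \<Longrightarrow> c \<in> Hom (pairs C x y) u (r i) \<Longrightarrow>
      j \<in> K \<Longrightarrow> d \<in> Hom (pairs C x y) u (r j) \<Longrightarrow> i = j \<and> c = d"
    using *[of u] by (auto simp: Ex1_def)
qed (use assms in \<open>auto simp: product_system_def\<close>)

lemma product_systemI:
  assumes "finite K" "\<And>i. i \<in> K \<Longrightarrow> r i \<in> Obj (pairs C x y)"
    and "\<And>u. u \<in> Obj (pairs C x y) \<Longrightarrow> \<exists>i\<in>K. \<exists>c. c \<in> Hom (pairs C x y) u (r i)"
    and "\<And>u i j c d. u \<in> Obj (pairs C x y) \<Longrightarrow> i \<in> K \<Longrightarrow> c \<in> Hom (pairs C x y) u (r i) \<Longrightarrow>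
      j \<in> K \<Longrightarrow> d \<in> Hom (pairs C x y) u (r j) \<Longrightarrow> i = j \<and> c = d"
  shows "product_system C x y K r"
  unfolding product_system_def
proof (intro conjI ballI)
  fix u assume u: "u \<in> Obj (pairs C x y)"
  obtain i c where *: "i \<in> K" "c \<in> Hom (pairs C x y) u (r i)" using assms(3)[OF u] by auto
  show "\<exists>!(i, c). i \<in> K \<and> c \<in> Hom (pairs C x y) u (r i)"
    by (rule ex1I[of _ "(i, c)"]) (use * assms(4)[OF u] in auto)
qed (use assms in auto)

text \<open>The map from M(y) to M(x times y) induced by the second projection.\<close>

definition restrict_family :: "('o, 'a) category \<Rightarrow> 'o \<Rightarrow> ('o, 'a, 'k, 'm) mod_functor \<Rightarrow> 'o \<Rightarrow> 'm \<Rightarrow> ('o \<times> 'a \<times> 'a) \<Rightarrow> 'm" where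
  "restrict_family C x M y v = (\<lambda>(w, a, b)\<in>Obj (pairs C x y). Ar M w y b v)"

definition map_family :: "('o, 'a) category \<Rightarrow> 'o \<Rightarrow> ('o \<Rightarrow> 'm \<Rightarrow> 'n) \<Rightarrow> 'o \<Rightarrow> (('o \<times> 'a \<times> 'a) \<Rightarrow> 'm) \<Rightarrow> ('o \<times> 'a \<times> 'a) \<Rightarrow> 'n" where
  "map_family C x \<eta> y s = (\<lambda>i\<in>Obj (pairs C x y). \<eta> (fst i) (s i))"

context small_category
begin

lemma finite_pairs:
  assumes "x \<in> Obj C" "y \<in> Obj C"
  shows "finite (Obj (pairs C x y))"
proof (rule finite_subset)
  show "Obj (pairs C x y) \<subseteq> (SIGMA w:Obj C. Hom C w x \<times> Hom C w y)"
    by (auto simp: pairs_simps)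
  show "finite (SIGMA w:Obj C. Hom C w x \<times> Hom C w y)"
    using assms by (auto intro: finite_Obj finite_Hom)
qed

lemma pairs_postcomp:
  assumes "x \<in> Obj C" "y \<in> Obj C" "z \<in> Obj C" "g \<in> Hom C y z" "(w, a, b) \<in> Obj (pairs C x y)"
  shows "(w, a, Comp C w y z g b) \<in> Obj (pairs C x z)"
  using assms by (auto simp: pairs_simps intro: comp_closed)

lemma pairs_hom_postcomp:
  assumes "x \<in> Obj C" "y \<in> Obj C" "z \<in> Obj C" "g \<in> Hom C y z" "(w, a, b) \<in> Obj (pairs C x y)"
    "(w', a', b') \<in> Obj (pairs C x y)" "c \<in> Hom (pairs C x y) (w, a, b) (w', a', b')"
  shows "c \<in> Hom (pairs C x z) (w, a, Comp C w y z g b) (w', a', Comp C w' y z g b')"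
  using assms by (auto simp: pairs_simps comp_assoc)

lemma diagram_on_pairs:
  assumes "contravariant_functor C k M"
  shows "diagram (pairs C x y) k (on_pairs M)"
  unfolding diagram_def
  using contra_module[OF assms] contra_linear[OF assms] by (auto simp: pairs_simps on_pairs_simps)

lemma families_functor:
  assumes k: "cring k" and M: "contravariant_functor C k M" and x: "x \<in> Obj C"
  shows "contravariant_functor C k (families C x M)"
  unfolding contravariant_functor_def
proof (intro conjI ballI)
  show "module k (Ob (families C x M) y)" for y
    unfolding families_simps by (rule limit_module[OF k diagram_on_pairs[OF M]])
  fix y assume y: "y \<in> Obj C"
  {
    fix z g assume z: "z \<in> Obj C" and g: "g \<in> Hom C y z"
    have closed: "Ar (families C x M) y z g s \<in> carrier (Ob (families C x M) y)"
      if s: "s \<in> carrier (Ob (families C x M) z)" for s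
      unfolding families_simps(2)
    proof (rule familiesI)
      fix i assume "i \<in> Obj (pairs C x y)"
      then show "(case i of (w, a, b) \<Rightarrow> s (w, a, Comp C w y z g b)) \<in> carrier (Ob M (fst i))"
        using familiesD(1)[OF s] pairs_postcomp[OF x y z g] by (cases i) fastforce
    next
      fix i j c assume "i \<in> Obj (pairs C x y)" "j \<in> Obj (pairs C x y)" "c \<in> Hom (pairs C x y) i j"
      then show "Ar M (fst i) (fst j) c (case j of (w, a, b) \<Rightarrow> s (w, a, Comp C w y z g b)) =
           (case i of (w, a, b) \<Rightarrow> s (w, a, Comp C w y z g b))"
        using familiesD(2)[OF s] pairs_postcomp[OF x y z g] pairs_hom_postcomp[OF x y z g]
        by (cases i; cases j) fastforce
    qed
    show "Ar (families C x M) y z g \<in> linear_maps k (Ob (families C x M) z) (Ob (families C x M) y)"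
    proof (rule linear_mapsI, goal_cases)
      case 1
      then show ?case by (rule closed)
    next
      case 2
      then show ?case
        using pairs_postcomp[OF x y z g]
        by (auto simp: families_simps limit_simps(2-4) on_pairs_simps fun_eq_iff restrict_def)
    next
      case 3
      then show ?case
        using pairs_postcomp[OF x y z g]
        by (auto simp: families_simps limit_simps(2-4) on_pairs_simps fun_eq_iff restrict_def)
    qed
    note closed
  } note closed = this
  show "Ar (families C x M) y y (Ide C y) s = s" if "s \<in> carrier (Ob (families C x M) y)" for s
  proof (rule limit_eqI)
    show "Ar (families C x M) y y (Ide C y) s \<in> carrier (limit (pairs C x y) (on_pairs M))"
      using closed[OF y ide_closed[OF y] that] by (simp add: families_simps)
    show "s \<in> carrier (limit (pairs C x y) (on_pairs M))" using that by (simp add: families_simps)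
  qed (auto simp: families_simps pairs_simps ide_left y)
  show "Ar (families C x M) y v (Comp C y z v h g) s = Ar (families C x M) y z g (Ar (families C x M) z v h s)"
    if "z \<in> Obj C" "v \<in> Obj C" "g \<in> Hom C y z" "h \<in> Hom C z v" for z v g h s
    using that x y pairs_postcomp[OF x y]
    by (auto simp: families_simps fun_eq_iff restrict_def pairs_simps comp_assoc)
qed

lemma restrict_family_natural:
  assumes M: "contravariant_functor C k M" and x: "x \<in> Obj C"
  shows "restrict_family C x M \<in> natural_maps C k M (families C x M)"
  unfolding natural_maps_def mem_Collect_eq
proof (intro conjI ballI)
  fix y assume y: "y \<in> Obj C"
  show "restrict_family C x M y \<in> linear_maps k (Ob M y) (Ob (families C x M) y)"
  proof (rule linear_mapsI, goal_cases)
    case (1 v)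
    show ?case unfolding restrict_family_def
    proof (rule familiesI)
      fix i j c assume "i \<in> Obj (pairs C x y)" "j \<in> Obj (pairs C x y)" "c \<in> Hom (pairs C x y) i j"
      then show "Ar M (fst i) (fst j) c (case j of (w, a, b) \<Rightarrow> Ar M w y b v) =
           (case i of (w, a, b) \<Rightarrow> Ar M w y b v)"
        using 1 y by (cases i; cases j) (auto simp: pairs_simps simp flip: contra_comp[OF M])
    qed (use 1 y contra_closed[OF M] in \<open>auto simp: pairs_simps\<close>)
  qed (use y in \<open>auto simp: restrict_family_def families_simps limit_simps(2-4) on_pairs_simps pairs_simps fun_eq_iff
    linear_add[OF contra_linear[OF M]] linear_smult[OF contra_linear[OF M]]\<close>)
  fix z g v assume "z \<in> Obj C" "g \<in> Hom C y z" "v \<in> carrier (Ob M z)"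
  then show "restrict_family C x M y (Ar M y z g v) = Ar (families C x M) y z g (restrict_family C x M z v)"
    using y pairs_postcomp[OF x y]
    by (auto simp: restrict_family_def families_simps pairs_simps fun_eq_iff contra_comp[OF M] comp_closed)
qed

lemma map_family_natural:
  assumes \<eta>: "\<eta> \<in> natural_maps C k M N" and x: "x \<in> Obj C"
  shows "map_family C x \<eta> \<in> natural_maps C k (families C x M) (families C x N)"
  unfolding natural_maps_def mem_Collect_eq
proof (intro conjI ballI)
  fix y assume y: "y \<in> Obj C"
  show "map_family C x \<eta> y \<in> linear_maps k (Ob (families C x M) y) (Ob (families C x N) y)"
  proof (rule linear_mapsI, goal_cases)
    case (1 s)
    show ?case unfolding map_family_def
    proof (rule familiesI)
      fix i j c assume *: "i \<in> Obj (pairs C x y)" "j \<in> Obj (pairs C x y)" "c \<in> Hom (pairs C x y) i j"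
      then have "\<eta> (fst i) (Ar M (fst i) (fst j) c (s j)) = Ar N (fst i) (fst j) c (\<eta> (fst j) (s j))"
        using familiesD(1)[OF 1] by (intro natural_natural[OF \<eta>]) (cases i; cases j; auto simp: pairs_simps)+
      then show "Ar N (fst i) (fst j) c (\<eta> (fst j) (s j)) = \<eta> (fst i) (s i)"
        using familiesD(2)[OF 1 *] by simp
    qed (use familiesD(1)[OF 1] natural_closed[OF \<eta>] in \<open>auto simp: pairs_simps\<close>)
  next
    case (2 s t)
    have "\<eta> (fst i) (s i \<oplus>\<^bsub>Ob M (fst i)\<^esub> t i) = \<eta> (fst i) (s i) \<oplus>\<^bsub>Ob N (fst i)\<^esub> \<eta> (fst i) (t i)"
      if "i \<in> Obj (pairs C x y)" for i
      using that familiesD(1)[OF 2(1) that] familiesD(1)[OF 2(2) that]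
      by (cases i) (intro linear_add[OF natural_linear[OF \<eta>]], auto simp: pairs_simps)
    then show ?case
      by (auto simp: map_family_def families_simps limit_simps(2-4) on_pairs_simps intro!: restrict_ext)
  next
    case (3 r s)
    have "\<eta> (fst i) (r \<odot>\<^bsub>Ob M (fst i)\<^esub> s i) = r \<odot>\<^bsub>Ob N (fst i)\<^esub> \<eta> (fst i) (s i)"
      if "i \<in> Obj (pairs C x y)" for i
      using that 3(1) familiesD(1)[OF 3(2) that]
      by (cases i) (intro linear_smult[OF natural_linear[OF \<eta>]], auto simp: pairs_simps)
    then show ?case
      by (auto simp: map_family_def families_simps limit_simps(2-4) on_pairs_simps intro!: restrict_ext)
  qed
  fix z g v assume "z \<in> Obj C" "g \<in> Hom C y z" "v \<in> carrier (Ob (families C x M) z)"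
  then show "map_family C x \<eta> y (Ar (families C x M) y z g v) = Ar (families C x N) y z g (map_family C x \<eta> z v)"
    using y pairs_postcomp[OF x y]
    by (auto simp: map_family_def families_simps pairs_simps fun_eq_iff comp_closed)
qed

end

section \<open>From a retraction to exactness of the complex of limits\<close>

section \<open>Retracts of functors of families have no higher limits\<close>

text \<open>An infinite set contains a copy of its square, so a function on a finite set can be
  coded into one element, one argument at a time.\<close>

lemma inj_on_finite_functions:
  assumes "finite I" "infinite (UNIV :: 'n set)"
  shows "\<exists>h :: ('i \<Rightarrow> 'n) \<Rightarrow> 'n. inj_on h (I \<rightarrow>\<^sub>E UNIV)"
  using assms(1)
proof (induction rule: finite_induct)
  case empty
  then show ?case by (simp add: PiE_empty_domain)
next
  case (insert i I)
  obtain h :: "('i \<Rightarrow> 'n) \<Rightarrow> 'n" where h: "inj_on h (I \<rightarrow>\<^sub>E UNIV)" using insert by auto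
  have "|(UNIV :: 'n set) \<times> (UNIV :: 'n set)| \<le>o |UNIV :: 'n set|"
    using card_of_Times_same_infinite[OF assms(2)] ordIso_iff_ordLeq by blast
  then obtain q :: "'n \<times> 'n \<Rightarrow> 'n" where q: "inj q"
    unfolding card_of_ordLeq[symmetric] by auto
  have "inj_on (\<lambda>s. q (s i, h (restrict s I))) (insert i I \<rightarrow>\<^sub>E UNIV)"
  proof (rule inj_onI)
    fix s t :: "'i \<Rightarrow> 'n" assume st: "s \<in> insert i I \<rightarrow>\<^sub>E UNIV" "t \<in> insert i I \<rightarrow>\<^sub>E UNIV"
      and eq: "q (s i, h (restrict s I)) = q (t i, h (restrict t I))"
    have "s i = t i" "h (restrict s I) = h (restrict t I)"
      using injD[OF q eq] by auto
    moreover from this(2) have "restrict s I = restrict t I"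
      by (rule inj_onD[OF h]) auto
    ultimately show "s = t"
      using st by (intro PiE_ext[OF st]) (metis insertE restrict_apply')
  qed
  then show ?case by blast
qed

lemma natural_zero:
  assumes "\<eta> \<in> natural_maps C k M N" "contravariant_functor C k M" "contravariant_functor C k N" "x \<in> Obj C"
  shows "\<eta> x \<zero>\<^bsub>Ob M x\<^esub> = \<zero>\<^bsub>Ob N x\<^esub>"
  by (rule linear_zero[OF contra_module[OF assms(2,4)] contra_module[OF assms(3,4)] natural_linear[OF assms(1,4)]])

lemma natural_minus:
  assumes "\<eta> \<in> natural_maps C k M N" "contravariant_functor C k M" "contravariant_functor C k N" "x \<in> Obj C"
    "u \<in> carrier (Ob M x)" "v \<in> carrier (Ob M x)"
  shows "\<eta> x (u \<ominus>\<^bsub>Ob M x\<^esub> v) = \<eta> x u \<ominus>\<^bsub>Ob N x\<^esub> \<eta> x v"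
  by (rule linear_minus[OF contra_module[OF assms(2,4)] contra_module[OF assms(3,4)] natural_linear[OF assms(1,4)] assms(5,6)])

lemma map_family_zero_iff:
  assumes "s \<in> carrier (Ob (families C x M) y)"
  shows "map_family C x \<eta> y s = \<zero>\<^bsub>Ob (families C x N) y\<^esub> \<longleftrightarrow>
    (\<forall>i\<in>Obj (pairs C x y). \<eta> (fst i) (s i) = \<zero>\<^bsub>Ob N (fst i)\<^esub>)"
  by (auto simp: map_family_def families_simps limit_simps on_pairs_simps restrict_def fun_eq_iff)

context small_category
begin

text \<open>A compatible family is determined by its values at the terminal objects
  \<open>r i\<close>, and these can be prescribed freely. So \<open>families\<close> is a product of
  evaluations and preserves exactness in the middle: preimages are picked at the \<open>r i\<close>
  only and spread from there.\<close>

lemma families_exact: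
  assumes M: "contravariant_functor C k M" and N: "contravariant_functor C k N"
    and \<alpha>: "\<alpha> \<in> natural_maps C k M N"
    and exact: "\<And>w. w \<in> Obj C \<Longrightarrow> \<alpha> w ` carrier (Ob M w) = {v \<in> carrier (Ob N w). \<beta> w v = \<zero>\<^bsub>Ob L w\<^esub>}"
    and K: "product_system C x y K r" and x: "x \<in> Obj C" and y: "y \<in> Obj C"
    and s: "s \<in> carrier (Ob (families C x N) y)"
    and zero: "map_family C x \<beta> y s = \<zero>\<^bsub>Ob (families C x L) y\<^esub>"
  shows "\<exists>u\<in>carrier (Ob (families C x M) y). map_family C x \<alpha> y u = s"
proof -
  let ?E = "pairs C x y"
  note Kd = product_systemD[OF K]
  have fstC: "fst i \<in> Obj C" if "i \<in> Obj ?E" for i using that by (cases i) (simp add: pairs_simps)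
  have homC: "c \<in> Hom C (fst i) (fst j)" if "c \<in> Hom ?E i j" for i j c
    using that by (cases i; cases j) (simp add: pairs_simps)
  have "\<exists>v. v \<in> carrier (Ob M (fst (r i))) \<and> \<alpha> (fst (r i)) v = s (r i)" if "i \<in> K" for i
  proof -
    have "s (r i) \<in> \<alpha> (fst (r i)) ` carrier (Ob M (fst (r i)))"
      using zero exact[OF fstC] Kd(2)[OF that] familiesD(1)[OF s Kd(2)[OF that]]
      unfolding map_family_zero_iff[OF s] by auto
    then show ?thesis by auto
  qed
  then obtain \<rho> where \<rho>: "\<rho> i \<in> carrier (Ob M (fst (r i)))" "\<alpha> (fst (r i)) (\<rho> i) = s (r i)" if "i \<in> K" for i
    by metis
  obtain \<kappa> c where c: "\<kappa> u \<in> K" "c u \<in> Hom ?E u (r (\<kappa> u))" if "u \<in> Obj ?E" for u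
    using Kd(3) by metis
  \<comment> \<open>The value at u is the restriction of the preimage chosen at the terminal object
    above u.\<close>
  define f where "f u = Ar M (fst u) (fst (r (\<kappa> u))) (c u) (\<rho> (\<kappa> u))" for u
  have f: "f u = Ar M (fst u) (fst (r i)) b (\<rho> i)"
    if "u \<in> Obj ?E" "i \<in> K" "b \<in> Hom ?E u (r i)" for u i b
    using Kd(4)[OF that(1) c(1)[OF that(1)] c(2)[OF that(1)] that(2,3)] by (simp add: f_def)
  have fc: "f u \<in> carrier (Ob M (fst u))" if "u \<in> Obj ?E" for u
    unfolding f_def using c[OF that] that Kd(2)
    by (intro contra_closed[OF M] fstC homC \<rho>(1)) auto
  have "restrict f (Obj ?E) \<in> carrier (Ob (families C x M) y)"
  proof (rule familiesI[OF fc])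
    fix i j b assume ij: "i \<in> Obj ?E" "j \<in> Obj ?E" and b: "b \<in> Hom ?E i j"
    have cj: "\<kappa> j \<in> K" "c j \<in> Hom ?E j (r (\<kappa> j))" using c ij by auto
    have rj: "r (\<kappa> j) \<in> Obj ?E" using Kd(2) cj by auto
    \<comment> \<open>The composite is an arrow from i to a terminal object, hence the only one;
      this is the compatibility of \<open>f\<close>.\<close>
    have "Comp C (fst i) (fst j) (fst (r (\<kappa> j))) (c j) b \<in> Hom ?E i (r (\<kappa> j))"
      using ij b cj(2) rj x y
      by (cases i; cases j; cases "r (\<kappa> j)") (auto simp: pairs_simps comp_closed simp flip: comp_assoc)
    from f[OF ij(1) cj(1) this]
    show "Ar M (fst i) (fst j) b (f j) = f i"
      using ij b cj rj by (simp add: f_def contra_comp[OF M] fstC homC \<rho>)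
  qed
  moreover have "map_family C x \<alpha> y (restrict f (Obj ?E)) = s"
  proof (rule limit_eqI)
    show "map_family C x \<alpha> y (restrict f (Obj ?E)) \<in> carrier (limit ?E (on_pairs N))"
      using natural_closed[OF map_family_natural[OF \<alpha> x] y calculation] by (simp add: families_simps)
    show "s \<in> carrier (limit ?E (on_pairs N))" using s by (simp add: families_simps)
    fix i assume i: "i \<in> Obj ?E"
    have ri: "r (\<kappa> i) \<in> Obj ?E" using c(1)[OF i] Kd(2) by auto
    have "\<alpha> (fst i) (f i) = Ar N (fst i) (fst (r (\<kappa> i))) (c i) (s (r (\<kappa> i)))"
      unfolding f_def using i ri c[OF i]
      by (subst natural_natural[OF \<alpha>]) (auto simp: fstC homC \<rho>)
    then show "map_family C x \<alpha> y (restrict f (Obj ?E)) i = s i"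
      using i familiesD(2)[OF s i ri c(2)[OF i]] by (simp add: map_family_def)
  qed
  ultimately show ?thesis by blast
qed

text \<open>Left exactness of limits: under an injective \<open>\<alpha>\<close> the preimages are
  unique, and therefore compatible.\<close>

lemma families_kernel:
  assumes M: "contravariant_functor C k M" and N: "contravariant_functor C k N"
    and \<alpha>: "\<alpha> \<in> natural_maps C k M N"
    and inj: "\<And>w. w \<in> Obj C \<Longrightarrow> inj_on (\<alpha> w) (carrier (Ob M w))"
    and exact: "\<And>w. w \<in> Obj C \<Longrightarrow> \<alpha> w ` carrier (Ob M w) = {v \<in> carrier (Ob N w). \<beta> w v = \<zero>\<^bsub>Ob L w\<^esub>}"
    and x: "x \<in> Obj C" and y: "y \<in> Obj C"
    and s: "s \<in> carrier (Ob (families C x N) y)"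
    and zero: "map_family C x \<beta> y s = \<zero>\<^bsub>Ob (families C x L) y\<^esub>"
  shows "\<exists>u\<in>carrier (Ob (families C x M) y). map_family C x \<alpha> y u = s"
proof -
  let ?E = "pairs C x y"
  have fstC: "fst i \<in> Obj C" if "i \<in> Obj ?E" for i using that by (cases i) (simp add: pairs_simps)
  have homC: "c \<in> Hom C (fst i) (fst j)" if "c \<in> Hom ?E i j" for i j c
    using that by (cases i; cases j) (simp add: pairs_simps)
  have "s i \<in> \<alpha> (fst i) ` carrier (Ob M (fst i))" if "i \<in> Obj ?E" for i
    using zero exact[OF fstC[OF that]] familiesD(1)[OF s that] that
    unfolding map_family_zero_iff[OF s] by auto
  then have "\<exists>v. v \<in> carrier (Ob M (fst i)) \<and> \<alpha> (fst i) v = s i" if "i \<in> Obj ?E" for i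
    using that by fastforce
  then obtain f where f: "f i \<in> carrier (Ob M (fst i))" "\<alpha> (fst i) (f i) = s i" if "i \<in> Obj ?E" for i
    by metis
  have "restrict f (Obj ?E) \<in> carrier (Ob (families C x M) y)"
  proof (rule familiesI[OF f(1)])
    fix i j b assume ij: "i \<in> Obj ?E" "j \<in> Obj ?E" and b: "b \<in> Hom ?E i j"
    have "\<alpha> (fst i) (Ar M (fst i) (fst j) b (f j)) = \<alpha> (fst i) (f i)"
      using ij b familiesD(2)[OF s ij b] by (subst natural_natural[OF \<alpha>]) (auto simp: f fstC homC)
    then show "Ar M (fst i) (fst j) b (f j) = f i"
      by (rule inj_onD[OF inj[OF fstC[OF ij(1)]]])
        (use ij b in \<open>auto intro!: contra_closed[OF M] fstC homC f\<close>)
  qed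
  moreover have "map_family C x \<alpha> y (restrict f (Obj ?E)) = s"
  proof (rule limit_eqI)
    show "map_family C x \<alpha> y (restrict f (Obj ?E)) \<in> carrier (limit ?E (on_pairs N))"
      using natural_closed[OF map_family_natural[OF \<alpha> x] y calculation] by (simp add: families_simps)
    show "s \<in> carrier (limit ?E (on_pairs N))" using s by (simp add: families_simps)
  qed (simp add: map_family_def f)
  ultimately show ?thesis by blast
qed

lemma restrict_map_family:
  assumes \<eta>: "\<eta> \<in> natural_maps C k M N" and "y \<in> Obj C" "v \<in> carrier (Ob M y)"
  shows "restrict_family C x N y (\<eta> y v) = map_family C x \<eta> y (restrict_family C x M y v)"
  using assms(2,3) by (auto simp: restrict_family_def map_family_def fun_eq_iff restrict_def pairs_simps
      natural_natural[OF \<eta>])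

text \<open>One encoding serves all functors at once, since it codes all functions on the finite set
  of pairs over y, compatible or not.\<close>

lemma families_encoding:
  assumes "infinite (UNIV :: 'n set)" "x \<in> Obj C"
  obtains enc :: "'o \<Rightarrow> ('o \<times> 'a \<times> 'a \<Rightarrow> 'n) \<Rightarrow> 'n"
  where "\<And>(M :: ('o, 'a, 'k, 'n) mod_functor) y. y \<in> Obj C \<Longrightarrow> inj_on (enc y) (carrier (Ob (families C x M) y))"
proof -
  have "\<forall>y\<in>Obj C. \<exists>h :: ('o \<times> 'a \<times> 'a \<Rightarrow> 'n) \<Rightarrow> 'n. inj_on h (Obj (pairs C x y) \<rightarrow>\<^sub>E UNIV)"
    using inj_on_finite_functions[OF finite_pairs[OF assms(2)] assms(1)] by blast
  then obtain enc :: "'o \<Rightarrow> ('o \<times> 'a \<times> 'a \<Rightarrow> 'n) \<Rightarrow> 'n"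
    where enc: "inj_on (enc y) (Obj (pairs C x y) \<rightarrow>\<^sub>E UNIV)" if "y \<in> Obj C" for y
    by metis
  show thesis
  proof (rule that)
    fix M :: "('o, 'a, 'k, 'n) mod_functor" and y assume "y \<in> Obj C"
    then show "inj_on (enc y) (carrier (Ob (families C x M) y))"
      by (rule inj_on_subset[OF enc]) (auto simp: families_simps limit_simps)
  qed
qed

end

lemma injective_resolutionD:
  assumes "injective_resolution C k M J e d"
  shows "contravariant_functor C k M" "injective_functor C k (J n)" "contravariant_functor C k (J n)"
    "e \<in> natural_maps C k M (J 0)" "d n \<in> natural_maps C k (J n) (J (Suc n))"
    "x \<in> Obj C \<Longrightarrow> inj_on (e x) (carrier (Ob M x))"
    "x \<in> Obj C \<Longrightarrow> e x ` carrier (Ob M x) = {v \<in> carrier (Ob (J 0) x). d 0 x v = \<zero>\<^bsub>Ob (J (Suc 0)) x\<^esub>}"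
    "x \<in> Obj C \<Longrightarrow> d n x ` carrier (Ob (J n) x) =
      {v \<in> carrier (Ob (J (Suc n)) x). d (Suc n) x v = \<zero>\<^bsub>Ob (J (Suc (Suc n))) x\<^esub>}"
  using assms by (auto simp: injective_resolution_def injective_functor_def a_kernel_def kernel_def)

text \<open>The vanishing argument freed from groups: a finite category with an object x that has
  products with all objects, and a functor split off from its extension to these products, with any
  injective resolution of it.\<close>

locale retract_resolution = small_category C
  for C :: "('o, 'a) category" and k :: "('k, 'z) ring_scheme" and x
    and K :: "'o \<Rightarrow> 'i set" and r :: "'o \<Rightarrow> 'i \<Rightarrow> 'o \<times> 'a \<times> 'a"
    and U :: "('o, 'a, 'k, 'm) mod_functor" and t
    and J :: "nat \<Rightarrow> ('o, 'a, 'k, 'n) mod_functor" and e d +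
  assumes k: "cring k" and x: "x \<in> Obj C" and inf: "infinite (UNIV :: 'n set)"
    and K: "\<And>y. y \<in> Obj C \<Longrightarrow> product_system C x y (K y) (r y)"
    and t: "t \<in> natural_maps C k (families C x U) U"
    and retract: "\<And>y v. y \<in> Obj C \<Longrightarrow> v \<in> carrier (Ob U y) \<Longrightarrow> t y (restrict_family C x U y v) = v"
    and res: "injective_resolution C k U J e d"
begin

lemmas U = injective_resolutionD(1)[OF res]
lemmas Jinj = injective_resolutionD(2)[OF res]
lemmas J = injective_resolutionD(3)[OF res]
lemmas e = injective_resolutionD(4)[OF res]
lemmas d = injective_resolutionD(5)[OF res]

lemma d_d:
  assumes "y \<in> Obj C" "v \<in> carrier (Ob (J n) y)"
  shows "d (Suc n) y (d n y v) = \<zero>\<^bsub>Ob (J (Suc (Suc n))) y\<^esub>"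
  using injective_resolutionD(8)[OF res assms(1), of n] assms by blast

lemma d_e:
  assumes "y \<in> Obj C" "v \<in> carrier (Ob U y)"
  shows "d 0 y (e y v) = \<zero>\<^bsub>Ob (J (Suc 0)) y\<^esub>"
  using injective_resolutionD(7)[OF res assms(1)] assms by blast

text \<open>The comparison theorem: \<open>families\<close> turns the resolution of \<open>U\<close>
  into an exact sequence, and each \<open>J n\<close> is injective, so \<open>t\<close> lifts to a
  cochain map degree by degree.\<close>

lemma lift_retraction:
  obtains T where "\<And>n. T n \<in> natural_maps C k (families C x (J n)) (J n)"
    and "\<And>y u. y \<in> Obj C \<Longrightarrow> u \<in> carrier (Ob (families C x U) y) \<Longrightarrow> T 0 y (map_family C x e y u) = e y (t y u)"
    and "\<And>n y s. y \<in> Obj C \<Longrightarrow> s \<in> carrier (Ob (families C x (J n)) y) \<Longrightarrow>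
      T (Suc n) y (map_family C x (d n) y s) = d n y (T n y s)"
proof -
  note FU = families_functor[OF k U x] and FJ = families_functor[OF k J x]
  note me = map_family_natural[OF e x] and md = map_family_natural[OF d x]
  obtain enc :: "'o \<Rightarrow> ('o \<times> 'a \<times> 'a \<Rightarrow> 'n) \<Rightarrow> 'n" where
    enc: "\<And>(M :: ('o, 'a, 'k, 'n) mod_functor) y. y \<in> Obj C \<Longrightarrow> inj_on (enc y) (carrier (Ob (families C x M) y))"
    using families_encoding[OF inf x] by blast
  \<comment> \<open>The last clause is what the next extension needs: the composite of
    \<open>T\<close> with the differential kills the kernel of the differential on families. The
    clause for n = 0 only carries the starting condition through the recursive choice.\<close>
  let ?P = "\<lambda>n T. T \<in> natural_maps C k (families C x (J n)) (J n) \<and>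
     (n = 0 \<longrightarrow> (\<forall>y\<in>Obj C. \<forall>u\<in>carrier (Ob (families C x U) y). T y (map_family C x e y u) = e y (t y u))) \<and>
     (\<forall>y\<in>Obj C. \<forall>s\<in>carrier (Ob (families C x (J n)) y).
        map_family C x (d n) y s = \<zero>\<^bsub>Ob (families C x (J (Suc n))) y\<^esub> \<longrightarrow> d n y (T y s) = \<zero>\<^bsub>Ob (J (Suc n)) y\<^esub>)"
  let ?Q = "\<lambda>n T T'. \<forall>y\<in>Obj C. \<forall>s\<in>carrier (Ob (families C x (J n)) y).
      T' y (map_family C x (d n) y s) = d n y (T y s)"
  have "\<exists>T. \<forall>n. ?P n (T n) \<and> ?Q n (T n) (T (Suc n))"
  proof (rule dependent_nat_choice)
    have "\<exists>T\<in>natural_maps C k (families C x (J 0)) (J 0). \<forall>y\<in>Obj C. \<forall>u\<in>carrier (Ob (families C x U) y).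
        T y (map_family C x e y u) = e y (t y u)"
    proof (rule injective_extension[OF Jinj FU FJ me natural_comp[OF t e] enc])
      fix y u assume y: "y \<in> Obj C" and u: "u \<in> carrier (Ob (families C x U) y)"
        and z: "map_family C x e y u = \<zero>\<^bsub>Ob (families C x (J 0)) y\<^esub>"
      \<comment> \<open>The map induced by the injective \<open>e\<close> is injective on families,
        so there is no kernel to be killed in degree 0.\<close>
      have "u = \<zero>\<^bsub>Ob (families C x U) y\<^esub>"
      proof (rule limit_eqI)
        show "u \<in> carrier (limit (pairs C x y) (on_pairs U))" using u by (simp add: families_simps)
        interpret m: module k "Ob (families C x U) y" by (rule contra_module[OF FU y])
        show "\<zero>\<^bsub>Ob (families C x U) y\<^esub> \<in> carrier (limit (pairs C x y) (on_pairs U))"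
          using m.M.zero_closed by (simp add: families_simps)
        fix i assume i: "i \<in> Obj (pairs C x y)"
        then have ic: "fst i \<in> Obj C" by (cases i) (simp add: pairs_simps)
        interpret u: module k "Ob U (fst i)" by (rule contra_module[OF U ic])
        have "e (fst i) (u i) = e (fst i) \<zero>\<^bsub>Ob U (fst i)\<^esub>"
          using z i unfolding map_family_zero_iff[OF u] by (simp add: natural_zero[OF e U J ic])
        then have "u i = \<zero>\<^bsub>Ob U (fst i)\<^esub>"
          using familiesD(1)[OF u i] by (auto dest: inj_onD[OF injective_resolutionD(6)[OF res ic]])
        then show "u i = \<zero>\<^bsub>Ob (families C x U) y\<^esub> i"
          using i by (simp add: families_simps limit_simps on_pairs_simps)
      qed
      then show "e y (t y u) = \<zero>\<^bsub>Ob (J 0) y\<^esub>"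
        by (simp add: natural_zero[OF t FU U y] natural_zero[OF e U J y])
    qed auto
    then obtain T where T: "T \<in> natural_maps C k (families C x (J 0)) (J 0)"
      "\<And>y u. y \<in> Obj C \<Longrightarrow> u \<in> carrier (Ob (families C x U) y) \<Longrightarrow> T y (map_family C x e y u) = e y (t y u)"
      by blast
    have "d 0 y (T y s) = \<zero>\<^bsub>Ob (J (Suc 0)) y\<^esub>" if y: "y \<in> Obj C"
      and s: "s \<in> carrier (Ob (families C x (J 0)) y)"
      and z: "map_family C x (d 0) y s = \<zero>\<^bsub>Ob (families C x (J (Suc 0))) y\<^esub>" for y s
    proof -
      obtain u where u: "u \<in> carrier (Ob (families C x U) y)" "map_family C x e y u = s"
        using families_kernel[OF U J e injective_resolutionD(6)[OF res] injective_resolutionD(7)[OF res] x y s z] by auto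
      then show ?thesis using y T(2)[OF y u(1)] d_e natural_closed[OF t y u(1)] by simp
    qed
    with T show "\<exists>T. ?P 0 T" by (intro exI[of _ T]) auto
  next
    fix T n assume P: "?P n T"
    then have T: "T \<in> natural_maps C k (families C x (J n)) (J n)" by simp
    have "\<exists>T'\<in>natural_maps C k (families C x (J (Suc n))) (J (Suc n)). ?Q n T T'"
      by (rule injective_extension[OF Jinj FJ FJ md natural_comp[OF T d] enc]) (use P in auto)
    then obtain T' where T': "T' \<in> natural_maps C k (families C x (J (Suc n))) (J (Suc n))" "?Q n T T'"
      by blast
    have "d (Suc n) y (T' y s) = \<zero>\<^bsub>Ob (J (Suc (Suc n))) y\<^esub>" if y: "y \<in> Obj C"
      and s: "s \<in> carrier (Ob (families C x (J (Suc n))) y)"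
      and z: "map_family C x (d (Suc n)) y s = \<zero>\<^bsub>Ob (families C x (J (Suc (Suc n)))) y\<^esub>" for y s
    proof -
      obtain u where u: "u \<in> carrier (Ob (families C x (J n)) y)" "map_family C x (d n) y u = s"
        using families_exact[OF J J d injective_resolutionD(8)[OF res] K[OF y] x y s z] by auto
      then show ?thesis using y T'(2) d_d natural_closed[OF T y u(1)] by auto
    qed
    with T' show "\<exists>T'. ?P (Suc n) T' \<and> ?Q n T T'" by (intro exI[of _ T']) auto
  qed
  then obtain T where "\<And>n. ?P n (T n) \<and> ?Q n (T n) (T (Suc n))" by blast
  then show thesis by (intro that[of T]) auto
qed

text \<open>An endomorphism of the resolution that vanishes on \<open>U\<close> is null-homotopic:
  the difference of \<open>g\<close> and \<open>d\<close> after \<open>h\<close> vanishes on the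
  image of one differential, which is the kernel of the next, and so it extends along the latter by
  injectivity.\<close>

lemma null_homotopy:
  assumes g: "\<And>n. g n \<in> natural_maps C k (J n) (J n)"
    and g0: "\<And>y v. y \<in> Obj C \<Longrightarrow> v \<in> carrier (Ob U y) \<Longrightarrow> g 0 y (e y v) = \<zero>\<^bsub>Ob (J 0) y\<^esub>"
    and gd: "\<And>n y v. y \<in> Obj C \<Longrightarrow> v \<in> carrier (Ob (J n) y) \<Longrightarrow> g (Suc n) y (d n y v) = d n y (g n y v)"
  obtains h where "\<And>n. h n \<in> natural_maps C k (J (Suc n)) (J n)"
    and "\<And>n y v. y \<in> Obj C \<Longrightarrow> v \<in> carrier (Ob (J (Suc n)) y) \<Longrightarrow>
      h (Suc n) y (d (Suc n) y v) = g (Suc n) y v \<ominus>\<^bsub>Ob (J (Suc n)) y\<^esub> d n y (h n y v)"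
proof -
  \<comment> \<open>\<open>?P\<close> says that the difference to be extended next vanishes on the
    image of \<open>d n\<close>; \<open>?Q\<close> is the homotopy identity in degree n + 1. The map
    \<open>h n\<close> lowers the degree from n + 1 to n.\<close>
  let ?P = "\<lambda>n h. h \<in> natural_maps C k (J (Suc n)) (J n) \<and>
     (\<forall>y\<in>Obj C. \<forall>v\<in>carrier (Ob (J n) y). d n y (h y (d n y v)) = d n y (g n y v))"
  let ?Q = "\<lambda>n h h'. \<forall>y\<in>Obj C. \<forall>v\<in>carrier (Ob (J (Suc n)) y).
      h' y (d (Suc n) y v) = g (Suc n) y v \<ominus>\<^bsub>Ob (J (Suc n)) y\<^esub> d n y (h y v)"
  have "\<exists>h. \<forall>n. ?P n (h n) \<and> ?Q n (h n) (h (Suc n))"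
  proof (rule dependent_nat_choice)
    have "\<exists>h\<in>natural_maps C k (J (Suc 0)) (J 0). \<forall>y\<in>Obj C. \<forall>v\<in>carrier (Ob (J 0) y).
        h y (d 0 y v) = g 0 y v"
    proof (rule injective_extension[OF Jinj J J d g, where enc = "\<lambda>_ v. v"])
      fix y v assume y: "y \<in> Obj C" and "v \<in> carrier (Ob (J 0) y)" "d 0 y v = \<zero>\<^bsub>Ob (J (Suc 0)) y\<^esub>"
      then obtain u where "u \<in> carrier (Ob U y)" "v = e y u"
        using injective_resolutionD(7)[OF res y] by auto
      then show "g 0 y v = \<zero>\<^bsub>Ob (J 0) y\<^esub>" using g0 y by simp
    qed simp
    then show "\<exists>h. ?P 0 h" by auto
  next
    fix h n assume P: "?P n h"
    then have h: "h \<in> natural_maps C k (J (Suc n)) (J n)" by simp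
    have "\<exists>h'\<in>natural_maps C k (J (Suc (Suc n))) (J (Suc n)). ?Q n h h'"
    proof (rule injective_extension[OF Jinj J J d natural_diff[OF J J g natural_comp[OF h d]], where enc = "\<lambda>_ v. v"])
      fix y v assume y: "y \<in> Obj C" and "v \<in> carrier (Ob (J (Suc n)) y)"
        "d (Suc n) y v = \<zero>\<^bsub>Ob (J (Suc (Suc n))) y\<^esub>"
      then obtain u where u: "u \<in> carrier (Ob (J n) y)" "v = d n y u"
        using injective_resolutionD(8)[OF res y, of n] by auto
      interpret m: module k "Ob (J (Suc n)) y" by (rule contra_module[OF J y])
      show "g (Suc n) y v \<ominus>\<^bsub>Ob (J (Suc n)) y\<^esub> d n y (h y v) = \<zero>\<^bsub>Ob (J (Suc n)) y\<^esub>"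
        using u P y gd natural_closed[OF g y] natural_closed[OF d y] by (simp add: m.M.minus_eq_zero_iff)
    qed simp
    then obtain h' where h': "h' \<in> natural_maps C k (J (Suc (Suc n))) (J (Suc n))" "?Q n h h'"
      by blast
    have "d (Suc n) y (h' y (d (Suc n) y v)) = d (Suc n) y (g (Suc n) y v)"
      if y: "y \<in> Obj C" and v: "v \<in> carrier (Ob (J (Suc n)) y)" for y v
    proof -
      interpret m: module k "Ob (J (Suc (Suc n))) y" by (rule contra_module[OF J y])
      have hv: "h y v \<in> carrier (Ob (J n) y)" by (rule natural_closed[OF h y v])
      have gv: "g (Suc n) y v \<in> carrier (Ob (J (Suc n)) y)" by (rule natural_closed[OF g y v])
      have "d (Suc n) y (h' y (d (Suc n) y v)) =
          d (Suc n) y (g (Suc n) y v) \<ominus>\<^bsub>Ob (J (Suc (Suc n))) y\<^esub> d (Suc n) y (d n y (h y v))"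
        using h'(2) y v natural_minus[OF d J J y gv natural_closed[OF d y hv]] by simp
      then show ?thesis
        using d_d[OF y hv] natural_closed[OF d y gv] by (simp add: a_minus_def)
    qed
    with h' show "\<exists>h'. ?P (Suc n) h' \<and> ?Q n h h'" by (intro exI[of _ h']) auto
  qed
  then obtain h where "\<And>n. ?P n (h n) \<and> ?Q n (h n) (h (Suc n))" by blast
  then show thesis by (intro that[of h]) auto
qed

text \<open>Restriction to products followed by \<open>T\<close> lifts the identity of
  \<open>U\<close>, hence is homotopic to the identity. On limits this composite passes through
  compatible families on products with x, where a primitive of z at the single object x yields a
  primitive everywhere.\<close>

lemma limit_exact:
  assumes z: "z \<in> carrier (limit C (J (Suc n)))"
    and dz: "limit_map C (d (Suc n)) z = \<zero>\<^bsub>limit C (J (Suc (Suc n)))\<^esub>"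
  shows "\<exists>w\<in>carrier (limit C (J n)). limit_map C (d n) w = z"
proof -
  obtain T where T: "\<And>n. T n \<in> natural_maps C k (families C x (J n)) (J n)"
    and T0: "\<And>y u. y \<in> Obj C \<Longrightarrow> u \<in> carrier (Ob (families C x U) y) \<Longrightarrow> T 0 y (map_family C x e y u) = e y (t y u)"
    and Td: "\<And>n y s. y \<in> Obj C \<Longrightarrow> s \<in> carrier (Ob (families C x (J n)) y) \<Longrightarrow>
      T (Suc n) y (map_family C x (d n) y s) = d n y (T n y s)"
    using lift_retraction by blast
  \<comment> \<open>A cochain map over the identity of \<open>U\<close>, by \<open>retract\<close>;
    its difference \<open>g\<close> from the identity is therefore null-homotopic.\<close>
  define \<theta> where "\<theta> n y v = T n y (restrict_family C x (J n) y v)" for n y v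
  note res_nat = restrict_family_natural[OF J x] restrict_family_natural[OF U x]
  have \<theta>: "\<theta> n \<in> natural_maps C k (J n) (J n)" for n
    unfolding \<theta>_def by (rule natural_comp[OF res_nat(1) T])
  define g where "g n y v = \<theta> n y v \<ominus>\<^bsub>Ob (J n) y\<^esub> v" for n y v
  have g: "g n \<in> natural_maps C k (J n) (J n)" for n
    unfolding g_def by (rule natural_diff[OF J J \<theta> natural_id])
  have \<theta>d: "\<theta> (Suc n) y (d n y v) = d n y (\<theta> n y v)" if "y \<in> Obj C" "v \<in> carrier (Ob (J n) y)" for n y v
    using that by (simp add: \<theta>_def restrict_map_family[OF d] Td natural_closed[OF res_nat(1)])
  have g0: "g 0 y (e y v) = \<zero>\<^bsub>Ob (J 0) y\<^esub>" if y: "y \<in> Obj C" and v: "v \<in> carrier (Ob U y)" for y v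
  proof -
    interpret m: module k "Ob (J 0) y" by (rule contra_module[OF J y])
    show ?thesis
      using that by (simp add: g_def \<theta>_def restrict_map_family[OF e] T0 natural_closed[OF res_nat(2)] retract
          m.M.minus_eq_zero_iff natural_closed[OF e])
  qed
  have gd: "g (Suc n) y (d n y v) = d n y (g n y v)" if "y \<in> Obj C" "v \<in> carrier (Ob (J n) y)" for n y v
    using that by (simp add: g_def \<theta>d natural_minus[OF d J J] natural_closed[OF \<theta>])
  obtain h where h: "\<And>n. h n \<in> natural_maps C k (J (Suc n)) (J n)"
    and hd: "\<And>n y v. y \<in> Obj C \<Longrightarrow> v \<in> carrier (Ob (J (Suc n)) y) \<Longrightarrow>
      h (Suc n) y (d (Suc n) y v) = g (Suc n) y v \<ominus>\<^bsub>Ob (J (Suc n)) y\<^esub> d n y (h n y v)"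
    using null_homotopy[of g, OF g g0 gd] by blast
  note zC = limitD(1)[OF z] and zA = limitD(2)[OF z]
  have dz0: "d (Suc n) y (z y) = \<zero>\<^bsub>Ob (J (Suc (Suc n))) y\<^esub>" if "y \<in> Obj C" for y
    using fun_cong[OF dz, of y] that by (simp add: limit_map_def limit_simps)
  \<comment> \<open>Exactness of the resolution is used at the object x alone; elsewhere primitives
    of z would not be compatible.\<close>
  then obtain q where q: "q \<in> carrier (Ob (J n) x)" "d n x q = z x"
    using injective_resolutionD(8)[OF res x, of n] zC[OF x] x by force
  \<comment> \<open>Pull \<open>q\<close> back along the first projections. Arrows y to y' act on
    the second projections only, so these families are compatible in y.\<close>
  define f where "f y = (\<lambda>(w, a, b)\<in>Obj (pairs C x y). Ar (J n) w x a q)" for y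
  have f: "f y \<in> carrier (Ob (families C x (J n)) y)" if y: "y \<in> Obj C" for y
    unfolding f_def
  proof (rule familiesI)
    fix i assume "i \<in> Obj (pairs C x y)"
    then show "(case i of (w, a, b) \<Rightarrow> Ar (J n) w x a q) \<in> carrier (Ob (J n) (fst i))"
      using x y q by (cases i) (auto simp: pairs_simps intro: contra_closed[OF J])
  next
    fix i j c assume "i \<in> Obj (pairs C x y)" "j \<in> Obj (pairs C x y)" "c \<in> Hom (pairs C x y) i j"
    then show "Ar (J n) (fst i) (fst j) c (case j of (w, a, b) \<Rightarrow> Ar (J n) w x a q) =
        (case i of (w, a, b) \<Rightarrow> Ar (J n) w x a q)"
      using x y q by (cases i; cases j) (auto simp: pairs_simps simp flip: contra_comp[OF J])
  qed
  have fA: "Ar (families C x (J n)) y y' a (f y') = f y" if "y \<in> Obj C" "y' \<in> Obj C" "a \<in> Hom C y y'" for y y' a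
    using that pairs_postcomp[OF x that]
    by (auto simp: families_simps f_def fun_eq_iff restrict_def)
  have df: "map_family C x (d n) y (f y) = restrict_family C x (J (Suc n)) y (z y)" if y: "y \<in> Obj C" for y
    using x y q zA by (auto simp: map_family_def restrict_family_def f_def fun_eq_iff restrict_def pairs_simps
       natural_natural[OF d])
  \<comment> \<open>The differential of the first term is \<open>\<theta>\<close> z, that of the
    second is \<open>\<theta>\<close> z minus z by the homotopy.\<close>
  define w where "w = (\<lambda>y\<in>Obj C. T n y (f y) \<ominus>\<^bsub>Ob (J n) y\<^esub> h n y (z y))"
  have Tf: "T n y (f y) \<in> carrier (Ob (J n) y)" and hz: "h n y (z y) \<in> carrier (Ob (J n) y)" if "y \<in> Obj C" for y
    using that natural_closed[OF T] natural_closed[OF h] f zC by auto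
  have w: "w \<in> carrier (limit C (J n))"
    unfolding w_def
  proof (rule limitI)
    fix y assume y: "y \<in> Obj C"
    interpret m: module k "Ob (J n) y" by (rule contra_module[OF J y])
    show "T n y (f y) \<ominus>\<^bsub>Ob (J n) y\<^esub> h n y (z y) \<in> carrier (Ob (J n) y)"
      using Tf hz y by simp
  next
    fix y y' a assume *: "y \<in> Obj C" "y' \<in> Obj C" "a \<in> Hom C y y'"
    have "Ar (J n) y y' a (T n y' (f y')) = T n y (f y)"
      using * by (simp add: natural_natural[OF T, symmetric] f fA)
    moreover have "Ar (J n) y y' a (h n y' (z y')) = h n y (z y)"
      using * by (simp add: natural_natural[OF h, symmetric] zC zA)
    ultimately show "Ar (J n) y y' a (T n y' (f y') \<ominus>\<^bsub>Ob (J n) y'\<^esub> h n y' (z y')) = T n y (f y) \<ominus>\<^bsub>Ob (J n) y\<^esub> h n y (z y)"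
      using * by (simp add: linear_minus[OF contra_module[OF J] contra_module[OF J] contra_linear[OF J]] Tf hz)
  qed
  have "limit_map C (d n) w = z"
  proof (rule limit_eqI[OF limit_map_closed[OF d w] z])
    fix y assume y: "y \<in> Obj C"
    interpret m: module k "Ob (J (Suc n)) y" by (rule contra_module[OF J y])
    have \<theta>z: "d n y (T n y (f y)) = \<theta> (Suc n) y (z y)"
      using y f by (simp add: \<theta>_def df flip: Td)
    have c: "\<theta> (Suc n) y (z y) \<in> carrier (Ob (J (Suc n)) y)" "z y \<in> carrier (Ob (J (Suc n)) y)"
      "d n y (h n y (z y)) \<in> carrier (Ob (J (Suc n)) y)"
      using y zC natural_closed[OF \<theta>] natural_closed[OF d] hz by auto
    \<comment> \<open>The homotopy identity at a cocycle: the term in which \<open>h\<close> follows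
      the differential drops out.\<close>
    have "g (Suc n) y (z y) \<ominus>\<^bsub>Ob (J (Suc n)) y\<^esub> d n y (h n y (z y)) = \<zero>\<^bsub>Ob (J (Suc n)) y\<^esub>"
      using hd[OF y zC[OF y]] dz0[OF y] natural_zero[OF h J J y] by simp
    then have "\<theta> (Suc n) y (z y) \<ominus>\<^bsub>Ob (J (Suc n)) y\<^esub> z y = d n y (h n y (z y))"
      using c by (simp add: m.M.minus_eq_zero_iff g_def)
    then have "\<theta> (Suc n) y (z y) \<ominus>\<^bsub>Ob (J (Suc n)) y\<^esub> d n y (h n y (z y)) = z y"
      using c by (metis (no_types, lifting) a_minus_def m.M.a_assoc m.M.a_comm m.M.a_inv_closed m.M.minus_add m.M.minus_minus m.M.r_neg1)
    then show "limit_map C (d n) w y = z y"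
      using y by (simp add: limit_map_def w_def natural_minus[OF d J J y Tf hz] \<theta>z)
  qed
  with w show ?thesis by blast
qed

text \<open>Coboundaries exhaust the cocycles, so the quotient consists of a single coset.\<close>

lemma trivial_higher_limit: "trivial_group (higher_limit C J d (Suc n))"
proof -
  let ?M = "\<lambda>n. limit C (J n)"
  let ?Z = "a_kernel (?M (Suc n)) (?M (Suc (Suc n))) (limit_map C (d (Suc n)))"
  have mod: "module k (?M n)" for n
    by (rule limit_module[OF k diagramI[OF J]])
  have Z: "?Z = {v \<in> carrier (?M (Suc n)). limit_map C (d (Suc n)) v = \<zero>\<^bsub>?M (Suc (Suc n))\<^esub>}"
    by (simp add: a_kernel_def kernel_def)
  have B: "limit_map C (d n) ` carrier (?M n) = ?Z"
  proof
    show "?Z \<subseteq> limit_map C (d n) ` carrier (?M n)" using limit_exact by (auto simp: Z image_iff)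
    show "limit_map C (d n) ` carrier (?M n) \<subseteq> ?Z"
    proof
      fix v assume "v \<in> limit_map C (d n) ` carrier (?M n)"
      then obtain w where w: "w \<in> carrier (?M n)" "v = limit_map C (d n) w" by blast
      have "limit_map C (d (Suc n)) v = \<zero>\<^bsub>?M (Suc (Suc n))\<^esub>"
        using w d_d limitD(1)[OF w(1)] by (auto simp: limit_map_def limit_simps(2) fun_eq_iff)
      then show "v \<in> ?Z" using w limit_map_closed[OF d] by (auto simp: Z)
    qed
  qed
  interpret M: module k "?M (Suc n)" by (rule mod)
  interpret M': module k "?M (Suc (Suc n))" by (rule mod)
  have lin: "limit_map C (d (Suc n)) \<in> linear_maps k (?M (Suc n)) (?M (Suc (Suc n)))"
    by (rule limit_map_linear[OF d])
  let ?G = "(?M (Suc n))\<lparr>carrier := ?Z\<rparr>"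
  have G: "abelian_group ?G"
  proof (rule abelian_groupI)
    fix u assume u: "u \<in> carrier ?G"
    then have "\<ominus>\<^bsub>?M (Suc n)\<^esub> u \<in> carrier ?G"
      by (simp add: Z linear_uminus[OF mod mod lin])
    moreover have "\<ominus>\<^bsub>?M (Suc n)\<^esub> u \<oplus>\<^bsub>?G\<^esub> u = \<zero>\<^bsub>?G\<^esub>" using u by (simp add: Z M.l_neg)
    ultimately show "\<exists>v\<in>carrier ?G. v \<oplus>\<^bsub>?G\<^esub> u = \<zero>\<^bsub>?G\<^esub>" by blast
  qed (auto simp: Z linear_add[OF lin] linear_zero[OF mod mod lin] M.M.a_ac)
  interpret G: abelian_group ?G by (rule G)
  have sub: "abelian_subgroup (carrier ?G) ?G"
    using G.add.subgroup_self by (intro abelian_subgroupI3[OF _ G]) (simp add: additive_subgroup_def)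
  interpret H: abelian_subgroup "carrier ?G" ?G by (rule sub)
  have eq: "higher_limit C J d (Suc n) = ?G A_Mod carrier ?G"
    unfolding higher_limit_def cohomology_def by (simp add: B)
  interpret Q: group "?G A_Mod carrier ?G" by (rule H.a_factorgroup_is_group)
  have "Y = carrier ?G" if Y: "Y \<in> carrier (?G A_Mod carrier ?G)" for Y
  proof -
    obtain u where "u \<in> carrier ?G" "Y = a_r_coset ?G (carrier ?G) u"
      using Y by (auto simp: A_FactGroup_def FactGroup_def RCOSETS_def a_r_coset_def)
    then show ?thesis using G.a_coset_join2[OF _ H.a_subgroup] by blast
  qed
  moreover have "carrier (?G A_Mod carrier ?G) \<noteq> {}" using Q.one_closed by blast
  ultimately show ?thesis unfolding eq Q.trivial_group by blast
qed

end

section \<open>Fixed points modulo p, with consequences for normalizers and Sylow subgroups\<close>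

section \<open>Finite p-groups\<close>

text \<open>Orbit sizes divide a power of p, so every orbit other than a fixed point has size
  divisible by p.\<close>

lemma card_fixed_points_mod:
  fixes G (structure)
  assumes G: "group G" and ord: "order G = p ^ n" and p: "Factorial_Ring.prime (p :: nat)" and E: "finite E"
    and closed: "\<And>g e. g \<in> carrier G \<Longrightarrow> e \<in> E \<Longrightarrow> act g e \<in> E"
    and one: "\<And>e. e \<in> E \<Longrightarrow> act \<one> e = e"
    and mult: "\<And>g h e. g \<in> carrier G \<Longrightarrow> h \<in> carrier G \<Longrightarrow> e \<in> E \<Longrightarrow> act (g \<otimes> h) e = act g (act h e)"
  shows "card E mod p = card {e \<in> E. \<forall>g\<in>carrier G. act g e = e} mod p"
proof -
  interpret group G by (rule G)
  define \<phi> where "\<phi> g = restrict (act g) E" for g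
  define Fix where "Fix = {e \<in> E. \<forall>g\<in>carrier G. act g e = e}"
  have bij: "\<phi> g \<in> Bij E" if g: "g \<in> carrier G" for g
    unfolding Bij_def
  proof (intro IntI CollectI)
    show "bij_betw (\<phi> g) E E"
    proof (rule bij_betw_byWitness[where f' = "\<phi> (inv g)"])
      show "\<forall>a\<in>E. \<phi> (inv g) (\<phi> g a) = a" "\<forall>a\<in>E. \<phi> g (\<phi> (inv g) a) = a"
        using g closed one by (auto simp: \<phi>_def simp flip: mult)
    qed (use g closed in \<open>auto simp: \<phi>_def\<close>)
  qed (simp add: \<phi>_def)
  interpret A: group_action G E \<phi>
  proof (unfold group_action_def, rule group_hom.intro[OF G group_BijGroup], unfold group_hom_axioms_def)
    show "\<phi> \<in> hom G (BijGroup E)"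
      by (rule homI) (use bij closed mult in \<open>auto simp: BijGroup_def compose_def \<phi>_def fun_eq_iff restrict_def\<close>)
  qed
  have orb: "orbit G \<phi> x = (\<lambda>g. act g x) ` carrier G" if "x \<in> E" for x
    using that by (auto simp: orbit_def \<phi>_def)
  \<comment> \<open>The congruence holds orbit by orbit: either the orbit is one fixed point, or p
    divides its size and it contains no fixed point.\<close>
  have *: "(\<Sum>x\<in>B. 1) mod p = (\<Sum>x\<in>B. of_bool (x \<in> Fix)) mod p" if B: "B \<in> orbits G E \<phi>" for B
  proof -
    obtain x where x: "x \<in> E" "B = orbit G \<phi> x" using B by (auto simp: orbits_def)
    have xO: "x \<in> B" using A.orbit_refl x by auto
    have OE: "B \<subseteq> E" using x closed by (auto simp: orb)
    then have fin: "finite B" using E finite_subset by blast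
    show ?thesis
    proof (cases "x \<in> Fix")
      case True
      then have "B = {x}" using x one by (auto simp: orb Fix_def image_iff)
      then show ?thesis using True by simp
    next
      case False
      then have "B \<noteq> {x}" using x by (auto simp: orb Fix_def)
      then have "card B \<noteq> 1" using xO by (auto simp: card_1_singleton_iff)
      moreover have "card B dvd p ^ n"
        using A.orbit_stabilizer_theorem[OF x(1)] x ord by (metis dvd_triv_left)
      ultimately have pO: "p dvd card B"
        using p by (metis divides_primepow_nat dvd_power power_0 gr0I)
      have "y \<notin> Fix" if "y \<in> B" for y
      proof
        assume y: "y \<in> Fix"
        have "x \<in> orbit G \<phi> y" using A.orbit_sym[OF x(1), of y] that OE x by auto
        then show False using y False by (auto simp: orb Fix_def)
      qed
      then have "(\<Sum>x\<in>B. of_bool (x \<in> Fix)) = (0 :: nat)" by simp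
      then show ?thesis using pO by simp
    qed
  qed
  have "card E = (\<Sum>B\<in>orbits G E \<phi>. \<Sum>x\<in>B. 1)" using A.disjoint_sum[OF E, of "\<lambda>_. 1 :: nat"] by simp
  moreover have "card Fix = (\<Sum>B\<in>orbits G E \<phi>. \<Sum>x\<in>B. of_bool (x \<in> Fix))"
    using A.disjoint_sum[OF E, of "\<lambda>x. of_bool (x \<in> Fix) :: nat"] E
    by (simp add: of_bool_def sum.If_cases Fix_def Collect_conj_eq Int_absorb1)
  moreover have "(\<Sum>B\<in>orbits G E \<phi>. \<Sum>x\<in>B. 1 :: nat) mod p = (\<Sum>B\<in>orbits G E \<phi>. \<Sum>x\<in>B. of_bool (x \<in> Fix)) mod p"
    using * by (subst (1 2) mod_sum_eq[symmetric]) (simp cong: sum.cong)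
  ultimately show ?thesis unfolding Fix_def by simp
qed

context group
begin

lemma r_coset_eq_iff:
  assumes "subgroup H G" "x \<in> carrier G" "y \<in> carrier G"
  shows "H #> x = H #> y \<longleftrightarrow> x \<otimes> inv y \<in> H"
proof
  assume "H #> x = H #> y"
  then have "x \<in> H #> y" using rcos_self[OF assms(2,1)] by simp
  then obtain h where "h \<in> H" "x = h \<otimes> y" by (auto simp: r_coset_def)
  then show "x \<otimes> inv y \<in> H" using assms subgroup.mem_carrier[OF assms(1)] by (simp add: m_assoc)
next
  assume a: "x \<otimes> inv y \<in> H"
  have "x = (x \<otimes> inv y) \<otimes> y" using assms by (simp add: m_assoc)
  then have "x \<in> H #> y" using a unfolding r_coset_def by blast
  then show "H #> x = H #> y" using repr_independence[OF _ assms(3,1)] by simp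
qed

text \<open>Let Q act by translation on its cosets in R. Their number is divisible by p and the
  coset Q is fixed, so another coset is fixed as well; a representative of it normalizes Q and lies
  outside Q.\<close>

lemma normalizer_grows:
  assumes fin: "finite (carrier G)" and ord: "order G = p ^ n" and p: "Factorial_Ring.prime (p :: nat)"
    and Q: "subgroup Q G" and R: "subgroup R G" and QR: "Q \<subset> R"
  shows "\<exists>x\<in>R - Q. \<forall>u\<in>Q. x \<otimes> u \<otimes> inv x \<in> Q"
proof -
  note Qc = subgroup.mem_carrier[OF Q] and Rc = subgroup.mem_carrier[OF R]
  have ppow: "\<exists>k. card H = p ^ k" if "subgroup H G" for H
  proof -
    have "card H dvd p ^ n" using lagrange[OF that] ord by (metis dvd_triv_right)
    then show ?thesis using p by (auto simp: divides_primepow_nat)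
  qed
  obtain q where q: "card Q = p ^ q" using ppow[OF Q] by auto
  obtain r where r: "card R = p ^ r" using ppow[OF R] by auto
  interpret GR: group "G\<lparr>carrier := R\<rparr>" using subgroup_imp_group[OF R] .
  define E where "E = (\<lambda>x. Q #> x) ` R"
  have "subgroup Q (G\<lparr>carrier := R\<rparr>)" using Q R QR subgroup_incl by blast
  from GR.lagrange[OF this] have cE: "card E * card Q = card R"
    by (simp add: E_def order_def RCOSETS_def r_coset_def UNION_singleton_eq_range)
  have finR: "finite R" using R fin subgroup.subset finite_subset by metis
  have "card Q < card R" using QR finR by (simp add: psubset_card_mono)
  then have "q < r" using q r p prime_gt_1_nat by (metis power_less_imp_less_exp)
  then have "p ^ r = p ^ (r - q) * p ^ q" by (simp flip: power_add)
  then have "card E = p ^ (r - q)" using cE q r p by (metis mult_cancel2 not_prime_0 power_not_zero)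
  then have pE: "p dvd card E" using \<open>q < r\<close> by simp
  \<comment> \<open>Multiplying by the inverse on the right gives a left action.\<close>
  define act where "act g A = A #> inv g" for g A
  have actE: "act g (Q #> x) = Q #> (x \<otimes> inv g)" if "g \<in> R" "x \<in> R" for g x
    using that Rc subgroup.subset[OF Q] by (simp add: act_def coset_mult_assoc)
  have gQ: "group (G\<lparr>carrier := Q\<rparr>)" using subgroup_imp_group[OF Q] .
  let ?Fix = "{e \<in> E. \<forall>g\<in>carrier (G\<lparr>carrier := Q\<rparr>). act g e = e}"
  have "card E mod p = card ?Fix mod p"
  proof (rule card_fixed_points_mod[OF gQ, of p q])
    show "order (G\<lparr>carrier := Q\<rparr>) = p ^ q" using q by (simp add: order_def)
    show "finite E" using finR by (simp add: E_def)
  next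
    fix g e assume "g \<in> carrier (G\<lparr>carrier := Q\<rparr>)" "e \<in> E"
    then show "act g e \<in> E"
      using QR actE subgroup.m_closed[OF R] subgroup.m_inv_closed[OF R] by (auto simp: E_def)
  next
    fix e assume "e \<in> E"
    then show "act \<one>\<^bsub>G\<lparr>carrier := Q\<rparr>\<^esub> e = e"
      using actE[of \<one>] subgroup.one_closed[OF R] Rc by (auto simp: E_def)
  next
    fix g h e assume "g \<in> carrier (G\<lparr>carrier := Q\<rparr>)" "h \<in> carrier (G\<lparr>carrier := Q\<rparr>)" "e \<in> E"
    moreover from this have "g \<in> R" "h \<in> R" using QR by auto
    ultimately show "act (g \<otimes>\<^bsub>G\<lparr>carrier := Q\<rparr>\<^esub> h) e = act g (act h e)"
      using actE subgroup.m_closed[OF R] subgroup.m_inv_closed[OF R] Rc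
      by (auto simp: E_def m_assoc inv_mult_group)
  qed (use p in auto)
  then have pF: "p dvd card ?Fix" using pE by (simp add: dvd_eq_mod_eq_0)
  have "act g (Q #> \<one>) = Q #> \<one>" if g: "g \<in> Q" for g
  proof -
    have "g \<in> R" using g QR by auto
    then show ?thesis
      using actE[of g \<one>] subgroup.one_closed[OF R] Qc[OF g] subgroup.m_inv_closed[OF Q g]
      by (simp add: r_coset_eq_iff[OF Q])
  qed
  then have "Q #> \<one> \<in> ?Fix"
    using subgroup.one_closed[OF R] by (auto simp: E_def)
  \<comment> \<open>The number of fixed cosets is divisible by p, hence is not 1.\<close>
  moreover have "?Fix \<noteq> {Q #> \<one>}"
    using pF p by (metis card.empty card_insert_disjoint empty_iff finite.emptyI not_prime_1 nat_dvd_1_iff_1 One_nat_def)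
  ultimately obtain A where A: "A \<in> ?Fix" "A \<noteq> Q #> \<one>" by blast
  then obtain x where x: "x \<in> R" "A = Q #> x" by (auto simp: E_def)
  have "x \<notin> Q" using A x Rc by (simp add: r_coset_eq_iff[OF Q])
  moreover have "x \<otimes> u \<otimes> inv x \<in> Q" if u: "u \<in> Q" for u
  proof -
    have "act (inv u) A = A" using A(1) subgroup.m_inv_closed[OF Q u] by auto
    then have "Q #> (x \<otimes> u) = Q #> x"
      using actE[of "inv u" x] x u QR subgroup.m_inv_closed[OF R] Qc by auto
    then show ?thesis using x u Rc Qc by (simp add: r_coset_eq_iff[OF Q])
  qed
  ultimately show ?thesis using x by blast
qed

lemma sylow_index:
  assumes fin: "finite (carrier G)" and p: "Factorial_Ring.prime (p :: nat)" and H: "sylow_subgroup p G H"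
  shows "\<not> p dvd card (rcosets H)"
proof
  have sH: "subgroup H G" and cH: "card H = p ^ multiplicity p (order G)"
    using H by (auto simp: sylow_subgroup_def)
  have cE: "card (rcosets H) * card H = order G" using lagrange[OF sH] .
  have ord0: "order G > 0" using fin order_gt_0_iff_finite by simp
  assume "p dvd card (rcosets H)"
  then have "p ^ Suc (multiplicity p (order G)) dvd order G"
    using cE cH by (metis mult_dvd_mono dvd_refl power_Suc)
  then show False
    using ord0 p by (metis Suc_n_not_le_n less_irrefl multiplicity_geI not_prime_unit)
qed

text \<open>The cyclic p-group generated by x acts on the cosets of H, whose number is prime to p.
  So some coset Hg is fixed by x, which means that conjugation by g moves x into H.\<close>

lemma p_element_conjugate_into_sylow:
  assumes fin: "finite (carrier G)" and p: "Factorial_Ring.prime (p :: nat)"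
    and H: "sylow_subgroup p G H" and x: "x \<in> carrier G" "x [^] (p ^ k :: nat) = \<one>"
  shows "\<exists>g\<in>carrier G. g \<otimes> x \<otimes> inv g \<in> H"
proof -
  have sH: "subgroup H G" using H by (auto simp: sylow_subgroup_def)
  define E where "E = rcosets H"
  have cE: "card E * card H = order G" using lagrange[OF sH] by (simp add: E_def)
  have ord0: "order G > 0" using fin order_gt_0_iff_finite by simp
  have "\<not> p dvd card E" unfolding E_def by (rule sylow_index[OF fin p H])
  let ?A = "G\<lparr>carrier := generate G {x}\<rparr>"
  have sA: "subgroup (generate G {x}) G" using x generate_is_subgroup by simp
  have "ord x dvd p ^ k" using x pow_eq_id by blast
  then obtain j where j: "ord x = p ^ j" using p by (auto simp: divides_primepow_nat)
  define act where "act g A = A #> inv g" for g A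
  have actE: "act g (H #> y) = H #> (y \<otimes> inv g)" if "g \<in> carrier G" "y \<in> carrier G" for g y
    using that subgroup.subset[OF sH] by (simp add: act_def coset_mult_assoc)
  let ?Fix = "{e \<in> E. \<forall>g\<in>carrier ?A. act g e = e}"
  have sub: "g \<in> carrier G" if "g \<in> generate G {x}" for g
    using that subgroup.mem_carrier[OF sA] by blast
  have "card E mod p = card ?Fix mod p"
  proof (rule card_fixed_points_mod[OF subgroup_imp_group[OF sA], of p j])
    show "order ?A = p ^ j" using j generate_pow_card[OF x(1)] by (simp add: order_def)
    show "finite E" using cE ord0 by (metis card.infinite less_irrefl mult_0)
  next
    fix g e assume "g \<in> carrier ?A" "e \<in> E"
    then show "act g e \<in> E" using sub actE by (auto simp: E_def RCOSETS_def)
  next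
    fix e assume "e \<in> E"
    then show "act \<one>\<^bsub>?A\<^esub> e = e" using actE by (auto simp: E_def RCOSETS_def)
  next
    fix g h e assume "g \<in> carrier ?A" "h \<in> carrier ?A" "e \<in> E"
    then show "act (g \<otimes>\<^bsub>?A\<^esub> h) e = act g (act h e)"
      using sub actE by (auto simp: E_def RCOSETS_def m_assoc inv_mult_group)
  qed (use p in auto)
  then have "?Fix \<noteq> {}" using \<open>\<not> p dvd card E\<close> by (metis card.empty dvd_eq_mod_eq_0 mod_0)
  then obtain A where A: "A \<in> ?Fix" by blast
  then obtain g where g: "g \<in> carrier G" "A = H #> g" by (auto simp: E_def RCOSETS_def)
  have "inv x \<in> generate G {x}" using generate.inv[of x "{x}" G] by simp
  then have "act (inv x) A = A" using A by auto
  then have "H #> (g \<otimes> x) = H #> g" using actE[of "inv x" g] g x by simp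
  then have "g \<otimes> x \<otimes> inv g \<in> H" using g x by (simp add: r_coset_eq_iff[OF sH])
  then show ?thesis using g by blast
qed

end

section \<open>Conjugation, morphisms of a fusion system, and centric subgroups\<close>

section \<open>Fusion systems\<close>

text \<open>\<open>conj_map\<close> without its domain: as a total function it composes by plain
  rewriting, and domains are put back by \<open>restrict\<close>.\<close>

definition conj_by :: "('g, 'x) monoid_scheme \<Rightarrow> 'g \<Rightarrow> 'g \<Rightarrow> 'g" where
  "conj_by G x u = x \<otimes>\<^bsub>G\<^esub> u \<otimes>\<^bsub>G\<^esub> inv\<^bsub>G\<^esub> x"

context group
begin

abbreviation cj :: "'a \<Rightarrow> 'a \<Rightarrow> 'a" where "cj \<equiv> conj_by G"

lemma cj_closed [simp]: "x \<in> carrier G \<Longrightarrow> u \<in> carrier G \<Longrightarrow> cj x u \<in> carrier G"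
  by (simp add: conj_by_def)

lemma cj_one [simp]: "u \<in> carrier G \<Longrightarrow> cj \<one> u = u"
  by (simp add: conj_by_def)

lemma cj_mult: "x \<in> carrier G \<Longrightarrow> y \<in> carrier G \<Longrightarrow> u \<in> carrier G \<Longrightarrow> cj (x \<otimes> y) u = cj x (cj y u)"
  by (simp add: conj_by_def inv_mult_group m_assoc)

lemma cj_inv [simp]: "x \<in> carrier G \<Longrightarrow> u \<in> carrier G \<Longrightarrow> cj (inv x) (cj x u) = u"
  and cj_inv' [simp]: "x \<in> carrier G \<Longrightarrow> u \<in> carrier G \<Longrightarrow> cj x (cj (inv x) u) = u"
  by (simp_all flip: cj_mult)

lemma cj_inj: "x \<in> carrier G \<Longrightarrow> u \<in> carrier G \<Longrightarrow> v \<in> carrier G \<Longrightarrow> cj x u = cj x v \<longleftrightarrow> u = v"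
  by (metis cj_inv)

lemma cj_hom: "x \<in> carrier G \<Longrightarrow> u \<in> carrier G \<Longrightarrow> v \<in> carrier G \<Longrightarrow> cj x (u \<otimes> v) = cj x u \<otimes> cj x v"
  by (simp add: conj_by_def m_assoc) (simp add: m_assoc[symmetric])

lemma cj_self: "subgroup H G \<Longrightarrow> x \<in> H \<Longrightarrow> u \<in> H \<Longrightarrow> cj x u \<in> H"
  by (simp add: conj_by_def subgroup.m_closed subgroup.m_inv_closed)

lemma cj_eq_iff_commutes:
  "x \<in> carrier G \<Longrightarrow> y \<in> carrier G \<Longrightarrow> u \<in> carrier G \<Longrightarrow>
    cj x u = cj y u \<longleftrightarrow> (inv y \<otimes> x) \<otimes> u = u \<otimes> (inv y \<otimes> x)"
proof -
  assume a: "x \<in> carrier G" "y \<in> carrier G" "u \<in> carrier G"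
  have "cj x u = cj y u \<longleftrightarrow> cj (inv y) (cj x u) = u"
    using a by (metis cj_closed cj_inv cj_inv' inv_closed)
  also have "\<dots> \<longleftrightarrow> cj (inv y \<otimes> x) u = u" using a by (simp add: cj_mult)
  also have "\<dots> \<longleftrightarrow> (inv y \<otimes> x) \<otimes> u = u \<otimes> (inv y \<otimes> x)"
    using a unfolding conj_by_def by (metis inv_closed inv_solve_right' m_closed)
  finally show ?thesis .
qed

lemma cj_image_subgroup:
  assumes "subgroup H G" "x \<in> carrier G"
  shows "subgroup (cj x ` H) G"
proof (rule subgroupI)
  note Hc = subgroup.mem_carrier[OF assms(1)]
  show "cj x ` H \<subseteq> carrier G" using Hc assms by auto
  show "cj x ` H \<noteq> {}" using subgroup.one_closed[OF assms(1)] by blast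
  show "inv a \<in> cj x ` H" if a: "a \<in> cj x ` H" for a
  proof -
    obtain h where h: "h \<in> H" "a = cj x h" using a by blast
    then have "inv a = cj x (inv h)" using Hc assms by (simp add: conj_by_def inv_mult_group m_assoc)
    then show ?thesis using subgroup.m_inv_closed[OF assms(1) h(1)] by blast
  qed
  show "a \<otimes> b \<in> cj x ` H" if "a \<in> cj x ` H" "b \<in> cj x ` H" for a b
    using that Hc assms by (auto simp flip: cj_hom intro!: imageI subgroup.m_closed[OF assms(1)])
qed

text \<open>Finiteness: conjugation is injective, so mapping H into itself already means mapping it
  onto itself.\<close>

lemma normalizer_iff:
  assumes "finite (carrier G)" "H \<subseteq> carrier G"
  shows "x \<in> normalizer G H \<longleftrightarrow> x \<in> carrier G \<and> (\<forall>u\<in>H. cj x u \<in> H)"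
proof -
  have eq: "x <# H #> inv x = cj x ` H" by (auto simp: l_coset_def r_coset_def conj_by_def)
  have "cj x ` H = H \<longleftrightarrow> cj x ` H \<subseteq> H" if x: "x \<in> carrier G"
  proof
    assume s: "cj x ` H \<subseteq> H"
    have "inj_on (cj x) H" using x assms by (auto intro!: inj_onI simp: cj_inj subset_iff)
    then show "cj x ` H = H"
      using s assms finite_subset by (intro endo_inj_surj) auto
  qed auto
  then show ?thesis using assms(2) eq by (auto simp: normalizer_def stabilizer_def)
qed

end

lemma conj_map_eq: "conj_map G x P = restrict (conj_by G x) P"
  by (simp add: conj_map_def conj_by_def restrict_def fun_eq_iff)

locale fusion =
  fixes p :: nat and S (structure) and F
  assumes fusion_system: "fusion_system p S F"

sublocale fusion \<subseteq> group S
  using fusion_system by (simp add: fusion_system_def)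

context fusion
begin

abbreviation sub :: "'a set \<Rightarrow> bool" where "sub P \<equiv> subgroup P S"

lemma finite_S: "finite (carrier S)" and order_S: "\<exists>n. order S = p ^ n"
  using fusion_system by (auto simp: fusion_system_def)

lemma sub_carrier [simp]: "sub P \<Longrightarrow> u \<in> P \<Longrightarrow> u \<in> carrier S"
  by (rule subgroup.mem_carrier)

lemma sub_finite: "sub P \<Longrightarrow> finite P"
  using finite_S subgroup.subset finite_subset by metis

lemma F_mon:
  assumes "sub P" "sub Q" "\<phi> \<in> F P Q"
  shows F_ext: "\<phi> \<in> extensional P"
    and F_closed: "u \<in> P \<Longrightarrow> \<phi> u \<in> Q"
    and F_mult: "u \<in> P \<Longrightarrow> v \<in> P \<Longrightarrow> \<phi> (u \<otimes> v) = \<phi> u \<otimes> \<phi> v"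
    and F_inj: "inj_on \<phi> P"
proof -
  have "F P Q \<subseteq> extensional P \<inter> mon (S\<lparr>carrier := P\<rparr>) (S\<lparr>carrier := Q\<rparr>)"
    using fusion_system assms by (simp add: fusion_system_def)
  then have "\<phi> \<in> extensional P" "\<phi> \<in> mon (S\<lparr>carrier := P\<rparr>) (S\<lparr>carrier := Q\<rparr>)" using assms by auto
  then show "\<phi> \<in> extensional P" "u \<in> P \<Longrightarrow> \<phi> u \<in> Q" "inj_on \<phi> P"
    "u \<in> P \<Longrightarrow> v \<in> P \<Longrightarrow> \<phi> (u \<otimes> v) = \<phi> u \<otimes> \<phi> v"
    by (auto simp: mon_def hom_def)
qed

lemma F_carrier:
  assumes "sub P" "sub Q" "\<phi> \<in> F P Q" "u \<in> P"
  shows "\<phi> u \<in> carrier S"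
  using F_closed[OF assms] assms by simp

lemma F_comp:
  assumes "sub P" "sub Q" "sub R" "\<phi> \<in> F P Q" "\<psi> \<in> F Q R"
  shows "compose P \<psi> \<phi> \<in> F P R"
  using fusion_system assms by (simp add: fusion_system_def)

lemma F_conj:
  assumes "sub P" "sub Q" "x \<in> carrier S" "\<And>u. u \<in> P \<Longrightarrow> cj x u \<in> Q"
  shows "restrict (cj x) P \<in> F P Q"
proof -
  have "conj_map S x P ` P \<subseteq> Q" using assms by (auto simp: conj_map_eq)
  then show ?thesis
    using fusion_system assms unfolding fusion_system_def by (auto simp: conj_map_eq)
qed

lemma F_incl:
  assumes "sub P" "sub Q" "P \<subseteq> Q"
  shows "incl P \<in> F P Q"
proof -
  have "incl P = restrict (cj \<one>) P" using assms by (auto simp: incl_def fun_eq_iff restrict_def)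
  then show ?thesis using F_conj[OF assms(1,2), of \<one>] assms by auto
qed

lemma F_one:
  assumes "sub P" "sub Q" "\<phi> \<in> F P Q"
  shows "\<phi> \<one> = \<one>"
proof -
  have "\<one> \<in> P" by (rule subgroup.one_closed[OF assms(1)])
  then have "\<phi> \<one> \<otimes> \<phi> \<one> = \<phi> \<one>" using F_mult[OF assms, of \<one> \<one>] by simp
  then show ?thesis using F_carrier[OF assms \<open>\<one> \<in> P\<close>] by (simp add: l_cancel_one)
qed

lemma F_inv:
  assumes "sub P" "sub Q" "\<phi> \<in> F P Q" "u \<in> P"
  shows "\<phi> (inv u) = inv (\<phi> u)"
proof -
  have iu: "inv u \<in> P" by (rule subgroup.m_inv_closed[OF assms(1,4)])
  have "\<phi> (inv u) \<otimes> \<phi> u = \<one>"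
    using F_mult[OF assms(1-3) iu assms(4)] F_one[OF assms(1-3)] assms by simp
  then show ?thesis
    using F_carrier[OF assms(1-3)] iu assms(4) by (metis inv_equality)
qed

lemma F_cj:
  assumes "sub P" "sub Q" "\<phi> \<in> F P Q" "u \<in> P" "x \<in> P"
  shows "\<phi> (cj x u) = cj (\<phi> x) (\<phi> u)"
  using assms subgroup.m_closed[OF assms(1)] subgroup.m_inv_closed[OF assms(1)]
  by (simp add: conj_by_def F_mult[OF assms(1-3)] F_inv[OF assms(1-3)])

lemma F_image_sub:
  assumes "sub P" "sub Q" "\<phi> \<in> F P Q"
  shows "sub (\<phi> ` P)"
proof (rule subgroupI)
  show "\<phi> ` P \<subseteq> carrier S" using F_carrier[OF assms] by auto
  show "\<phi> ` P \<noteq> {}" using subgroup.one_closed[OF assms(1)] by blast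
  show "inv a \<in> \<phi> ` P" if "a \<in> \<phi> ` P" for a
    using that F_inv[OF assms, symmetric] subgroup.m_inv_closed[OF assms(1)] by auto
  show "a \<otimes> b \<in> \<phi> ` P" if "a \<in> \<phi> ` P" "b \<in> \<phi> ` P" for a b
    using that F_mult[OF assms, symmetric] subgroup.m_closed[OF assms(1)] by auto
qed

lemma isosD:
  assumes "sub P" "sub Q" "\<phi> \<in> fusion_isos S F P Q"
  shows "\<phi> \<in> F P Q" "\<phi> ` P = Q" "restrict (inv_into P \<phi>) Q \<in> F Q P"
proof -
  obtain \<psi> where \<psi>: "\<phi> \<in> F P Q" "\<psi> \<in> F Q P" "compose P \<psi> \<phi> = incl P" "compose Q \<phi> \<psi> = incl Q"
    using assms(3) by (auto simp: fusion_isos_def inverse_arrows_def fusion_category_def)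
  then show "\<phi> \<in> F P Q" by simp
  have "\<phi> (\<psi> v) = v" if "v \<in> Q" for v
    using fun_cong[OF \<psi>(4), of v] that by (simp add: compose_def incl_def)
  then show im: "\<phi> ` P = Q"
    using F_closed[OF assms(1,2) \<psi>(1)] F_closed[OF assms(2,1) \<psi>(2)] by (auto simp: image_iff) metis
  have "\<psi> (\<phi> u) = u" if "u \<in> P" for u
    using fun_cong[OF \<psi>(3), of u] that by (simp add: compose_def incl_def)
  then have "restrict (inv_into P \<phi>) Q = \<psi>"
    using F_inj[OF assms(1,2) \<psi>(1)] im F_ext[OF assms(2,1) \<psi>(2)]
    by (intro extensionalityI[of _ Q]) auto
  then show "restrict (inv_into P \<phi>) Q \<in> F Q P" using \<psi> by simp
qed

lemma F_iso:
  assumes "sub P" "sub Q" "\<phi> \<in> F P Q"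
  shows "\<phi> \<in> fusion_isos S F P (\<phi> ` P)"
  using fusion_system assms by (simp add: fusion_system_def)

lemma F_onto_image:
  assumes "sub P" "sub Q" "\<phi> \<in> F P Q"
  shows "\<phi> \<in> F P (\<phi> ` P)" "restrict (inv_into P \<phi>) (\<phi> ` P) \<in> F (\<phi> ` P) P"
  using isosD[OF assms(1) F_image_sub[OF assms] F_iso[OF assms]] by auto

lemma F_corestrict:
  assumes "sub P" "sub Q" "sub R" "\<phi> \<in> F P Q" "\<phi> ` P \<subseteq> R"
  shows "\<phi> \<in> F P R"
proof -
  have s: "sub (\<phi> ` P)" by (rule F_image_sub[OF assms(1,2,4)])
  have "compose P (incl (\<phi> ` P)) \<phi> \<in> F P R"
    by (rule F_comp[OF assms(1) s assms(3) F_onto_image(1)[OF assms(1,2,4)] F_incl[OF s assms(3,5)]])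
  moreover have "compose P (incl (\<phi> ` P)) \<phi> = \<phi>"
    using F_ext[OF assms(1,2,4)] by (auto simp: compose_def incl_def fun_eq_iff restrict_def extensional_def)
  ultimately show ?thesis by simp
qed

lemma F_restrict:
  assumes "sub P" "sub Q" "sub R" "\<phi> \<in> F P Q" "R \<subseteq> P"
  shows "restrict \<phi> R \<in> F R Q"
proof -
  have "compose R \<phi> (incl R) \<in> F R Q"
    by (rule F_comp[OF assms(3,1,2) F_incl[OF assms(3,1,5)] assms(4)])
  moreover have "compose R \<phi> (incl R) = restrict \<phi> R" by (auto simp: compose_def incl_def fun_eq_iff)
  ultimately show ?thesis by simp
qed

lemma F_conj_comp:
  assumes "sub P" "sub Q" "sub R" "\<phi> \<in> F P Q" "x \<in> carrier S" "\<And>u. u \<in> P \<Longrightarrow> cj x (\<phi> u) \<in> R"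
  shows "(\<lambda>u\<in>P. cj x (\<phi> u)) \<in> F P R"
proof -
  have s: "sub (\<phi> ` P)" by (rule F_image_sub[OF assms(1,2,4)])
  have "compose P (restrict (cj x) (\<phi> ` P)) \<phi> \<in> F P R"
    by (rule F_comp[OF assms(1) s assms(3) F_onto_image(1)[OF assms(1,2,4)] F_conj[OF s assms(3)]])
      (use assms in auto)
  moreover have "compose P (restrict (cj x) (\<phi> ` P)) \<phi> = (\<lambda>u\<in>P. cj x (\<phi> u))"
    by (auto simp: compose_def fun_eq_iff)
  ultimately show ?thesis by simp
qed

lemma finite_F:
  assumes "sub P" "sub Q"
  shows "finite (F P Q)"
proof (rule finite_subset)
  show "F P Q \<subseteq> P \<rightarrow>\<^sub>E Q"
    using F_ext[OF assms] F_closed[OF assms] by (auto simp: PiE_def)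
  show "finite (P \<rightarrow>\<^sub>E Q)" using assms by (intro finite_PiE sub_finite)
qed

subsection \<open>Centric subgroups\<close>

text \<open>The second part is the form in which centricity is used: the conjugates of P are the
  images of P under morphisms, as every morphism is an isomorphism onto its image.\<close>

lemma centricsD:
  assumes "P \<in> centrics S F"
  shows "sub P"
    and "sub Q \<Longrightarrow> \<phi> \<in> F P Q \<Longrightarrow> g \<in> carrier S \<Longrightarrow> (\<And>u. u \<in> P \<Longrightarrow> g \<otimes> \<phi> u = \<phi> u \<otimes> g) \<Longrightarrow> g \<in> \<phi> ` P"
proof -
  show P: "sub P" using assms by (simp add: centrics_def)
  assume *: "sub Q" "\<phi> \<in> F P Q" "g \<in> carrier S" "\<And>u. u \<in> P \<Longrightarrow> g \<otimes> \<phi> u = \<phi> u \<otimes> g"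
  have "\<phi> ` P \<in> conjugates S F P"
    using F_image_sub[OF P *(1,2)] F_iso[OF P *(1,2)] by (auto simp: conjugates_def)
  then have "centralizer S (\<phi> ` P) \<subseteq> \<phi> ` P" using assms by (simp add: centrics_def)
  moreover have "g \<in> centralizer S (\<phi> ` P)" using * by (simp add: centralizer_def)
  ultimately show "g \<in> \<phi> ` P" by blast
qed

lemma centricsI:
  assumes "sub P" "\<And>Q \<phi> g. sub Q \<Longrightarrow> \<phi> \<in> F P Q \<Longrightarrow> g \<in> carrier S \<Longrightarrow>
    (\<And>u. u \<in> P \<Longrightarrow> g \<otimes> \<phi> u = \<phi> u \<otimes> g) \<Longrightarrow> g \<in> \<phi> ` P"
  shows "P \<in> centrics S F"
  unfolding centrics_def
proof (intro CollectI conjI ballI assms(1) subsetI)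
  fix Q g assume "Q \<in> conjugates S F P" and g: "g \<in> centralizer S Q"
  then obtain \<phi> where Q: "sub Q" and "\<phi> \<in> fusion_isos S F P Q" by (auto simp: conjugates_def)
  then have \<phi>: "\<phi> \<in> F P Q" "\<phi> ` P = Q" using isosD[OF assms(1)] by auto
  then show "g \<in> Q"
    using assms(2)[OF Q \<phi>(1), of g] g by (auto simp: centralizer_def)
qed

lemma centric_image:
  assumes P: "P \<in> centrics S F" and Q: "sub Q" and \<phi>: "\<phi> \<in> F P Q"
  shows "\<phi> ` P \<in> centrics S F"
proof (rule centricsI)
  have P': "sub P" using centricsD(1)[OF P] .
  show s: "sub (\<phi> ` P)" by (rule F_image_sub[OF P' Q \<phi>])
  fix R \<psi> g assume *: "sub R" "\<psi> \<in> F (\<phi> ` P) R" "g \<in> carrier S" "\<And>u. u \<in> \<phi> ` P \<Longrightarrow> g \<otimes> \<psi> u = \<psi> u \<otimes> g"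
  have "g \<in> compose P \<psi> \<phi> ` P"
    by (rule centricsD(2)[OF P *(1) F_comp[OF P' s *(1) F_onto_image(1)[OF P' Q \<phi>] *(2)] *(3)])
      (use * in \<open>auto simp: compose_def\<close>)
  then show "g \<in> \<psi> ` \<phi> ` P" by (auto simp: compose_def)
qed

text \<open>What centralizes the image of Q centralizes the image of P, hence lies in the image of P
  and so in that of Q.\<close>

lemma centric_mono:
  assumes P: "P \<in> centrics S F" and Q: "sub Q" "P \<subseteq> Q"
  shows "Q \<in> centrics S F"
proof (rule centricsI)
  have P': "sub P" using centricsD(1)[OF P] .
  fix R \<phi> g assume *: "sub R" "\<phi> \<in> F Q R" "g \<in> carrier S" "\<And>u. u \<in> Q \<Longrightarrow> g \<otimes> \<phi> u = \<phi> u \<otimes> g"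
  have "g \<in> restrict \<phi> P ` P"
    by (rule centricsD(2)[OF P *(1) F_restrict[OF Q(1) *(1) P' *(2) Q(2)] *(3)]) (use * Q in auto)
  then show "g \<in> \<phi> ` Q" using Q by auto
qed (rule Q)

end

section \<open>Consequences of saturation for centric subgroups\<close>

locale saturated_fusion = fusion +
  assumes saturated: "saturated p S F" and p_prime: "Factorial_Ring.prime p"
begin

text \<open>An element s that realizes the twisted conjugation normalizes the image of P of its own
  accord, because x normalizes P. Membership in \<open>Aut_S\<close> thus comes down to the
  existence of s.\<close>

lemma extender_iff:
  assumes P: "sub P" and Q: "sub Q" and \<phi>: "\<phi> \<in> F P Q"
  shows "x \<in> extender S P \<phi> \<longleftrightarrow> x \<in> carrier S \<and> (\<forall>u\<in>P. cj x u \<in> P) \<and>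
    (\<exists>s\<in>carrier S. \<forall>u\<in>P. \<phi> (cj x u) = cj s (\<phi> u))"
proof -
  have N: "x \<in> normalizer S P \<longleftrightarrow> x \<in> carrier S \<and> (\<forall>u\<in>P. cj x u \<in> P)"
    by (rule normalizer_iff[OF finite_S subgroup.subset[OF P]])
  have N': "s \<in> normalizer S (\<phi> ` P) \<longleftrightarrow> s \<in> carrier S \<and> (\<forall>u\<in>P. cj s (\<phi> u) \<in> \<phi> ` P)" for s
    using normalizer_iff[OF finite_S subgroup.subset[OF F_image_sub[OF P Q \<phi>]]] by auto
  have "(\<lambda>y\<in>\<phi> ` P. \<phi> (conj_map S x P (inv_into P \<phi> y))) \<in> Aut_S S (\<phi> ` P) \<longleftrightarrow>
      (\<exists>s\<in>carrier S. \<forall>u\<in>P. \<phi> (cj x u) = cj s (\<phi> u))" if x: "x \<in> normalizer S P"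
  proof -
    have "(\<lambda>y\<in>\<phi> ` P. \<phi> (conj_map S x P (inv_into P \<phi> y))) = conj_map S s (\<phi> ` P) \<longleftrightarrow>
        (\<forall>u\<in>P. \<phi> (cj x u) = cj s (\<phi> u))" for s
      using F_inj[OF P Q \<phi>] by (auto simp: fun_eq_iff conj_map_eq restrict_def)
    moreover have "s \<in> normalizer S (\<phi> ` P)" if "s \<in> carrier S" "\<forall>u\<in>P. \<phi> (cj x u) = cj s (\<phi> u)" for s
      using that x unfolding N N' by (metis imageI)
    ultimately show ?thesis
      unfolding Aut_S_def image_iff using N' by metis
  qed
  then show ?thesis unfolding extender_def using N by auto
qed

lemma extender_sub:
  assumes P: "sub P" and Q: "sub Q" and \<phi>: "\<phi> \<in> F P Q"
  shows "sub (extender S P \<phi>)"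
proof (rule subgroupI)
  note iff = extender_iff[OF P Q \<phi>]
  note \<phi>c = F_carrier[OF P Q \<phi>]
  show "extender S P \<phi> \<subseteq> carrier S" using iff by auto
  have "\<one> \<in> extender S P \<phi>"
    unfolding iff using P \<phi>c by (auto intro!: bexI[of _ \<one>])
  then show "extender S P \<phi> \<noteq> {}" by blast
  show "x \<otimes> y \<in> extender S P \<phi>" if xy: "x \<in> extender S P \<phi>" "y \<in> extender S P \<phi>" for x y
  proof -
    obtain s t where "s \<in> carrier S" "\<forall>u\<in>P. \<phi> (cj x u) = cj s (\<phi> u)"
      "t \<in> carrier S" "\<forall>u\<in>P. \<phi> (cj y u) = cj t (\<phi> u)" using xy iff by auto
    then show ?thesis
      unfolding iff using xy[unfolded iff] P \<phi>c
      by (auto simp: cj_mult intro!: bexI[of _ "s \<otimes> t"])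
  qed
  show "inv x \<in> extender S P \<phi>" if x: "x \<in> extender S P \<phi>" for x
  proof -
    obtain s where s: "s \<in> carrier S" "\<And>u. u \<in> P \<Longrightarrow> \<phi> (cj x u) = cj s (\<phi> u)" using x iff by auto
    have xc: "x \<in> carrier S" and xP: "\<And>u. u \<in> P \<Longrightarrow> cj x u \<in> P" using x iff by auto
    have "inj_on (cj x) P" using xc P by (intro inj_onI) (simp add: cj_inj)
    then have "cj x ` P = P" using xP sub_finite[OF P] by (intro endo_inj_surj) auto
    then have inv: "\<exists>v\<in>P. u = cj x v" if "u \<in> P" for u using that by blast
    have "cj (inv x) u \<in> P \<and> \<phi> (cj (inv x) u) = cj (inv s) (\<phi> u)" if u: "u \<in> P" for u
    proof -
      obtain v where v: "v \<in> P" "u = cj x v" using inv[OF u] by blast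
      then show ?thesis using xc P s \<phi>c by simp
    qed
    then show ?thesis unfolding iff using xc s(1) by (auto intro!: bexI[of _ "inv s"])
  qed
qed

text \<open>The centralizer of a conjugate of P is its centre, and isomorphic groups have centres of
  equal order.\<close>

lemma centric_fully_centralized:
  assumes P: "P \<in> centrics S F"
  shows "fully_centralized S F P"
  unfolding fully_centralized_def
proof (intro conjI ballI)
  show P': "sub P" using centricsD(1)[OF P] .
  fix Q assume "Q \<in> conjugates S F P"
  then obtain \<phi> where Q: "sub Q" and i: "\<phi> \<in> fusion_isos S F P Q" by (auto simp: conjugates_def)
  note \<phi> = isosD[OF P' Q i]
  have sub: "centralizer S Q \<subseteq> \<phi> ` centralizer S P"
  proof
    fix g assume g: "g \<in> centralizer S Q"
    then obtain u where u: "u \<in> P" "g = \<phi> u"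
      using centricsD(2)[OF P Q \<phi>(1), of g] \<phi>(2) by (auto simp: centralizer_def)
    have "u \<otimes> v = v \<otimes> u" if v: "v \<in> P" for v
    proof (rule inj_onD[OF F_inj[OF P' Q \<phi>(1)]])
      have "\<phi> v \<in> Q" using F_closed[OF P' Q \<phi>(1) v] .
      then show "\<phi> (u \<otimes> v) = \<phi> (v \<otimes> u)"
        using g u v by (simp add: centralizer_def F_mult[OF P' Q \<phi>(1)])
    qed (use u v subgroup.m_closed[OF P'] in auto)
    then show "g \<in> \<phi> ` centralizer S P" using u P' by (auto simp: centralizer_def)
  qed
  have fin: "finite (centralizer S P)" using finite_S by (auto simp: centralizer_def)
  show "card (centralizer S Q) \<le> card (centralizer S P)"
    using card_mono[OF _ sub] card_image_le[OF fin, of \<phi>] fin by simp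
qed

text \<open>The extension axiom applies to every \<phi> here, since its image is centric and so
  fully centralized; the two conditions on N say that N lies in the extender of \<phi>.\<close>

lemma extension:
  assumes P: "P \<in> centrics S F" and \<phi>: "\<phi> \<in> F P (carrier S)" and N: "sub N" "P \<subseteq> N"
    and ext: "\<And>x u. x \<in> N \<Longrightarrow> u \<in> P \<Longrightarrow> cj x u \<in> P"
    and conj: "\<And>x. x \<in> N \<Longrightarrow> \<exists>s\<in>carrier S. \<forall>u\<in>P. \<phi> (cj x u) = cj s (\<phi> u)"
  shows "\<exists>\<psi>\<in>F N (carrier S). \<forall>u\<in>P. \<psi> u = \<phi> u"
proof -
  have P': "sub P" using centricsD(1)[OF P] .
  have "fully_centralized S F (\<phi> ` P)"
    by (rule centric_fully_centralized[OF centric_image[OF P subgroup_self \<phi>]])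
  then obtain \<psi> where \<psi>: "\<psi> \<in> F (extender S P \<phi>) (carrier S)" "\<forall>u\<in>P. \<psi> u = \<phi> u"
    using saturated P' \<phi> unfolding saturated_def by blast
  have "N \<subseteq> extender S P \<phi>"
    using N ext conj by (auto simp: extender_iff[OF P' subgroup_self \<phi>])
  then have "restrict \<psi> N \<in> F N (carrier S)"
    by (rule F_restrict[OF extender_sub[OF P' subgroup_self \<phi>] subgroup_self N(1) \<psi>(1)])
  then show ?thesis using \<psi>(2) N(2) by (intro bexI[of _ "restrict \<psi> N"]) auto
qed

lemma fully_normalized_conjugate:
  assumes P: "sub P"
  shows "\<exists>Q \<kappa>. sub Q \<and> \<kappa> \<in> fusion_isos S F P Q \<and> fully_normalized S F Q"
proof -
  have "incl P ` P = P" by (auto simp: incl_def)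
  then have "P \<in> conjugates S F P"
    using P F_iso[OF P P F_incl[OF P P]] by (auto simp: conjugates_def)
  moreover have "finite (conjugates S F P)"
    by (rule finite_subset[of _ "Pow (carrier S)"]) (auto simp: conjugates_def finite_S dest: subgroup.subset)
  ultimately have ne: "conjugates S F P \<noteq> {}" and fin: "finite (conjugates S F P)" by auto
  let ?f = "\<lambda>R. card (normalizer S R)"
  obtain Q where Q: "Q \<in> conjugates S F P" "?f Q = Max (?f ` conjugates S F P)"
    using Max_in[of "?f ` conjugates S F P"] ne fin by (metis (no_types, lifting) finite_imageI image_iff image_is_empty)
  then have max: "?f R \<le> ?f Q" if "R \<in> conjugates S F P" for R
    using that fin by simp
  from Q(1) obtain \<kappa> where sQ: "sub Q" and \<kappa>: "\<kappa> \<in> fusion_isos S F P Q" by (auto simp: conjugates_def)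
  \<comment> \<open>Conjugacy is transitive, so the maximum taken over the conjugates of P also
    bounds those of Q.\<close>
  have "R \<in> conjugates S F P" if R: "R \<in> conjugates S F Q" for R
  proof -
    obtain \<psi> where sR: "sub R" and \<psi>: "\<psi> \<in> fusion_isos S F Q R" using R by (auto simp: conjugates_def)
    note k = isosD[OF P sQ \<kappa>] and s = isosD[OF sQ sR \<psi>]
    have "compose P \<psi> \<kappa> \<in> F P R" by (rule F_comp[OF P sQ sR k(1) s(1)])
    moreover have "compose P \<psi> \<kappa> ` P = R" using k(2) s(2) by (auto simp: compose_def)
    ultimately show ?thesis using F_iso[OF P sR] sR by (auto simp: conjugates_def)
  qed
  then have "fully_normalized S F Q" using sQ max by (simp add: fully_normalized_def)
  then show ?thesis using sQ \<kappa> by blast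
qed

lemma F_self_Bij:
  assumes "sub P"
  shows "F P P \<subseteq> Bij P"
proof
  fix \<phi> assume \<phi>: "\<phi> \<in> F P P"
  have "\<phi> ` P = P"
    using F_closed[OF assms assms \<phi>] F_inj[OF assms assms \<phi>] sub_finite[OF assms]
    by (intro endo_inj_surj) auto
  then show "\<phi> \<in> Bij P" using F_ext[OF assms assms \<phi>] F_inj[OF assms assms \<phi>] by (auto simp: Bij_def bij_betw_def)
qed

lemma Aut_F_group:
  assumes P: "sub P"
  shows "group (Aut_F F P)" "finite (carrier (Aut_F F P))"
    and "\<alpha> \<in> F P P \<Longrightarrow> \<beta> \<in> F P P \<Longrightarrow> \<alpha> \<otimes>\<^bsub>Aut_F F P\<^esub> \<beta> = compose P \<alpha> \<beta>"
    and "\<alpha> \<in> F P P \<Longrightarrow> u \<in> P \<Longrightarrow> (inv\<^bsub>Aut_F F P\<^esub> \<alpha>) (\<alpha> u) = u"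
    and "\<one>\<^bsub>Aut_F F P\<^esub> = (\<lambda>u\<in>P. u)" and "carrier (Aut_F F P) = F P P"
proof -
  note B = F_self_Bij[OF P]
  interpret B: group "BijGroup P" by (rule group_BijGroup)
  show car: "carrier (Aut_F F P) = F P P" by (simp add: Aut_F_def)
  show mult: "\<alpha> \<in> F P P \<Longrightarrow> \<beta> \<in> F P P \<Longrightarrow> \<alpha> \<otimes>\<^bsub>Aut_F F P\<^esub> \<beta> = compose P \<alpha> \<beta>" for \<alpha> \<beta>
    using B by (auto simp: Aut_F_def BijGroup_def)
  show one: "\<one>\<^bsub>Aut_F F P\<^esub> = (\<lambda>u\<in>P. u)" by (simp add: Aut_F_def BijGroup_def)
  have "subgroup (F P P) (BijGroup P)"
  proof (rule B.subgroupI)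
    show "F P P \<subseteq> carrier (BijGroup P)" using B by (simp add: BijGroup_def)
    show "F P P \<noteq> {}" using F_incl[OF P P] by blast
    show "\<alpha> \<otimes>\<^bsub>BijGroup P\<^esub> \<beta> \<in> F P P" if "\<alpha> \<in> F P P" "\<beta> \<in> F P P" for \<alpha> \<beta>
      using that B F_comp[OF P P P] by (auto simp: BijGroup_def)
    show "inv\<^bsub>BijGroup P\<^esub> \<alpha> \<in> F P P" if a: "\<alpha> \<in> F P P" for \<alpha>
    proof -
      have "\<alpha> ` P = P" using B a by (auto simp: Bij_def bij_betw_def)
      then show ?thesis using F_onto_image(2)[OF P P a] B a by (auto simp: inv_BijGroup)
    qed
  qed
  then show g: "group (Aut_F F P)" unfolding Aut_F_def by (rule B.subgroup_imp_group)
  show "finite (carrier (Aut_F F P))" using finite_F[OF P P] car by simp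
  interpret A: group "Aut_F F P" by (rule g)
  assume a: "\<alpha> \<in> F P P" and u: "u \<in> P"
  have "inv\<^bsub>Aut_F F P\<^esub> \<alpha> \<otimes>\<^bsub>Aut_F F P\<^esub> \<alpha> = \<one>\<^bsub>Aut_F F P\<^esub>" using a car by simp
  moreover have "inv\<^bsub>Aut_F F P\<^esub> \<alpha> \<in> F P P" using a car A.inv_closed by blast
  ultimately have "compose P (inv\<^bsub>Aut_F F P\<^esub> \<alpha>) \<alpha> = (\<lambda>u\<in>P. u)" using mult a one by metis
  from fun_cong[OF this, of u] show "(inv\<^bsub>Aut_F F P\<^esub> \<alpha>) (\<alpha> u) = u" using u by (simp add: compose_def)
qed

text \<open>An automorphism of \<open>P\<close> which is the identity on a centric \<open>Q\<close> and on the cosets of \<open>Q\<close> has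
  \<open>p\<close>-power order, hence is conjugate to an element of a Sylow subgroup of the form \<open>Aut_S P'\<close>, and
  therefore is given by conjugation with an element centralizing \<open>Q\<close>.\<close>

lemma automorphism_fixing_centric:
  assumes Q: "Q \<in> centrics S F" and P: "sub P" "Q \<subseteq> P" and \<alpha>: "\<alpha> \<in> F P P"
    and fix_Q: "\<And>u. u \<in> Q \<Longrightarrow> \<alpha> u = u"
    and cosets: "\<And>u. u \<in> P \<Longrightarrow> inv u \<otimes> \<alpha> u \<in> Q"
  shows "\<exists>z\<in>Q. \<forall>u\<in>P. \<alpha> u = cj z u"
proof -
  have Q': "sub Q" using centricsD(1)[OF Q] .
  interpret AP: group "Aut_F F P" by (rule Aut_F_group[OF P(1)])
  note AP = Aut_F_group[OF P(1)]
  obtain n where n: "order S = p ^ n" using order_S by blast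
  \<comment> \<open>As \<open>\<alpha>\<close> fixes Q, iterating it only multiplies u by powers of
    one element of Q.\<close>
  have pow: "(\<alpha> [^]\<^bsub>Aut_F F P\<^esub> m) u = u \<otimes> (inv u \<otimes> \<alpha> u) [^] m" if u: "u \<in> P" for u and m :: nat
  proof (induction m)
    case 0
    then show ?case using u P by (simp add: AP(5))
  next
    case (Suc m)
    have z: "inv u \<otimes> \<alpha> u \<in> Q" using cosets u by simp
    have zm: "(inv u \<otimes> \<alpha> u) [^] m \<in> Q" using z Q'
      by (induction m) (auto intro: subgroup.one_closed subgroup.m_closed)
    have \<alpha>u: "\<alpha> u \<in> carrier S" using F_carrier[OF P(1) P(1) \<alpha> u] .
    have "\<alpha> [^]\<^bsub>Aut_F F P\<^esub> Suc m = \<alpha> \<otimes>\<^bsub>Aut_F F P\<^esub> (\<alpha> [^]\<^bsub>Aut_F F P\<^esub> m)"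
      using \<alpha> AP(6) AP.nat_pow_Suc2 by simp
    also have "\<dots> = compose P \<alpha> (\<alpha> [^]\<^bsub>Aut_F F P\<^esub> m)"
      using \<alpha> AP.nat_pow_closed[of \<alpha> m] by (intro AP(3)) (auto simp: AP(6))
    finally have "(\<alpha> [^]\<^bsub>Aut_F F P\<^esub> Suc m) u = \<alpha> (u \<otimes> (inv u \<otimes> \<alpha> u) [^] m)"
      using u Suc by (simp add: compose_def)
    also have "\<dots> = \<alpha> u \<otimes> (inv u \<otimes> \<alpha> u) [^] m"
      using F_mult[OF P(1) P(1) \<alpha> u] zm P(2) fix_Q by auto
    also have "\<dots> = u \<otimes> (inv u \<otimes> \<alpha> u) [^] Suc m"
    proof -
      have "u \<otimes> (inv u \<otimes> \<alpha> u) [^] Suc m = u \<otimes> ((inv u \<otimes> \<alpha> u) \<otimes> (inv u \<otimes> \<alpha> u) [^] m)"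
        using u P(1) \<alpha>u by (subst nat_pow_Suc2) auto
      also have "\<dots> = u \<otimes> (inv u \<otimes> \<alpha> u) \<otimes> (inv u \<otimes> \<alpha> u) [^] m"
        using u P(1) \<alpha>u by (intro m_assoc[symmetric]) auto
      also have "u \<otimes> (inv u \<otimes> \<alpha> u) = \<alpha> u"
        using u P(1) \<alpha>u by (simp add: m_assoc[symmetric])
      finally show ?thesis by simp
    qed
    finally show ?case .
  qed
  \<comment> \<open>The exponent is the order of S, which kills the element of Q in
    \<open>pow\<close>.\<close>
  have "\<alpha> [^]\<^bsub>Aut_F F P\<^esub> (p ^ n) = \<one>\<^bsub>Aut_F F P\<^esub>"
  proof (rule extensionalityI[of _ P])
    show "\<alpha> [^]\<^bsub>Aut_F F P\<^esub> (p ^ n) \<in> extensional P"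
      using \<alpha> AP.nat_pow_closed[of \<alpha> "p ^ n"] F_ext[OF P(1) P(1)] by (simp add: AP(6))
    fix u assume u: "u \<in> P"
    have c: "inv u \<otimes> \<alpha> u \<in> carrier S" using u P(1) F_carrier[OF P(1) P(1) \<alpha> u] by simp
    show "(\<alpha> [^]\<^bsub>Aut_F F P\<^esub> (p ^ n)) u = \<one>\<^bsub>Aut_F F P\<^esub> u"
      using u P(1) pow_order_eq_1[OF c] n by (simp add: pow AP(5))
  qed (simp add: AP(5))
  note \<alpha>pow = this
  \<comment> \<open>The Sylow property is available for fully normalized subgroups only, so
    \<open>\<alpha>\<close> is carried to such a conjugate R of P; \<open>h\<close> is the transport
    of automorphisms along \<open>\<kappa>\<close>.\<close>
  obtain R \<kappa> where R: "sub R" "\<kappa> \<in> fusion_isos S F P R" "fully_normalized S F R"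
    using fully_normalized_conjugate[OF P(1)] by blast
  note \<kappa> = isosD[OF P(1) R(1,2)]
  define \<kappa>' where "\<kappa>' = restrict (inv_into P \<kappa>) R"
  have \<kappa>': "\<kappa>' \<in> F R P" "\<And>u. u \<in> P \<Longrightarrow> \<kappa>' (\<kappa> u) = u" "\<And>v. v \<in> R \<Longrightarrow> \<kappa> (\<kappa>' v) = v"
    using \<kappa> F_inj[OF P(1) R(1) \<kappa>(1)] by (auto simp: \<kappa>'_def f_inv_into_f)
  interpret AR: group "Aut_F F R" by (rule Aut_F_group[OF R(1)])
  note AR = Aut_F_group[OF R(1)]
  define h where "h \<beta> = compose R \<kappa> (compose R \<beta> \<kappa>')" for \<beta>
  have h: "h \<beta> \<in> F R R" "\<And>v. v \<in> R \<Longrightarrow> h \<beta> v = \<kappa> (\<beta> (\<kappa>' v))" if "\<beta> \<in> F P P" for \<beta>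
    using that F_comp[OF R(1) P(1) R(1) F_comp[OF R(1) P(1) P(1) \<kappa>'(1) that] \<kappa>(1)]
    by (auto simp: h_def compose_def)
  have hpow: "h \<alpha> [^]\<^bsub>Aut_F F R\<^esub> m = h (\<alpha> [^]\<^bsub>Aut_F F P\<^esub> m)" for m :: nat
  proof (induction m)
    case 0
    have one: "\<one>\<^bsub>Aut_F F P\<^esub> \<in> F P P" using AP(6) AP.one_closed by blast
    have "\<one>\<^bsub>Aut_F F R\<^esub> = h \<one>\<^bsub>Aut_F F P\<^esub>"
    proof (rule extensionalityI[of _ R])
      show "h \<one>\<^bsub>Aut_F F P\<^esub> \<in> extensional R" by (rule F_ext[OF R(1) R(1) h(1)[OF one]])
      fix v assume "v \<in> R"
      then show "\<one>\<^bsub>Aut_F F R\<^esub> v = h \<one>\<^bsub>Aut_F F P\<^esub> v"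
        using F_closed[OF R(1) P(1) \<kappa>'(1)] h(2)[OF one] \<kappa>'(3) by (simp add: AR(5) AP(5))
    qed (simp add: AR(5))
    then show ?case by simp
  next
    case (Suc m)
    have am: "\<alpha> [^]\<^bsub>Aut_F F P\<^esub> m \<in> F P P" using \<alpha> AP.nat_pow_closed[of \<alpha> m] by (simp add: AP(6))
    have "h \<alpha> [^]\<^bsub>Aut_F F R\<^esub> Suc m = compose R (h (\<alpha> [^]\<^bsub>Aut_F F P\<^esub> m)) (h \<alpha>)"
      using Suc h(1)[OF am] h(1)[OF \<alpha>] by (simp add: AR(3))
    also have "\<dots> = h (compose P (\<alpha> [^]\<^bsub>Aut_F F P\<^esub> m) \<alpha>)"
    proof (rule extensionalityI[of _ R])
      note c = F_comp[OF P(1) P(1) P(1) \<alpha> am]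
      show "h (compose P (\<alpha> [^]\<^bsub>Aut_F F P\<^esub> m) \<alpha>) \<in> extensional R" by (rule F_ext[OF R(1) R(1) h(1)[OF c]])
      fix v assume v: "v \<in> R"
      have "h (compose P (\<alpha> [^]\<^bsub>Aut_F F P\<^esub> m) \<alpha>) v = \<kappa> ((\<alpha> [^]\<^bsub>Aut_F F P\<^esub> m) (\<alpha> (\<kappa>' v)))"
        using h(2)[OF c v] F_closed[OF R(1) P(1) \<kappa>'(1) v] by (simp add: compose_def)
      moreover have "\<alpha> (\<kappa>' v) \<in> P" using F_closed[OF P(1) P(1) \<alpha>] F_closed[OF R(1) P(1) \<kappa>'(1) v] by simp
      ultimately show "compose R (h (\<alpha> [^]\<^bsub>Aut_F F P\<^esub> m)) (h \<alpha>) v = h (compose P (\<alpha> [^]\<^bsub>Aut_F F P\<^esub> m) \<alpha>) v"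
        using v F_closed[OF R(1) R(1) h(1)[OF \<alpha>] v] \<kappa>'(2) by (simp add: compose_def h(2)[OF am] h(2)[OF \<alpha>])
    qed (simp add: compose_def)
    also have "\<dots> = h (\<alpha> [^]\<^bsub>Aut_F F P\<^esub> Suc m)" using am \<alpha> by (simp add: AP(3))
    finally show ?case .
  qed
  have "h \<alpha> [^]\<^bsub>Aut_F F R\<^esub> (p ^ n) = h (\<alpha> [^]\<^bsub>Aut_F F P\<^esub> (0 :: nat))"
    unfolding hpow \<alpha>pow by simp
  then have hp: "h \<alpha> [^]\<^bsub>Aut_F F R\<^esub> (p ^ n) = \<one>\<^bsub>Aut_F F R\<^esub>"
    unfolding hpow[symmetric] by simp
  have "sylow_subgroup p (Aut_F F R) (Aut_S S R)" using saturated R(3) by (simp add: saturated_def)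
  then obtain \<gamma> where \<gamma>: "\<gamma> \<in> F R R"
    "\<gamma> \<otimes>\<^bsub>Aut_F F R\<^esub> h \<alpha> \<otimes>\<^bsub>Aut_F F R\<^esub> inv\<^bsub>Aut_F F R\<^esub> \<gamma> \<in> Aut_S S R"
    using AR.p_element_conjugate_into_sylow[OF AR(2) p_prime _ _ hp] h(1)[OF \<alpha>] by (auto simp: AR(6))
  then obtain g where g: "g \<in> normalizer S R"
    "\<gamma> \<otimes>\<^bsub>Aut_F F R\<^esub> h \<alpha> \<otimes>\<^bsub>Aut_F F R\<^esub> inv\<^bsub>Aut_F F R\<^esub> \<gamma> = conj_map S g R" by (auto simp: Aut_S_def)
  have gS: "g \<in> carrier S" using g(1) normalizer_iff[OF finite_S subgroup.subset[OF R(1)]] by blast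
  have \<gamma>i: "inv\<^bsub>Aut_F F R\<^esub> \<gamma> \<in> F R R" using \<gamma>(1) AR(6) AR.inv_closed by blast
  have conj: "\<gamma> (h \<alpha> v) = cj g (\<gamma> v)" if v: "v \<in> R" for v
  proof -
    have \<gamma>v: "\<gamma> v \<in> R" using F_closed[OF R(1) R(1) \<gamma>(1) v] .
    have "\<gamma> \<otimes>\<^bsub>Aut_F F R\<^esub> h \<alpha> \<otimes>\<^bsub>Aut_F F R\<^esub> inv\<^bsub>Aut_F F R\<^esub> \<gamma> =
        compose R (compose R \<gamma> (h \<alpha>)) (inv\<^bsub>Aut_F F R\<^esub> \<gamma>)"
      using \<gamma>(1) \<gamma>i h(1)[OF \<alpha>] F_comp[OF R(1) R(1) R(1)] by (simp add: AR(3))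
    then have "(compose R (compose R \<gamma> (h \<alpha>)) (inv\<^bsub>Aut_F F R\<^esub> \<gamma>)) (\<gamma> v) = restrict (cj g) R (\<gamma> v)"
      using g(2) by (simp only: conj_map_eq)
    also have "\<dots> = cj g (\<gamma> v)" using \<gamma>v by simp
    finally have "(compose R (compose R \<gamma> (h \<alpha>)) (inv\<^bsub>Aut_F F R\<^esub> \<gamma>)) (\<gamma> v) = cj g (\<gamma> v)" .
    then show ?thesis using \<gamma>v v by (simp add: compose_def AR(4)[OF \<gamma>(1)])
  qed
  \<comment> \<open>Along this isomorphism \<open>\<alpha>\<close> becomes conjugation by
    \<open>g\<close>, an element of S that may still lie outside R.\<close>
  define \<mu> where "\<mu> = compose P \<gamma> \<kappa>"
  have \<mu>: "\<mu> \<in> F P R" unfolding \<mu>_def by (rule F_comp[OF P(1) R(1) R(1) \<kappa>(1) \<gamma>(1)])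
  have \<mu>\<alpha>: "\<mu> (\<alpha> u) = cj g (\<mu> u)" if u: "u \<in> P" for u
    using conj[of "\<kappa> u"] F_closed[OF P(1) R(1) \<kappa>(1) u] u F_closed[OF P(1) P(1) \<alpha> u]
    by (simp add: \<mu>_def compose_def h[OF \<alpha>] \<kappa>')
  \<comment> \<open>Since \<open>\<alpha>\<close> is the identity on Q, the element \<open>g\<close>
    centralizes the image of Q. Centricity puts it into that image, which produces z.\<close>
  have "g \<in> restrict \<mu> Q ` Q"
  proof (rule centricsD(2)[OF Q R(1) F_restrict[OF P(1) R(1) Q' \<mu> P(2)] gS])
    fix u assume u: "u \<in> Q"
    then have "cj g (\<mu> u) = cj \<one> (\<mu> u)" using \<mu>\<alpha>[of u] fix_Q[OF u] P F_carrier[OF P(1) R(1) \<mu>] by auto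
    then show "g \<otimes> restrict \<mu> Q u = restrict \<mu> Q u \<otimes> g"
      using u P F_carrier[OF P(1) R(1) \<mu>] gS by (subst (asm) cj_eq_iff_commutes) auto
  qed
  then obtain z where z: "z \<in> Q" "g = \<mu> z" by auto
  have "\<alpha> u = cj z u" if u: "u \<in> P" for u
  proof (rule inj_onD[OF F_inj[OF P(1) R(1) \<mu>]])
    show "\<mu> (\<alpha> u) = \<mu> (cj z u)" using u z P \<mu>\<alpha> F_cj[OF P(1) R(1) \<mu>] by auto
    show "\<alpha> u \<in> P" using F_closed[OF P(1) P(1) \<alpha> u] .
    show "cj z u \<in> P" using u z P cj_self by auto
  qed
  then show ?thesis using z(1) by blast
qed

end

section \<open>Uniqueness of extensions up to conjugation in S\<close>

context saturated_fusion
begin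

definition normalizer_in :: "'a set \<Rightarrow> 'a set \<Rightarrow> 'a set" where
  "normalizer_in P Q = {x \<in> P. \<forall>u\<in>Q. cj x u \<in> Q}"

lemma normalizer_in:
  assumes P: "sub P" and Q: "sub Q" "Q \<subseteq> P"
  shows "sub (normalizer_in P Q)" "Q \<subseteq> normalizer_in P Q" "normalizer_in P Q \<subseteq> P"
    "Q \<noteq> P \<Longrightarrow> Q \<subset> normalizer_in P Q"
proof -
  have "normalizer_in P Q = P \<inter> normalizer S Q"
    using P by (auto simp: normalizer_in_def normalizer_iff[OF finite_S subgroup.subset[OF Q(1)]])
  then show "sub (normalizer_in P Q)"
    using subgroups_Inter_pair[OF P normalizer_imp_subgroup[OF subgroup.subset[OF Q(1)]]] by simp
  show sub: "Q \<subseteq> normalizer_in P Q" "normalizer_in P Q \<subseteq> P"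
    using Q cj_self[OF Q(1)] by (auto simp: normalizer_in_def)
  assume "Q \<noteq> P"
  then have "Q \<subset> P" using Q by auto
  moreover obtain n where "order S = p ^ n" using order_S by blast
  ultimately obtain x where "x \<in> P - Q" "\<forall>u\<in>Q. x \<otimes> u \<otimes> inv x \<in> Q"
    using normalizer_grows[OF finite_S _ p_prime Q(1) P] by blast
  then have "x \<in> normalizer_in P Q - Q" by (simp add: normalizer_in_def conj_by_def)
  then show "Q \<subset> normalizer_in P Q" using sub by auto
qed

text \<open>After conjugating by s the two maps coincide on Q. For x in P their values at x
  conjugate the image of Q alike, so they differ by an element of this image, by centricity. Hence
  both have the same image, and comparing them gives an automorphism of P to which
  \<open>automorphism_fixing_centric\<close> applies.\<close>

lemma restriction_unique_normal:
  assumes Q: "Q \<in> centrics S F" and P: "sub P" "Q \<subseteq> P"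
    and \<psi>1: "\<psi>1 \<in> F P (carrier S)" and \<psi>2: "\<psi>2 \<in> F P (carrier S)"
    and s: "s \<in> carrier S" "\<And>u. u \<in> Q \<Longrightarrow> \<psi>2 u = cj s (\<psi>1 u)"
    and normal: "\<And>x u. x \<in> P \<Longrightarrow> u \<in> Q \<Longrightarrow> cj x u \<in> Q"
  shows "\<exists>t\<in>carrier S. \<forall>u\<in>P. \<psi>2 u = cj t (\<psi>1 u)"
proof -
  note SS = subgroup_self
  have Q': "sub Q" using centricsD(1)[OF Q] .
  have \<psi>1c: "\<psi>1 u \<in> carrier S" and \<psi>2c: "\<psi>2 u \<in> carrier S" if "u \<in> P" for u
    using that F_carrier[OF P(1) SS] \<psi>1 \<psi>2 by auto
  define \<chi> where "\<chi> = (\<lambda>u\<in>P. cj s (\<psi>1 u))"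
  have \<chi>: "\<chi> \<in> F P (carrier S)"
    unfolding \<chi>_def by (rule F_conj_comp[OF P(1) SS SS \<psi>1 s(1)]) (use s \<psi>1c in auto)
  have \<chi>c: "\<chi> u \<in> carrier S" if "u \<in> P" for u
    using that F_carrier[OF P(1) SS \<chi>] by auto
  have agree: "\<psi>2 u = \<chi> u" if "u \<in> Q" for u using that s P by (auto simp: \<chi>_def)
  have coset: "inv (\<chi> x) \<otimes> \<psi>2 x \<in> \<chi> ` Q" if x: "x \<in> P" for x
  proof -
    have "inv (\<chi> x) \<otimes> \<psi>2 x \<in> restrict \<chi> Q ` Q"
    proof (rule centricsD(2)[OF Q SS F_restrict[OF P(1) SS Q' \<chi> P(2)]])
      show "inv (\<chi> x) \<otimes> \<psi>2 x \<in> carrier S" using x \<chi>c \<psi>2c by simp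
      fix u assume u: "u \<in> Q"
      then have uP: "u \<in> P" using P by auto
      \<comment> \<open>Both sides are the common value of the two maps at the conjugate of u by x,
        which lies in Q by normality.\<close>
      have "cj (\<psi>2 x) (\<psi>2 u) = cj (\<chi> x) (\<chi> u)"
        using agree[OF normal[OF x u]] x uP by (simp add: F_cj[OF P(1) SS \<psi>2] F_cj[OF P(1) SS \<chi>])
      then have "cj (\<psi>2 x) (\<chi> u) = cj (\<chi> x) (\<chi> u)" using agree[OF u] by simp
      then show "inv (\<chi> x) \<otimes> \<psi>2 x \<otimes> restrict \<chi> Q u = restrict \<chi> Q u \<otimes> (inv (\<chi> x) \<otimes> \<psi>2 x)"
        using u uP x \<chi>c \<psi>2c by (subst (asm) cj_eq_iff_commutes) auto
    qed
    then show ?thesis by auto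
  qed
  have \<psi>2_image: "\<psi>2 x \<in> \<chi> ` P" if x: "x \<in> P" for x
  proof -
    obtain q where q: "q \<in> Q" "inv (\<chi> x) \<otimes> \<psi>2 x = \<chi> q" using coset[OF x] by auto
    then have qP: "q \<in> P" using P by auto
    have "\<psi>2 x = \<chi> x \<otimes> (inv (\<chi> x) \<otimes> \<psi>2 x)" using \<chi>c \<psi>2c x by (simp add: m_assoc[symmetric])
    also have "\<dots> = \<chi> (x \<otimes> q)" using q qP x by (simp add: F_mult[OF P(1) SS \<chi>])
    finally show ?thesis using x qP subgroup.m_closed[OF P(1)] by blast
  qed
  note im = F_image_sub[OF P(1) SS \<chi>]
  define \<chi>' where "\<chi>' = restrict (inv_into P \<chi>) (\<chi> ` P)"
  have \<chi>': "\<chi>' \<in> F (\<chi> ` P) P" "\<And>u. u \<in> P \<Longrightarrow> \<chi>' (\<chi> u) = u"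
    unfolding \<chi>'_def using F_onto_image(2)[OF P(1) SS \<chi>] F_inj[OF P(1) SS \<chi>] by auto
  \<comment> \<open>The comparison automorphism, \<open>\<psi>2\<close> followed by the inverse of
    \<open>\<chi>\<close>.\<close>
  define \<alpha> where "\<alpha> = compose P \<chi>' \<psi>2"
  have "\<psi>2 \<in> F P (\<chi> ` P)" by (rule F_corestrict[OF P(1) SS im \<psi>2]) (use \<psi>2_image in auto)
  then have \<alpha>: "\<alpha> \<in> F P P" unfolding \<alpha>_def by (rule F_comp[OF P(1) im P(1) _ \<chi>'(1)])
  have \<chi>\<alpha>: "\<chi> (\<alpha> u) = \<psi>2 u" if u: "u \<in> P" for u
    using \<psi>2_image[OF u] u \<chi>'(2) by (auto simp: \<alpha>_def compose_def)
  have \<alpha>P: "\<alpha> u \<in> P" if "u \<in> P" for u using F_closed[OF P(1) P(1) \<alpha> that] .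
  note inj = inj_onD[OF F_inj[OF P(1) SS \<chi>]]
  have "\<exists>z\<in>Q. \<forall>u\<in>P. \<alpha> u = cj z u"
  proof (rule automorphism_fixing_centric[OF Q P \<alpha>])
    fix u assume u: "u \<in> Q"
    then have uP: "u \<in> P" using P by auto
    show "\<alpha> u = u" by (rule inj) (use u uP \<chi>\<alpha> agree \<alpha>P in auto)
  next
    fix u assume u: "u \<in> P"
    have iu: "inv u \<in> P" using subgroup.m_inv_closed[OF P(1) u] .
    obtain q where q: "q \<in> Q" "inv (\<chi> u) \<otimes> \<psi>2 u = \<chi> q" using coset[OF u] by auto
    have "\<chi> (inv u \<otimes> \<alpha> u) = \<chi> q"
      using q u iu \<alpha>P[OF u] by (simp add: F_mult[OF P(1) SS \<chi>] F_inv[OF P(1) SS \<chi>] \<chi>\<alpha>)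
    then have "inv u \<otimes> \<alpha> u = q"
      by (rule inj) (use q P u iu \<alpha>P subgroup.m_closed[OF P(1)] in auto)
    then show "inv u \<otimes> \<alpha> u \<in> Q" using q by simp
  qed
  then obtain z where z: "z \<in> Q" "\<And>u. u \<in> P \<Longrightarrow> \<alpha> u = cj z u" by blast
  have zP: "z \<in> P" using z P by auto
  show ?thesis
  proof (intro bexI[of _ "\<chi> z \<otimes> s"] ballI)
    show "\<chi> z \<otimes> s \<in> carrier S" using \<chi>c[OF zP] s by simp
    fix u assume u: "u \<in> P"
    have "\<psi>2 u = \<chi> (cj z u)" using \<chi>\<alpha>[OF u] z(2)[OF u] by simp
    also have "\<dots> = cj (\<chi> z) (\<chi> u)" by (rule F_cj[OF P(1) SS \<chi> u zP])
    also have "\<dots> = cj (\<chi> z \<otimes> s) (\<psi>1 u)" using u \<chi>c[OF zP] s \<psi>1c by (simp add: cj_mult) (simp add: \<chi>_def)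
    finally show "\<psi>2 u = cj (\<chi> z \<otimes> s) (\<psi>1 u)" .
  qed
qed

text \<open>Climb from Q to P through successive normalizers; each step is the normal case, and Q
  grows until it is P. In the orbit category this says that inclusions of centric subgroups can be
  cancelled in front of morphisms to S.\<close>

lemma restriction_unique:
  assumes Q: "Q \<in> centrics S F" and P: "sub P" "Q \<subseteq> P"
    and \<psi>1: "\<psi>1 \<in> F P (carrier S)" and \<psi>2: "\<psi>2 \<in> F P (carrier S)"
    and s: "s \<in> carrier S" "\<And>u. u \<in> Q \<Longrightarrow> \<psi>2 u = cj s (\<psi>1 u)"
  shows "\<exists>t\<in>carrier S. \<forall>u\<in>P. \<psi>2 u = cj t (\<psi>1 u)"
  using Q P(2) s
proof (induction "card P - card Q" arbitrary: Q s rule: less_induct)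
  case less
  show ?case
  proof (cases "Q = P")
    case False
    have Q': "sub Q" using centricsD(1)[OF less.prems(1)] .
    let ?N = "normalizer_in P Q"
    note N = normalizer_in[OF P(1) Q' less.prems(2)]
    note SS = subgroup_self
    have "\<exists>t\<in>carrier S. \<forall>u\<in>?N. restrict \<psi>2 ?N u = cj t (restrict \<psi>1 ?N u)"
    proof (rule restriction_unique_normal[OF less.prems(1) N(1,2) _ _ less.prems(3)])
      show "restrict \<psi>1 ?N \<in> F ?N (carrier S)" "restrict \<psi>2 ?N \<in> F ?N (carrier S)"
        using F_restrict[OF P(1) SS N(1) _ N(3)] \<psi>1 \<psi>2 by auto
      show "restrict \<psi>2 ?N u = cj s (restrict \<psi>1 ?N u)" if "u \<in> Q" for u
        using that less.prems(4) N(2) by auto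
      show "cj x u \<in> Q" if "x \<in> ?N" "u \<in> Q" for x u using that by (auto simp: normalizer_in_def)
    qed
    then obtain t where t: "t \<in> carrier S" "\<And>u. u \<in> ?N \<Longrightarrow> \<psi>2 u = cj t (\<psi>1 u)" by auto
    have "card Q < card ?N" using N(4)[OF False] sub_finite[OF N(1)] by (simp add: psubset_card_mono)
    moreover have "card ?N \<le> card P" using N(3) sub_finite[OF P(1)] by (simp add: card_mono)
    ultimately have "card P - card ?N < card P - card Q" by simp
    then show ?thesis
      by (rule less.hyps[OF _ centric_mono[OF less.prems(1) N(1,2)] N(3) t])
  qed (use less.prems in auto)
qed

end

subsection \<open>The centric orbit category\<close>

context fusion
begin

abbreviation C where "C \<equiv> centric_orbit_category S F"
abbreviation cls where "cls \<equiv> orbit_class S"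

lemma cls_eq:
  assumes "sub P" "sub Q" "\<phi> \<in> F P Q"
  shows "cls P Q \<phi> = (\<lambda>q. \<lambda>u\<in>P. cj q (\<phi> u)) ` Q"
  unfolding orbit_class_def using F_closed[OF assms]
  by (intro image_cong refl) (auto simp: compose_def conj_map_eq fun_eq_iff)

lemma cls_mem:
  assumes "sub P" "sub Q" "\<phi> \<in> F P Q" "\<psi> \<in> extensional P"
  shows "\<psi> \<in> cls P Q \<phi> \<longleftrightarrow> (\<exists>q\<in>Q. \<forall>u\<in>P. \<psi> u = cj q (\<phi> u))"
  unfolding cls_eq[OF assms(1-3)] using assms(4)
  by (auto simp: image_iff intro!: bexI extensionalityI[of _ P])

lemma cls_eq_iff:
  assumes "sub P" "sub Q" "\<phi> \<in> F P Q" "\<psi> \<in> F P Q"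
  shows "cls P Q \<phi> = cls P Q \<psi> \<longleftrightarrow> (\<exists>q\<in>Q. \<forall>u\<in>P. \<psi> u = cj q (\<phi> u))"
proof
  note \<phi>c = F_carrier[OF assms(1-3)] and \<psi>c = F_carrier[OF assms(1,2,4)]
  assume "cls P Q \<phi> = cls P Q \<psi>"
  moreover have "\<psi> \<in> cls P Q \<psi>"
    using cls_mem[OF assms(1,2,4) F_ext[OF assms(1,2,4)]] subgroup.one_closed[OF assms(2)] \<psi>c
    by (auto intro!: bexI[of _ \<one>])
  ultimately show "\<exists>q\<in>Q. \<forall>u\<in>P. \<psi> u = cj q (\<phi> u)"
    using cls_mem[OF assms(1-3) F_ext[OF assms(1,2,4)]] by simp
next
  note \<phi>c = F_carrier[OF assms(1-3)] and \<psi>c = F_carrier[OF assms(1,2,4)]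
  assume "\<exists>q\<in>Q. \<forall>u\<in>P. \<psi> u = cj q (\<phi> u)"
  then obtain q where q: "q \<in> Q" "\<And>u. u \<in> P \<Longrightarrow> \<psi> u = cj q (\<phi> u)" by blast
  have qS: "q \<in> carrier S" using q assms by simp
  have "(\<lambda>u\<in>P. cj r (\<psi> u)) = (\<lambda>u\<in>P. cj (r \<otimes> q) (\<phi> u))" if "r \<in> Q" for r
    using that q qS assms \<phi>c by (auto simp: fun_eq_iff cj_mult)
  moreover have "(\<lambda>u\<in>P. cj r (\<phi> u)) = (\<lambda>u\<in>P. cj (r \<otimes> inv q) (\<psi> u))" if "r \<in> Q" for r
    using that q qS assms \<phi>c by (auto simp: fun_eq_iff cj_mult)
  ultimately show "cls P Q \<phi> = cls P Q \<psi>"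
    unfolding cls_eq[OF assms(1-3)] cls_eq[OF assms(1,2,4)]
    using q subgroup.m_closed[OF assms(2)] subgroup.m_inv_closed[OF assms(2)] by auto
qed

lemma C_Obj: "Obj C = centrics S F"
  and C_Hom: "Hom C P Q = cls P Q ` F P Q"
  and C_Ide: "Ide C P = cls P P (incl P)"
  by (simp_all add: centric_orbit_category_def full_subcategory_def orbit_category_def)

text \<open>A conjugation by q before \<psi> turns into the conjugation by \<psi>(q) after it, so
  all composites of representatives lie in one class; q = 1 already yields the whole class.\<close>

lemma C_Comp:
  assumes P: "sub P" and Q: "sub Q" and R: "sub R" and \<phi>: "\<phi> \<in> F P Q" and \<psi>: "\<psi> \<in> F Q R"
  shows "Comp C P Q R (cls Q R \<psi>) (cls P Q \<phi>) = cls P R (compose P \<psi> \<phi>)"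
proof -
  note \<phi>Q = F_closed[OF P Q \<phi>] and \<psi>R = F_closed[OF Q R \<psi>]
  have cj: "cj q (\<phi> u) \<in> Q" if "q \<in> Q" "u \<in> P" for q u using that \<phi>Q cj_self[OF Q] by simp
  have eq: "compose P (\<lambda>u\<in>Q. cj r (\<psi> u)) (\<lambda>u\<in>P. cj q (\<phi> u)) = (\<lambda>u\<in>P. cj (r \<otimes> \<psi> q) (compose P \<psi> \<phi> u))"
    if "r \<in> R" "q \<in> Q" for r q
    using that cj \<phi>Q \<psi>R R by (auto simp: compose_def fun_eq_iff F_cj[OF Q R \<psi>] cj_mult)
  have "Comp C P Q R (cls Q R \<psi>) (cls P Q \<phi>) =
      (\<lambda>(r, q). \<lambda>u\<in>P. cj (r \<otimes> \<psi> q) (compose P \<psi> \<phi> u)) ` (R \<times> Q)"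
    unfolding cls_eq[OF P Q \<phi>] cls_eq[OF Q R \<psi>] centric_orbit_category_def full_subcategory_def orbit_category_def
    using eq by (auto simp: image_iff) (metis, metis eq)
  also have "\<dots> = cls P R (compose P \<psi> \<phi>)"
    unfolding cls_eq[OF P R F_comp[OF P Q R \<phi> \<psi>]]
  proof (intro equalityI subsetI)
    fix f assume "f \<in> (\<lambda>(r, q). \<lambda>u\<in>P. cj (r \<otimes> \<psi> q) (compose P \<psi> \<phi> u)) ` (R \<times> Q)"
    then show "f \<in> (\<lambda>r. \<lambda>u\<in>P. cj r (compose P \<psi> \<phi> u)) ` R"
      using \<psi>R subgroup.m_closed[OF R] by auto
  next
    fix f assume "f \<in> (\<lambda>r. \<lambda>u\<in>P. cj r (compose P \<psi> \<phi> u)) ` R"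
    then obtain r where r: "r \<in> R" "f = (\<lambda>u\<in>P. cj r (compose P \<psi> \<phi> u))" by blast
    then have "f = (\<lambda>(r, q). \<lambda>u\<in>P. cj (r \<otimes> \<psi> q) (compose P \<psi> \<phi> u)) (r, \<one>)"
      using F_one[OF Q R \<psi>] R by simp
    then show "f \<in> (\<lambda>(r, q). \<lambda>u\<in>P. cj (r \<otimes> \<psi> q) (compose P \<psi> \<phi> u)) ` (R \<times> Q)"
      using r subgroup.one_closed[OF Q] by blast
  qed
  finally show ?thesis .
qed

lemma centric_sub [simp]: "P \<in> centrics S F \<Longrightarrow> sub P"
  by (rule centricsD(1))

lemma C_category: "small_category C"
proof
  fix x y z a b assume "x \<in> Obj C" "y \<in> Obj C" "z \<in> Obj C" "a \<in> Hom C x y" "b \<in> Hom C y z"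
  then show "Comp C x y z b a \<in> Hom C x z"
    unfolding C_Obj C_Hom by (auto simp: C_Comp intro!: imageI F_comp[of x y z])
next
  fix w x y z a b c assume *: "w \<in> Obj C" "x \<in> Obj C" "y \<in> Obj C" "z \<in> Obj C"
    and "a \<in> Hom C w x" "b \<in> Hom C x y" "c \<in> Hom C y z"
  then obtain \<phi> \<psi> \<chi> where **: "\<phi> \<in> F w x" "\<psi> \<in> F x y" "\<chi> \<in> F y z"
    "a = cls w x \<phi>" "b = cls x y \<psi>" "c = cls y z \<chi>" unfolding C_Hom by blast
  have s: "sub w" "sub x" "sub y" "sub z" using * by (auto simp: C_Obj)
  have "compose w (compose x \<chi> \<psi>) \<phi> = compose w \<chi> (compose w \<psi> \<phi>)"
    using F_closed[OF s(1,2) **(1)] by (auto simp: compose_def fun_eq_iff)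
  then show "Comp C w x z (Comp C x y z c b) a = Comp C w y z c (Comp C w x y b a)"
    using s ** by (simp add: C_Comp F_comp)
next
  fix x assume "x \<in> Obj C"
  then show "Ide C x \<in> Hom C x x" by (auto simp: C_Obj C_Hom C_Ide intro!: imageI F_incl)
next
  fix x y a assume *: "x \<in> Obj C" "y \<in> Obj C" and "a \<in> Hom C x y"
  then obtain \<phi> where \<phi>: "\<phi> \<in> F x y" "a = cls x y \<phi>" unfolding C_Hom by blast
  have s: "sub x" "sub y" using * by (auto simp: C_Obj)
  have "compose x (incl y) \<phi> = \<phi>" "compose x \<phi> (incl x) = \<phi>"
    using F_ext[OF s \<phi>(1)] F_closed[OF s \<phi>(1)]
    by (auto simp: compose_def incl_def intro!: extensionalityI[of _ x])
  then show "Comp C x y y (Ide C y) a = a" "Comp C x x y a (Ide C x) = a"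
    using s \<phi> F_incl by (simp_all add: C_Comp C_Ide)
next
  show "finite (Obj C)"
    by (rule finite_subset[of _ "Pow (carrier S)"]) (auto simp: C_Obj finite_S dest!: centric_sub subgroup.subset)
next
  fix x y assume "x \<in> Obj C" "y \<in> Obj C"
  then show "finite (Hom C x y)" by (simp add: C_Hom C_Obj finite_F)
qed

end

section \<open>The number of morphisms to S modulo p\<close>

context saturated_fusion
begin

text \<open>The p-group N acts on the classes of morphisms from Q to S by precomposition with
  conjugations. A class is fixed exactly if it extends to N, by \<open>extension\<close>, and the
  extension is unique by \<open>restriction_unique\<close>; so restriction identifies the morphisms
  from N with the fixed points.\<close>

lemma card_Hom_normalizer_mod:
  assumes Q: "Q \<in> centrics S F"
  defines "N \<equiv> normalizer_in (carrier S) Q"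
  shows "card (Hom C Q (carrier S)) mod p = card (Hom C N (carrier S)) mod p"
proof -
  let ?T = "carrier S"
  note T = subgroup_self
  have Q': "sub Q" using Q by simp
  note N = normalizer_in[OF T Q' subgroup.subset[OF Q'], folded N_def]
  have NQ: "cj x u \<in> Q" if "x \<in> N" "u \<in> Q" for x u using that by (simp add: N_def normalizer_in_def)
  note Ninv = subgroup.m_inv_closed[OF N(1)]
  \<comment> \<open>The inverse makes precomposition a left action.\<close>
  define pre where "pre x \<phi> = (\<lambda>u\<in>Q. \<phi> (cj (inv x) u))" for x and \<phi> :: "'a \<Rightarrow> 'a"
  define act where "act x A = pre x ` A" for x and A :: "('a \<Rightarrow> 'a) set"
  have pre: "pre x \<phi> \<in> F Q ?T" if x: "x \<in> N" and \<phi>: "\<phi> \<in> F Q ?T" for x \<phi>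
  proof -
    have "compose Q \<phi> (restrict (cj (inv x)) Q) \<in> F Q ?T"
      by (rule F_comp[OF Q' Q' T F_conj[OF Q' Q'] \<phi>]) (use x N Ninv NQ in auto)
    moreover have "compose Q \<phi> (restrict (cj (inv x)) Q) = pre x \<phi>"
      by (auto simp: compose_def pre_def)
    ultimately show ?thesis by simp
  qed
  have act_cls: "act x (cls Q ?T \<phi>) = cls Q ?T (pre x \<phi>)" if x: "x \<in> N" and \<phi>: "\<phi> \<in> F Q ?T" for x \<phi>
    unfolding act_def cls_eq[OF Q' T \<phi>] cls_eq[OF Q' T pre[OF x \<phi>]] image_image
    using NQ[OF Ninv[OF x]] by (intro image_cong refl) (auto simp: pre_def fun_eq_iff)
  obtain n where "order S = p ^ n" using order_S by blast
  then have "card N dvd p ^ n" using lagrange[OF N(1)] by (metis dvd_triv_right)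
  then obtain j where j: "card N = p ^ j" using p_prime by (auto simp: divides_primepow_nat)
  let ?G = "S\<lparr>carrier := N\<rparr>"
  have "card (Hom C Q ?T) mod p = card {A \<in> Hom C Q ?T. \<forall>x\<in>carrier ?G. act x A = A} mod p"
  proof (rule card_fixed_points_mod[OF subgroup_imp_group[OF N(1)] _ p_prime])
    show "order ?G = p ^ j" using j by (simp add: order_def)
    show "finite (Hom C Q ?T)" by (simp add: C_Hom finite_F[OF Q' T])
  next
    fix x A assume "x \<in> carrier ?G" "A \<in> Hom C Q ?T"
    then show "act x A \<in> Hom C Q ?T" unfolding C_Hom using act_cls pre by auto
  next
    fix A assume "A \<in> Hom C Q ?T"
    then obtain \<phi> where \<phi>: "\<phi> \<in> F Q ?T" "A = cls Q ?T \<phi>" unfolding C_Hom by blast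
    have "pre \<one> \<phi> = \<phi>" using F_ext[OF Q' T \<phi>(1)] Q' by (auto simp: pre_def intro!: extensionalityI[of _ Q])
    then show "act \<one>\<^bsub>?G\<^esub> A = A" using act_cls[OF subgroup.one_closed[OF N(1)] \<phi>(1)] \<phi> by simp
  next
    fix x y A assume xy: "x \<in> carrier ?G" "y \<in> carrier ?G" and "A \<in> Hom C Q ?T"
    then obtain \<phi> where \<phi>: "\<phi> \<in> F Q ?T" "A = cls Q ?T \<phi>" unfolding C_Hom by blast
    have "pre (x \<otimes> y) \<phi> = pre x (pre y \<phi>)"
      using xy NQ Ninv N(1) Q' by (auto simp: pre_def fun_eq_iff inv_mult_group cj_mult)
    then show "act (x \<otimes>\<^bsub>?G\<^esub> y) A = act x (act y A)"
      using xy \<phi> by (simp add: act_cls pre subgroup.m_closed[OF N(1)])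
  qed
  note fixed_points = this
  define r where "r A = (\<lambda>\<psi>. restrict \<psi> Q) ` A" for A :: "('a \<Rightarrow> 'a) set"
  have res: "restrict \<psi> Q \<in> F Q ?T" if "\<psi> \<in> F N ?T" for \<psi>
    by (rule F_restrict[OF N(1) T Q' that N(2)])
  have r: "r (cls N ?T \<psi>) = cls Q ?T (restrict \<psi> Q)" if \<psi>: "\<psi> \<in> F N ?T" for \<psi>
    unfolding r_def cls_eq[OF N(1) T \<psi>] cls_eq[OF Q' T res[OF \<psi>]] image_image
    using N(2) by (intro image_cong refl) (auto simp: fun_eq_iff)
  have bij: "bij_betw r (Hom C N ?T) {A \<in> Hom C Q ?T. \<forall>x\<in>carrier ?G. act x A = A}"
    unfolding bij_betw_def
  proof
    show "inj_on r (Hom C N ?T)"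
    proof (rule inj_onI)
      fix A B assume "A \<in> Hom C N ?T" "B \<in> Hom C N ?T" and eq: "r A = r B"
      then obtain \<psi>1 \<psi>2 where \<psi>: "\<psi>1 \<in> F N ?T" "A = cls N ?T \<psi>1" "\<psi>2 \<in> F N ?T" "B = cls N ?T \<psi>2"
        unfolding C_Hom by blast
      then obtain s where "s \<in> ?T" "\<And>u. u \<in> Q \<Longrightarrow> restrict \<psi>2 Q u = cj s (restrict \<psi>1 Q u)"
        using eq by (auto simp: r cls_eq_iff[OF Q' T res res])
      then have "\<exists>t\<in>?T. \<forall>u\<in>N. \<psi>2 u = cj t (\<psi>1 u)"
        using N(2) by (intro restriction_unique[OF Q N(1,2) \<psi>(1,3)]) auto
      then show "A = B" using \<psi> by (simp add: cls_eq_iff[OF N(1) T])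
    qed
    show "r ` Hom C N ?T = {A \<in> Hom C Q ?T. \<forall>x\<in>carrier ?G. act x A = A}"
    proof (intro subset_antisym subsetI)
      fix B assume "B \<in> r ` Hom C N ?T"
      then obtain \<psi> where \<psi>: "\<psi> \<in> F N ?T" "B = cls Q ?T (restrict \<psi> Q)" unfolding C_Hom using r by auto
      have "act x B = B" if x: "x \<in> N" for x
      proof -
        \<comment> \<open>Precomposing with a conjugation inside N, the domain of
          \<open>\<psi>\<close>, amounts to conjugating the values in S.\<close>
        have "cls Q ?T (restrict \<psi> Q) = cls Q ?T (pre x (restrict \<psi> Q))"
          unfolding cls_eq_iff[OF Q' T res[OF \<psi>(1)] pre[OF x res[OF \<psi>(1)]]]
        proof (intro bexI ballI)
          have ix: "inv x \<in> N" using Ninv[OF x] .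
          show "\<psi> (inv x) \<in> ?T" using F_closed[OF N(1) T \<psi>(1) ix] .
          fix u assume "u \<in> Q"
          then show "pre x (restrict \<psi> Q) u = cj (\<psi> (inv x)) (restrict \<psi> Q u)"
            using NQ[OF ix] N(2) ix F_cj[OF N(1) T \<psi>(1) _ ix] by (auto simp: pre_def)
        qed
        then show ?thesis using \<psi> act_cls[OF x res[OF \<psi>(1)]] by simp
      qed
      then show "B \<in> {A \<in> Hom C Q ?T. \<forall>x\<in>carrier ?G. act x A = A}"
        using \<psi> res by (auto simp: C_Hom)
    next
      fix B assume "B \<in> {A \<in> Hom C Q ?T. \<forall>x\<in>carrier ?G. act x A = A}"
      then obtain \<phi> where \<phi>: "\<phi> \<in> F Q ?T" "B = cls Q ?T \<phi>" and fixed: "\<And>x. x \<in> N \<Longrightarrow> act x B = B"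
        unfolding C_Hom by auto
      \<comment> \<open>That the class is fixed by N is the very condition under which saturation
        extends \<open>\<phi>\<close> to N.\<close>
      have "\<exists>\<psi>\<in>F N ?T. \<forall>u\<in>Q. \<psi> u = \<phi> u"
      proof (rule extension[OF Q \<phi>(1) N(1,2) NQ])
        fix x assume x: "x \<in> N"
        then have ix: "inv x \<in> N" using Ninv by simp
        have "cls Q ?T \<phi> = cls Q ?T (pre (inv x) \<phi>)" using fixed[OF ix] act_cls[OF ix \<phi>(1)] \<phi>(2) by simp
        then show "\<exists>s\<in>?T. \<forall>u\<in>Q. \<phi> (cj x u) = cj s (\<phi> u)"
          unfolding cls_eq_iff[OF Q' T \<phi>(1) pre[OF ix \<phi>(1)]]
          using sub_carrier[OF N(1) x] by (simp add: pre_def)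
      qed
      then obtain \<psi> where \<psi>: "\<psi> \<in> F N ?T" "\<And>u. u \<in> Q \<Longrightarrow> \<psi> u = \<phi> u" by blast
      have "restrict \<psi> Q = \<phi>" using \<psi>(2) F_ext[OF Q' T \<phi>(1)] by (auto intro!: extensionalityI[of _ Q])
      then have "B = r (cls N ?T \<psi>)" using \<phi>(2) r[OF \<psi>(1)] by simp
      then show "B \<in> r ` Hom C N ?T" using \<psi>(1) by (simp add: C_Hom)
    qed
  qed
  show ?thesis using fixed_points bij_betw_same_card[OF bij] by simp
qed

text \<open>S is fully normalized, so its inner automorphisms form a Sylow subgroup of
  \<open>Aut_F F (carrier S)\<close>, and the morphism classes from S to S are the cosets of this
  subgroup.\<close>

lemma card_Hom_S_S: "\<not> p dvd card (Hom C (carrier S) (carrier S))"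
proof -
  let ?T = "carrier S" let ?A = "Aut_F F ?T" let ?I = "Aut_S S ?T"
  note T = subgroup_self
  note A = Aut_F_group[OF T]
  interpret A: group ?A by (rule A)
  have "fully_normalized S F ?T"
    unfolding fully_normalized_def
  proof (intro conjI T ballI)
    fix Q assume "Q \<in> conjugates S F ?T"
    then have "Q \<subseteq> ?T" by (auto simp: conjugates_def dest: subgroup.subset)
    then have "normalizer S Q \<subseteq> ?T" using normalizer_iff[OF finite_S] by blast
    moreover have "normalizer S ?T = ?T" using normalizer_iff[OF finite_S order_refl] by auto
    ultimately show "card (normalizer S Q) \<le> card (normalizer S ?T)" using finite_S by (simp add: card_mono)
  qed
  then have "sylow_subgroup p ?A ?I" using saturated by (simp add: saturated_def)
  then have "\<not> p dvd card (rcosets\<^bsub>?A\<^esub> ?I)" by (rule A.sylow_index[OF A(2) p_prime])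
  moreover have "rcosets\<^bsub>?A\<^esub> ?I = Hom C ?T ?T"
  proof -
    have nT: "normalizer S ?T = ?T" using normalizer_iff[OF finite_S order_refl] by auto
    \<comment> \<open>Classes are formed by postcomposing with inner automorphisms, which are right
      cosets in the group of automorphisms.\<close>
    have "?I #>\<^bsub>?A\<^esub> \<phi> = cls ?T ?T \<phi>" if \<phi>: "\<phi> \<in> F ?T ?T" for \<phi>
    proof -
      have c: "conj_map S q ?T \<in> F ?T ?T" if "q \<in> ?T" for q
        unfolding conj_map_eq by (rule F_conj[OF T T that]) (use that in auto)
      show ?thesis
        unfolding r_coset_def Aut_S_def orbit_class_def nT using c \<phi> by (auto simp: A(3))
    qed
    then show ?thesis unfolding RCOSETS_def C_Hom A(6) by auto
  qed
  ultimately show ?thesis by simp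
qed

text \<open>Passing to the normalizer preserves the number modulo p, and iterated normalizers reach
  S.\<close>

lemma card_Hom_S_not_dvd:
  assumes "Q \<in> centrics S F"
  shows "\<not> p dvd card (Hom C Q (carrier S))"
  using assms
proof (induction "card (carrier S) - card Q" arbitrary: Q rule: less_induct)
  case less
  have Q: "sub Q" using less.prems by simp
  show ?case
  proof (cases "Q = carrier S")
    case False
    let ?N = "normalizer_in (carrier S) Q"
    note N = normalizer_in[OF subgroup_self Q subgroup.subset[OF Q]]
    have "card Q < card ?N" using N(4)[OF False] sub_finite[OF N(1)] by (simp add: psubset_card_mono)
    moreover have "card ?N \<le> card (carrier S)" using N(3) finite_S by (simp add: card_mono)
    ultimately have "card (carrier S) - card ?N < card (carrier S) - card Q" by simp
    then have "\<not> p dvd card (Hom C ?N (carrier S))"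
      by (rule less.hyps[OF _ centric_mono[OF less.prems N(1,2)]])
    then show ?thesis using card_Hom_normalizer_mod[OF less.prems] by (simp add: dvd_eq_mod_eq_0)
  qed (use card_Hom_S_S in simp)
qed

end

section \<open>Maximal extensions of a morphism inside P\<close>

section \<open>Products with \<open>S\<close> in the centric orbit category\<close>

context saturated_fusion
begin

text \<open>Equality, as morphisms to S in the orbit category, of the restrictions to Q. It is
  stated for arbitrary functions, so that maps on different larger domains can be compared
  directly.\<close>

definition agree :: "'a set \<Rightarrow> ('a \<Rightarrow> 'a) \<Rightarrow> ('a \<Rightarrow> 'a) \<Rightarrow> bool" where
  "agree Q \<phi> \<psi> \<longleftrightarrow> (\<exists>s\<in>carrier S. \<forall>u\<in>Q. \<psi> u = cj s (\<phi> u))"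

lemma agree_refl: "(\<And>u. u \<in> Q \<Longrightarrow> \<phi> u \<in> carrier S) \<Longrightarrow> agree Q \<phi> \<phi>"
  unfolding agree_def by (intro bexI[of _ \<one>]) auto

lemma agree_sym:
  assumes "agree Q \<phi> \<psi>" "\<And>u. u \<in> Q \<Longrightarrow> \<phi> u \<in> carrier S"
  shows "agree Q \<psi> \<phi>"
proof -
  obtain s where "s \<in> carrier S" "\<And>u. u \<in> Q \<Longrightarrow> \<psi> u = cj s (\<phi> u)" using assms by (auto simp: agree_def)
  then show ?thesis using assms(2) unfolding agree_def by (intro bexI[of _ "inv s"]) auto
qed

lemma agree_trans:
  assumes "agree Q \<phi> \<psi>" "agree Q \<psi> \<chi>" "\<And>u. u \<in> Q \<Longrightarrow> \<phi> u \<in> carrier S"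
  shows "agree Q \<phi> \<chi>"
proof -
  obtain s t where "s \<in> carrier S" "\<And>u. u \<in> Q \<Longrightarrow> \<psi> u = cj s (\<phi> u)"
    "t \<in> carrier S" "\<And>u. u \<in> Q \<Longrightarrow> \<chi> u = cj t (\<psi> u)" using assms by (auto simp: agree_def)
  then show ?thesis using assms(3) unfolding agree_def by (intro bexI[of _ "t \<otimes> s"]) (auto simp: cj_mult)
qed

lemma agree_mono: "agree Q \<phi> \<psi> \<Longrightarrow> R \<subseteq> Q \<Longrightarrow> agree R \<phi> \<psi>"
  by (auto simp: agree_def)

lemma cls_eq_iff_agree:
  assumes "sub P" "\<phi> \<in> F P (carrier S)" "\<psi> \<in> F P (carrier S)"
  shows "cls P (carrier S) \<phi> = cls P (carrier S) \<psi> \<longleftrightarrow> agree P \<phi> \<psi>"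
  using cls_eq_iff[OF assms(1) subgroup_self assms(2,3)] by (simp add: agree_def)

text \<open>The part of the extender lying in P. Saturation extends \<phi> to it; conversely, it
  contains each element of P that normalizes Q and lies in the domain of some extension of
  \<phi>.\<close>

definition extension_domain :: "'a set \<Rightarrow> 'a set \<Rightarrow> ('a \<Rightarrow> 'a) \<Rightarrow> 'a set" where
  "extension_domain P Q \<phi> = P \<inter> extender S Q \<phi>"

lemma extension_domain_iff:
  assumes "sub P" "sub Q" "\<phi> \<in> F Q (carrier S)"
  shows "x \<in> extension_domain P Q \<phi> \<longleftrightarrow> x \<in> P \<and> (\<forall>u\<in>Q. cj x u \<in> Q) \<and>
    (\<exists>s\<in>carrier S. \<forall>u\<in>Q. \<phi> (cj x u) = cj s (\<phi> u))"
  using extender_iff[OF assms(2) subgroup_self assms(3)] assms(1) by (auto simp: extension_domain_def)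

lemma extension_domain:
  assumes P: "sub P" and Q: "Q \<in> centrics S F" "Q \<subseteq> P" and \<phi>: "\<phi> \<in> F Q (carrier S)"
  shows "sub (extension_domain P Q \<phi>)" "Q \<subseteq> extension_domain P Q \<phi>" "extension_domain P Q \<phi> \<subseteq> P"
    "\<exists>\<psi>\<in>F (extension_domain P Q \<phi>) (carrier S). \<forall>u\<in>Q. \<psi> u = \<phi> u"
proof -
  note T = subgroup_self
  have Q': "sub Q" using Q by simp
  note iff = extension_domain_iff[OF P Q' \<phi>]
  show s: "sub (extension_domain P Q \<phi>)"
    unfolding extension_domain_def by (rule subgroups_Inter_pair[OF P extender_sub[OF Q' T \<phi>]])
  show sub: "Q \<subseteq> extension_domain P Q \<phi>"
  proof
    fix x assume x: "x \<in> Q"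
    then have "\<exists>s\<in>carrier S. \<forall>u\<in>Q. \<phi> (cj x u) = cj s (\<phi> u)"
      using F_cj[OF Q' T \<phi>] F_closed[OF Q' T \<phi>] by (intro bexI[of _ "\<phi> x"]) auto
    then show "x \<in> extension_domain P Q \<phi>"
      unfolding iff using x Q(2) cj_self[OF Q' x] by auto
  qed
  show "extension_domain P Q \<phi> \<subseteq> P" by (simp add: extension_domain_def)
  show "\<exists>\<psi>\<in>F (extension_domain P Q \<phi>) (carrier S). \<forall>u\<in>Q. \<psi> u = \<phi> u"
    by (rule extension[OF Q(1) \<phi> s sub]) (auto simp: iff)
qed

text \<open>Larger pairs extend \<psi> only up to conjugation in S; their domains are centric by
  \<open>centric_mono\<close>.\<close>

definition maximal :: "'a set \<Rightarrow> 'a set \<Rightarrow> ('a \<Rightarrow> 'a) \<Rightarrow> bool" where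
  "maximal P R \<psi> \<longleftrightarrow> R \<in> centrics S F \<and> R \<subseteq> P \<and> \<psi> \<in> F R (carrier S) \<and>
     (\<forall>R' \<psi>'. sub R' \<longrightarrow> R \<subseteq> R' \<longrightarrow> R' \<subseteq> P \<longrightarrow> \<psi>' \<in> F R' (carrier S) \<longrightarrow> agree R \<psi> \<psi>' \<longrightarrow> R' = R)"

lemma maximalD:
  assumes "maximal P R \<psi>"
  shows "R \<in> centrics S F" "sub R" "R \<subseteq> P" "\<psi> \<in> F R (carrier S)" "u \<in> R \<Longrightarrow> \<psi> u \<in> carrier S"
    and "sub R' \<Longrightarrow> R \<subseteq> R' \<Longrightarrow> R' \<subseteq> P \<Longrightarrow> \<psi>' \<in> F R' (carrier S) \<Longrightarrow> agree R \<psi> \<psi>' \<Longrightarrow> R' = R"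
proof -
  show *: "R \<in> centrics S F" "R \<subseteq> P" "\<psi> \<in> F R (carrier S)"
    and "sub R' \<Longrightarrow> R \<subseteq> R' \<Longrightarrow> R' \<subseteq> P \<Longrightarrow> \<psi>' \<in> F R' (carrier S) \<Longrightarrow> agree R \<psi> \<psi>' \<Longrightarrow> R' = R"
    using assms by (auto simp: maximal_def)
  then show "sub R" "u \<in> R \<Longrightarrow> \<psi> u \<in> carrier S"
    using F_closed[OF _ subgroup_self *(3)] by auto
qed

lemma maximal_exists:
  assumes P: "sub P" and "Q \<in> centrics S F" "Q \<subseteq> P" "\<phi> \<in> F Q (carrier S)"
  shows "\<exists>R \<psi>. maximal P R \<psi> \<and> Q \<subseteq> R \<and> agree Q \<phi> \<psi>"
  using assms(2-)
proof (induction "card P - card Q" arbitrary: Q \<phi> rule: less_induct)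
  case less
  note \<phi>c = F_carrier[OF centric_sub[OF less.prems(1)] subgroup_self less.prems(3)]
  show ?case
  proof (cases "maximal P Q \<phi>")
    case True
    then show ?thesis using agree_refl[of Q \<phi>] \<phi>c by blast
  next
    case False
    then obtain R \<psi> where R: "sub R" "Q \<subseteq> R" "R \<subseteq> P" "\<psi> \<in> F R (carrier S)" "agree Q \<phi> \<psi>" "R \<noteq> Q"
      using less.prems by (auto simp: maximal_def)
    have "card Q < card R" using R sub_finite[OF R(1)] by (simp add: psubset_card_mono psubsetI)
    moreover have "card R \<le> card P" using R(3) sub_finite[OF P] by (simp add: card_mono)
    ultimately have "card P - card R < card P - card Q" by simp
    then obtain R' \<psi>' where R': "maximal P R' \<psi>'" "R \<subseteq> R'" "agree R \<psi> \<psi>'"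
      using less.hyps[OF _ centric_mono[OF less.prems(1) R(1,2)] R(3,4)] by blast
    then have "agree Q \<phi> \<psi>'"
      using agree_trans[OF R(5) agree_mono[OF R'(3) R(2)]] \<phi>c by blast
    then show ?thesis using R' R(2) by blast
  qed
qed

text \<open>Two maximal pairs above (Q, \<phi>) may have domains with no visible overlap beyond Q.
  Both are compared with a third, lying above the extension of \<phi> to its extension domain: this
  contains the normalizer of Q in either domain, which is larger than Q, so induction applies to
  each comparison.\<close>

lemma maximal_unique:
  assumes P: "sub P" and "Q \<in> centrics S F" "\<phi> \<in> F Q (carrier S)"
    and "maximal P R1 \<psi>1" "Q \<subseteq> R1" "agree Q \<phi> \<psi>1"
    and "maximal P R2 \<psi>2" "Q \<subseteq> R2" "agree Q \<phi> \<psi>2"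
  shows "R1 = R2 \<and> agree R1 \<psi>1 \<psi>2"
  using assms(2-)
proof (induction "card P - card Q" arbitrary: Q \<phi> R1 \<psi>1 R2 \<psi>2 rule: less_induct)
  case less
  note T = subgroup_self
  note Qc = less.prems(1)
  have Q: "sub Q" using Qc by simp
  note \<phi> = less.prems(2)
  note \<phi>c = F_carrier[OF Q T \<phi>]
  note m1 = less.prems(3) and m2 = less.prems(6)
  have QP: "Q \<subseteq> P" using maximalD(3)[OF m1] less.prems(4) by auto
  have base: "R1 = R2 \<and> agree R1 \<psi>1 \<psi>2"
    if "maximal P R1 \<psi>1" "agree Q \<phi> \<psi>1" "maximal P R2 \<psi>2" "Q \<subseteq> R2" "agree Q \<phi> \<psi>2" "Q = R1"
    for R1 \<psi>1 R2 \<psi>2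
  proof -
    have "agree R1 \<psi>1 \<psi>2"
      using agree_trans[OF agree_sym[OF that(2) \<phi>c] that(5)] maximalD(5)[OF that(1)] that(6) by blast
    moreover from this have "R2 = R1"
      using maximalD(6)[OF that(1) maximalD(2)[OF that(3)] _ maximalD(3,4)[OF that(3)]] that(4,6) by blast
    ultimately show ?thesis by simp
  qed
  show ?case
  proof (cases "Q = R1 \<or> Q = R2")
    case True
    then show ?thesis
    proof
      assume "Q = R1"
      then show ?thesis using base[OF m1 less.prems(5) m2 less.prems(7,8)] by blast
    next
      assume "Q = R2"
      then have "R2 = R1 \<and> agree R2 \<psi>2 \<psi>1" using base[OF m2 less.prems(8) m1 less.prems(4,5)] by blast
      then show ?thesis using agree_sym[of R2 \<psi>2 \<psi>1] maximalD(5)[OF m2] by auto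
    qed
  next
    case False
    let ?N = "extension_domain P Q \<phi>"
    note N = extension_domain[OF P Qc QP \<phi>]
    \<comment> \<open>The reference pair (M, m) is chosen above an extension \<open>\<chi>\<close>
      of \<open>\<phi>\<close>, independently of the two given pairs.\<close>
    obtain \<chi> where \<chi>: "\<chi> \<in> F ?N (carrier S)" "\<And>u. u \<in> Q \<Longrightarrow> \<chi> u = \<phi> u" using N(4) by blast
    obtain M m where M: "maximal P M m" "?N \<subseteq> M" "agree ?N \<chi> m"
      using maximal_exists[OF P centric_mono[OF Qc N(1,2)] N(3) \<chi>(1)] by blast
    have step: "R = M \<and> agree R \<psi> m" if R: "maximal P R \<psi>" "Q \<subseteq> R" "agree Q \<phi> \<psi>" and neq: "Q \<noteq> R" for R \<psi>
    proof -
      let ?N' = "normalizer_in R Q"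
      note N' = normalizer_in[OF maximalD(2)[OF R(1)] Q R(2)]
      note \<psi> = maximalD(4)[OF R(1)]
      obtain s where s: "s \<in> carrier S" "\<And>u. u \<in> Q \<Longrightarrow> \<psi> u = cj s (\<phi> u)" using R(3) by (auto simp: agree_def)
      \<comment> \<open>For x in R normalizing Q, the conjugation by \<open>\<psi>\<close> x,
        corrected by s, realizes on the values of \<open>\<phi>\<close> the conjugation by
        x.\<close>
      have "?N' \<subseteq> ?N"
      proof
        fix x assume x: "x \<in> ?N'"
        then have xR: "x \<in> R" and xQ: "\<And>u. u \<in> Q \<Longrightarrow> cj x u \<in> Q" by (auto simp: normalizer_in_def)
        have xc: "\<psi> x \<in> carrier S" using maximalD(5)[OF R(1) xR] .
        have "\<phi> (cj x u) = cj (inv s \<otimes> \<psi> x \<otimes> s) (\<phi> u)" if u: "u \<in> Q" for u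
        proof -
          have "cj s (\<phi> (cj x u)) = \<psi> (cj x u)" using s xQ[OF u] by simp
          also have "\<dots> = cj (\<psi> x) (\<psi> u)" using u R(2) xR by (intro F_cj[OF maximalD(2)[OF R(1)] T \<psi>]) auto
          also have "\<dots> = cj (\<psi> x) (cj s (\<phi> u))" using s u by simp
          finally have "cj (inv s) (cj s (\<phi> (cj x u))) = cj (inv s) (cj (\<psi> x) (cj s (\<phi> u)))" by simp
          then show ?thesis using s xc \<phi>c[OF u] \<phi>c[OF xQ[OF u]] by (simp add: cj_mult)
        qed
        moreover have "inv s \<otimes> \<psi> x \<otimes> s \<in> carrier S" using s xc by simp
        ultimately show "x \<in> ?N"
          unfolding extension_domain_iff[OF P Q \<phi>] using xQ xR maximalD(3)[OF R(1)] by auto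
      qed
      have r\<psi>: "restrict \<psi> ?N' \<in> F ?N' (carrier S)"
        by (rule F_restrict[OF maximalD(2)[OF R(1)] T N'(1) \<psi> N'(3)])
      have r\<chi>: "restrict \<chi> ?N' \<in> F ?N' (carrier S)"
        by (rule F_restrict[OF N(1) T N'(1) \<chi>(1) \<open>?N' \<subseteq> ?N\<close>])
      \<comment> \<open>Both maps extend \<open>\<phi>\<close> to the normalizer up to conjugation,
        so they agree there; this is the starting pair for the induction hypothesis.\<close>
      have "\<exists>t\<in>carrier S. \<forall>u\<in>?N'. restrict \<chi> ?N' u = cj t (restrict \<psi> ?N' u)"
      proof (rule restriction_unique[OF Qc N'(1,2) r\<psi> r\<chi>, of "inv s"])
        fix u assume "u \<in> Q"
        then show "restrict \<chi> ?N' u = cj (inv s) (restrict \<psi> ?N' u)"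
          using s \<phi>c \<chi>(2) N'(2) by (auto simp: subset_iff)
      qed (use s in simp)
      then have "agree ?N' (restrict \<psi> ?N') \<chi>" by (auto simp: agree_def)
      moreover have "agree ?N' \<chi> m" using agree_mono[OF M(3) \<open>?N' \<subseteq> ?N\<close>] .
      ultimately have am: "agree ?N' (restrict \<psi> ?N') m"
        using agree_trans F_carrier[OF N'(1) T r\<psi>] by blast
      have a\<psi>: "agree ?N' (restrict \<psi> ?N') \<psi>"
        using agree_refl[of ?N' "restrict \<psi> ?N'"] F_carrier[OF N'(1) T r\<psi>] by (auto simp: agree_def)
      have "card Q < card ?N'" using N'(4)[OF neq] sub_finite[OF N'(1)] by (simp add: psubset_card_mono)
      moreover have "card ?N' \<le> card P" using N'(3) maximalD(3)[OF R(1)] sub_finite[OF P]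
        by (intro card_mono) auto
      ultimately have "card P - card ?N' < card P - card Q" by simp
      then show "R = M \<and> agree R \<psi> m"
        using \<open>?N' \<subseteq> ?N\<close> M(2)
        by (intro less.hyps[OF _ centric_mono[OF Qc N'(1,2)] r\<psi> R(1) N'(3) a\<psi> M(1) _ am]) auto
    qed
    have "R1 = M \<and> agree R1 \<psi>1 m" using step[OF m1 less.prems(4,5)] False by auto
    moreover have "R2 = M \<and> agree R2 \<psi>2 m" using step[OF m2 less.prems(7,8)] False by auto
    ultimately show ?thesis
      using agree_trans[OF _ agree_sym] maximalD(5)[OF m1] maximalD(5)[OF m2] by blast
  qed
qed

text \<open>Such an x belongs to the extension domain of \<psi>, and by maximality this domain is R
  itself. The stabilizer of a maximal pair is thus no larger than R, which later makes arrows to a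
  summand unique.\<close>

lemma maximal_stabilizer:
  assumes P: "sub P" and m: "maximal P R \<psi>" and x: "x \<in> P" "\<And>u. u \<in> R \<Longrightarrow> cj x u \<in> R"
    and agree: "agree R \<psi> (\<lambda>u. \<psi> (cj x u))"
  shows "x \<in> R"
proof -
  note R = maximalD[OF m]
  note N = extension_domain[OF P R(1,3,4)]
  obtain \<chi> where \<chi>: "\<chi> \<in> F (extension_domain P R \<psi>) (carrier S)" "\<And>u. u \<in> R \<Longrightarrow> \<chi> u = \<psi> u" using N(4) by blast
  have "agree R \<psi> \<chi>" using agree_refl[of R \<psi>] R(5) \<chi>(2) by (auto simp: agree_def)
  then have "extension_domain P R \<psi> = R" by (rule R(6)[OF N(1-3) \<chi>(1)])
  moreover have "x \<in> extension_domain P R \<psi>"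
    unfolding extension_domain_iff[OF P R(2,4)] using x agree by (auto simp: agree_def)
  ultimately show ?thesis by simp
qed

text \<open>The action of P on pairs: the domain is conjugated by x, and the map is precomposed with
  the inverse conjugation.\<close>

definition translate :: "'a \<Rightarrow> 'a set \<Rightarrow> ('a \<Rightarrow> 'a) \<Rightarrow> 'a \<Rightarrow> 'a" where
  "translate x R \<psi> = (\<lambda>v\<in>cj x ` R. \<psi> (cj (inv x) v))"

lemma translate_F:
  assumes R: "sub R" and \<psi>: "\<psi> \<in> F R (carrier S)" and x: "x \<in> carrier S"
  shows "sub (cj x ` R)" "translate x R \<psi> \<in> F (cj x ` R) (carrier S)"
    "u \<in> R \<Longrightarrow> translate x R \<psi> (cj x u) = \<psi> u"
proof -
  show s: "sub (cj x ` R)" by (rule cj_image_subgroup[OF R x])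
  have "compose (cj x ` R) \<psi> (restrict (cj (inv x)) (cj x ` R)) \<in> F (cj x ` R) (carrier S)"
    by (rule F_comp[OF s R subgroup_self F_conj[OF s R] \<psi>]) (use x R in auto)
  moreover have "compose (cj x ` R) \<psi> (restrict (cj (inv x)) (cj x ` R)) = translate x R \<psi>"
    by (auto simp: compose_def translate_def)
  ultimately show "translate x R \<psi> \<in> F (cj x ` R) (carrier S)" by simp
  show "u \<in> R \<Longrightarrow> translate x R \<psi> (cj x u) = \<psi> u" using x R by (simp add: translate_def)
qed

lemma cj_image_centric:
  assumes "R \<in> centrics S F" "x \<in> carrier S"
  shows "cj x ` R \<in> centrics S F"
proof -
  have "restrict (cj x) R ` R \<in> centrics S F"
    using assms sub_carrier[OF centric_sub[OF assms(1)]]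
    by (intro centric_image[OF assms(1) subgroup_self F_conj] subgroup_self) auto
  then show ?thesis by simp
qed

lemma maximal_translate:
  assumes P: "sub P" and m: "maximal P R \<psi>" and x: "x \<in> P"
  shows "maximal P (cj x ` R) (translate x R \<psi>)"
  unfolding maximal_def
proof (intro conjI allI impI)
  note R = maximalD[OF m]
  have xS: "x \<in> carrier S" using x P by simp
  note t = translate_F[OF R(2,4) xS]
  show "cj x ` R \<in> centrics S F" by (rule cj_image_centric[OF R(1) xS])
  show "cj x ` R \<subseteq> P" using cj_self[OF P x] R(3) by auto
  show "translate x R \<psi> \<in> F (cj x ` R) (carrier S)" by (rule t)
  fix R' \<psi>' assume R': "sub R'" "cj x ` R \<subseteq> R'" "R' \<subseteq> P" "\<psi>' \<in> F R' (carrier S)"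
    "agree (cj x ` R) (translate x R \<psi>) \<psi>'"
  have ix: "inv x \<in> P" "inv x \<in> carrier S" using x P subgroup.m_inv_closed by auto
  note t' = translate_F[OF R'(1,4) ix(2)]
  have "cj (inv x) ` R' = R"
  proof (rule R(6)[OF t'(1) _ _ t'(2)])
    show "R \<subseteq> cj (inv x) ` R'"
    proof
      fix u assume u: "u \<in> R"
      then have "u = cj (inv x) (cj x u)" using xS R(2) by simp
      then show "u \<in> cj (inv x) ` R'" using u R'(2) by blast
    qed
    show "cj (inv x) ` R' \<subseteq> P" using cj_self[OF P ix(1)] R'(3) by auto
    obtain s where s: "s \<in> carrier S" "\<And>u. u \<in> R \<Longrightarrow> \<psi>' (cj x u) = cj s (\<psi> u)"
      using R'(5) t(3) by (auto simp: agree_def)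
    have "translate (inv x) R' \<psi>' u = \<psi>' (cj x u)" if u: "u \<in> R" for u
      using t'(3)[of "cj x u"] R'(2) u xS R(2) by auto
    then show "agree R \<psi> (translate (inv x) R' \<psi>')" using s by (auto simp: agree_def)
  qed
  then have "cj x ` R = cj x ` cj (inv x) ` R'" by simp
  also have "\<dots> = R'" unfolding image_image using xS R'(1) by simp
  finally show "R' = cj x ` R" by simp
qed

section \<open>Orbits of maximal pairs as the summands of the product\<close>

definition same_orbit :: "'a set \<Rightarrow> 'a set \<times> ('a \<Rightarrow> 'a) \<Rightarrow> 'a set \<times> ('a \<Rightarrow> 'a) \<Rightarrow> bool" where
  "same_orbit P m m' \<longleftrightarrow> (\<exists>x\<in>P. fst m' = cj x ` fst m \<and> agree (fst m) (snd m) (\<lambda>u. snd m' (cj x u)))"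

definition pair_rep :: "'a set \<Rightarrow> 'a set \<times> ('a \<Rightarrow> 'a) \<Rightarrow> 'a set \<times> ('a \<Rightarrow> 'a)" where
  "pair_rep P m = (SOME m'. maximal P (fst m') (snd m') \<and> same_orbit P m m')"

definition pair_reps :: "'a set \<Rightarrow> ('a set \<times> ('a \<Rightarrow> 'a)) set" where
  "pair_reps P = pair_rep P ` {m. maximal P (fst m) (snd m)}"

lemma same_orbit_refl:
  assumes "sub P" "maximal P (fst m) (snd m)"
  shows "same_orbit P m m"
  unfolding same_orbit_def
proof (intro bexI[of _ \<one>] conjI)
  note R = maximalD[OF assms(2)]
  show "fst m = cj \<one> ` fst m" using R(2) by auto
  show "agree (fst m) (snd m) (\<lambda>u. snd m (cj \<one> u))"
    using agree_refl[of "fst m" "snd m"] R(2,5) by (auto simp: agree_def)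
qed (rule subgroup.one_closed[OF assms(1)])

lemma same_orbit_sym:
  assumes P: "sub P" and m: "maximal P (fst m) (snd m)" and "same_orbit P m m'"
  shows "same_orbit P m' m"
proof -
  note R = maximalD[OF m]
  obtain x s where x: "x \<in> P" "fst m' = cj x ` fst m" "s \<in> carrier S"
    "\<And>u. u \<in> fst m \<Longrightarrow> snd m' (cj x u) = cj s (snd m u)"
    using assms(3) by (auto simp: same_orbit_def agree_def)
  have xS: "x \<in> carrier S" using x P by simp
  have [simp]: "cj (inv x) (cj x u) = u" if "u \<in> fst m" for u using that xS R(2) by simp
  show ?thesis
    unfolding same_orbit_def agree_def
  proof (rule bexI[of _ "inv x"], rule conjI, goal_cases)
    case 1
    show ?case unfolding x(2) image_image by simp
    case 2
    have "snd m (cj (inv x) v) = cj (inv s) (snd m' v)" if v: "v \<in> fst m'" for v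
      using v x R(5) by auto
    then show ?case using x(3) by blast
  qed (use x P subgroup.m_inv_closed in auto)
qed

lemma same_orbit_trans:
  assumes P: "sub P" and m: "maximal P (fst m1) (snd m1)" and "same_orbit P m1 m2" "same_orbit P m2 m3"
  shows "same_orbit P m1 m3"
proof -
  note R = maximalD[OF m]
  obtain x s where x: "x \<in> P" "fst m2 = cj x ` fst m1" "s \<in> carrier S"
    "\<And>u. u \<in> fst m1 \<Longrightarrow> snd m2 (cj x u) = cj s (snd m1 u)"
    using assms(3) by (auto simp: same_orbit_def agree_def)
  obtain y t where y: "y \<in> P" "fst m3 = cj y ` fst m2" "t \<in> carrier S"
    "\<And>u. u \<in> fst m2 \<Longrightarrow> snd m3 (cj y u) = cj t (snd m2 u)"
    using assms(4) by (auto simp: same_orbit_def agree_def)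
  have xy: "x \<in> carrier S" "y \<in> carrier S" using x y P by auto
  have [simp]: "cj (y \<otimes> x) u = cj y (cj x u)" if "u \<in> fst m1" for u using that xy R(2) by (simp add: cj_mult)
  show ?thesis
    unfolding same_orbit_def agree_def
  proof (rule bexI[of _ "y \<otimes> x"], rule conjI, goal_cases)
    case 1
    show ?case unfolding x(2) y(2) image_image by simp
    case 2
    have "snd m3 (cj (y \<otimes> x) u) = cj (t \<otimes> s) (snd m1 u)" if u: "u \<in> fst m1" for u
      using u x y R(5) by (simp add: cj_mult)
    then show ?case using x(3) y(3) by blast
  qed (use x y P subgroup.m_closed in auto)
qed

lemma pair_rep:
  assumes P: "sub P" and m: "maximal P (fst m) (snd m)"
  shows "maximal P (fst (pair_rep P m)) (snd (pair_rep P m))" "same_orbit P m (pair_rep P m)"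
  using someI[of "\<lambda>m'. maximal P (fst m') (snd m') \<and> same_orbit P m m'" m] same_orbit_refl[OF P m] m
  by (auto simp: pair_rep_def)

lemma pair_reps_maximal:
  assumes P: "sub P" and "m \<in> pair_reps P"
  shows "maximal P (fst m) (snd m)"
  using assms pair_rep[OF P] by (auto simp: pair_reps_def)

text \<open>Pairs in one orbit satisfy the same predicate in \<open>pair_rep\<close>, so the choice
  operator returns the same representative for both.\<close>

lemma pair_reps_unique:
  assumes P: "sub P" and "m1 \<in> pair_reps P" "m2 \<in> pair_reps P" "same_orbit P m1 m2"
  shows "m1 = m2"
proof -
  obtain a b where a: "maximal P (fst a) (snd a)" "m1 = pair_rep P a"
    and b: "maximal P (fst b) (snd b)" "m2 = pair_rep P b"
    using assms(2,3) by (auto simp: pair_reps_def)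
  have "same_orbit P a m1" "same_orbit P m2 b"
    using pair_rep[OF P a(1)] pair_rep[OF P b(1)] same_orbit_sym[OF P b(1)] a b by auto
  then have ab: "same_orbit P a b"
    using same_orbit_trans[OF P a(1)] assms(4) by blast
  then have ba: "same_orbit P b a" using same_orbit_sym[OF P a(1)] by blast
  have "same_orbit P a m \<longleftrightarrow> same_orbit P b m" for m
    using same_orbit_trans[OF P b(1) ba] same_orbit_trans[OF P a(1) ab] by blast
  then show ?thesis using a b by (simp add: pair_rep_def)
qed

text \<open>A summand of the product with its two projections: \<psi> to S and the inclusion to
  P.\<close>

definition pair_object :: "'a set \<Rightarrow> 'a set \<times> ('a \<Rightarrow> 'a) \<Rightarrow> 'a set \<times> ('a \<Rightarrow> 'a) set \<times> ('a \<Rightarrow> 'a) set" where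
  "pair_object P m = (fst m, cls (fst m) (carrier S) (snd m), cls (fst m) P (incl (fst m)))"

lemma pairs_iff:
  assumes "P \<in> centrics S F"
  shows "u \<in> Obj (pairs C (carrier S) P) \<longleftrightarrow>
    (\<exists>Q \<alpha> \<beta>. Q \<in> centrics S F \<and> \<alpha> \<in> F Q (carrier S) \<and> \<beta> \<in> F Q P \<and> u = (Q, cls Q (carrier S) \<alpha>, cls Q P \<beta>))"
  by (cases u) (auto simp: pairs_simps C_Obj C_Hom)

lemma pairs_hom_iff:
  assumes "sub Q" "sub R" "sub P" "\<alpha> \<in> F Q (carrier S)" "\<beta> \<in> F Q P" "\<alpha>' \<in> F R (carrier S)" "\<beta>' \<in> F R P"
    and "\<gamma> \<in> F Q R"
  shows "cls Q R \<gamma> \<in> Hom (pairs C (carrier S) P) (Q, cls Q (carrier S) \<alpha>, cls Q P \<beta>) (R, cls R (carrier S) \<alpha>', cls R P \<beta>')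
    \<longleftrightarrow> agree Q (compose Q \<alpha>' \<gamma>) \<alpha> \<and> (\<exists>y\<in>P. \<forall>u\<in>Q. \<beta> u = cj y (\<beta>' (\<gamma> u)))"
proof -
  note T = subgroup_self
  have "(\<exists>y\<in>P. \<forall>u\<in>Q. \<beta> u = cj y (compose Q \<beta>' \<gamma> u)) \<longleftrightarrow> (\<exists>y\<in>P. \<forall>u\<in>Q. \<beta> u = cj y (\<beta>' (\<gamma> u)))"
    by (simp add: compose_def)
  then show ?thesis
    using assms unfolding pairs_simps
    by (simp add: C_Comp[OF assms(1,2) T assms(8,6)] C_Comp[OF assms(1,2,3,8,7)]
        cls_eq_iff_agree[OF assms(1) F_comp[OF assms(1,2) T assms(8,6)] assms(4)]
        cls_eq_iff[OF assms(1,3) F_comp[OF assms(1,2,3,8,7)] assms(5)] C_Hom)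
qed

text \<open>An object over S and P is moved into P along its second map, enlarged to a maximal pair
  and translated to a representative. Uniqueness of the maximal pair shows that any two arrows
  differ by an element of P stabilizing the pair, hence by an inner automorphism of its
  domain.\<close>

lemma pair_reps_product_system:
  assumes Pc: "P \<in> centrics S F"
  shows "product_system C (carrier S) P (pair_reps P) (pair_object P)"
proof (rule product_systemI)
  note T = subgroup_self
  have P: "sub P" using Pc by simp
  note max = pair_reps_maximal[OF P]
  have i: "incl R \<in> F R P" if "sub R" "R \<subseteq> P" for R using F_incl[OF that(1) P that(2)] .
  show "finite (pair_reps P)"
  proof (rule finite_subset)
    show "pair_reps P \<subseteq> (SIGMA R:Pow P. R \<rightarrow>\<^sub>E carrier S)"
    proof
      fix m assume "m \<in> pair_reps P"
      note R = maximalD[OF max[OF this]]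
      show "m \<in> (SIGMA R:Pow P. R \<rightarrow>\<^sub>E carrier S)"
        using R(3,5) F_ext[OF R(2) T R(4)] by (cases m) (auto simp: PiE_def)
    qed
    show "finite (SIGMA R:Pow P. R \<rightarrow>\<^sub>E carrier S)"
      using sub_finite[OF P] finite_S by (intro finite_SigmaI finite_PiE) (auto intro: finite_subset)
  qed
  show "pair_object P m \<in> Obj (pairs C (carrier S) P)" if "m \<in> pair_reps P" for m
    unfolding pair_object_def pairs_iff[OF Pc] using maximalD[OF max[OF that]] i by blast
  fix u assume "u \<in> Obj (pairs C (carrier S) P)"
  then obtain Q \<alpha> \<beta> where Q: "Q \<in> centrics S F" and \<alpha>: "\<alpha> \<in> F Q (carrier S)" and \<beta>: "\<beta> \<in> F Q P"
    and u: "u = (Q, cls Q (carrier S) \<alpha>, cls Q P \<beta>)" unfolding pairs_iff[OF Pc] by blast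
  have Q': "sub Q" using Q by simp
  note \<alpha>c = F_carrier[OF Q' T \<alpha>]
  have hom: "cls Q (fst m) \<gamma> \<in> Hom (pairs C (carrier S) P) u (pair_object P m) \<longleftrightarrow>
      agree Q (\<lambda>u. snd m (\<gamma> u)) \<alpha> \<and> (\<exists>y\<in>P. \<forall>u\<in>Q. \<beta> u = cj y (\<gamma> u))"
    if m: "maximal P (fst m) (snd m)" and \<gamma>: "\<gamma> \<in> F Q (fst m)" for m \<gamma>
  proof -
    note R = maximalD[OF m]
    have "\<gamma> u \<in> fst m" if "u \<in> Q" for u using F_closed[OF Q' R(2) \<gamma> that] .
    then show ?thesis
      unfolding u pair_object_def pairs_hom_iff[OF Q' R(2) P \<alpha> \<beta> R(4) i[OF R(2,3)] \<gamma>]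
      by (auto simp: agree_def compose_def incl_def)
  qed
  show "\<exists>m\<in>pair_reps P. \<exists>c. c \<in> Hom (pairs C (carrier S) P) u (pair_object P m)"
  proof -
    let ?Q = "\<beta> ` Q"
    have sQ: "sub ?Q" by (rule F_image_sub[OF Q' P \<beta>])
    \<comment> \<open>\<open>\<alpha>\<close> transported to the image of \<open>\<beta>\<close>, so
      that the domain becomes a subgroup of P.\<close>
    define \<phi> where "\<phi> = compose ?Q \<alpha> (restrict (inv_into Q \<beta>) ?Q)"
    have \<phi>: "\<phi> \<in> F ?Q (carrier S)"
      unfolding \<phi>_def by (rule F_comp[OF sQ Q' T F_onto_image(2)[OF Q' P \<beta>] \<alpha>])
    have \<phi>\<beta>: "\<phi> (\<beta> u) = \<alpha> u" if "u \<in> Q" for u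
      using that F_inj[OF Q' P \<beta>] by (simp add: \<phi>_def compose_def)
    have QP: "?Q \<subseteq> P" using F_closed[OF Q' P \<beta>] by auto
    obtain R \<psi> where R: "maximal P R \<psi>" "?Q \<subseteq> R" "agree ?Q \<phi> \<psi>"
      using maximal_exists[OF P centric_image[OF Q P \<beta>] QP \<phi>] by blast
    define m where "m = pair_rep P (R, \<psi>)"
    have m: "maximal P (fst m) (snd m)" "same_orbit P (R, \<psi>) m"
      using pair_rep[OF P, of "(R, \<psi>)"] R(1) by (auto simp: m_def)
    note Rm = maximalD[OF m(1)]
    obtain x where x: "x \<in> P" "fst m = cj x ` R" "agree R \<psi> (\<lambda>u. snd m (cj x u))"
      using m(2) by (auto simp: same_orbit_def)
    have xS: "x \<in> carrier S" using x P by simp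
    \<comment> \<open>Translation by x leads from the maximal pair found above \<open>?Q\<close> to
      its representative; the arrow is \<open>\<beta>\<close> followed by this translation.\<close>
    define \<gamma> where "\<gamma> = (\<lambda>u\<in>Q. cj x (\<beta> u))"
    have \<gamma>: "\<gamma> \<in> F Q (fst m)"
      unfolding \<gamma>_def by (rule F_conj_comp[OF Q' P Rm(2) \<beta> xS]) (use x R(2) in auto)
    have "agree ?Q \<phi> (\<lambda>u. snd m (cj x u))"
      using agree_trans[OF R(3) agree_mono[OF x(3) R(2)]] F_carrier[OF sQ T \<phi>] by blast
    then have "agree Q \<alpha> (\<lambda>u. snd m (\<gamma> u))" using \<phi>\<beta> by (auto simp: agree_def \<gamma>_def)
    then have "agree Q (\<lambda>u. snd m (\<gamma> u)) \<alpha>" by (rule agree_sym) (rule \<alpha>c)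
    moreover have "\<exists>y\<in>P. \<forall>u\<in>Q. \<beta> u = cj y (\<gamma> u)"
      using x(1) xS F_carrier[OF Q' P \<beta>] subgroup.m_inv_closed[OF P]
      by (intro bexI[of _ "inv x"]) (auto simp: \<gamma>_def)
    ultimately have "cls Q (fst m) \<gamma> \<in> Hom (pairs C (carrier S) P) u (pair_object P m)"
      unfolding hom[OF m(1) \<gamma>] by blast
    moreover have "m \<in> pair_reps P" using R(1) by (auto simp: m_def pair_reps_def)
    ultimately show ?thesis by blast
  qed
  fix m1 c1 m2 c2
  assume m1: "m1 \<in> pair_reps P" and c1: "c1 \<in> Hom (pairs C (carrier S) P) u (pair_object P m1)"
    and m2: "m2 \<in> pair_reps P" and c2: "c2 \<in> Hom (pairs C (carrier S) P) u (pair_object P m2)"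
  note R1 = maximalD[OF max[OF m1]] and R2 = maximalD[OF max[OF m2]]
  obtain \<gamma>1 where \<gamma>1: "\<gamma>1 \<in> F Q (fst m1)" "c1 = cls Q (fst m1) \<gamma>1"
    using c1 unfolding u pair_object_def pairs_simps C_Hom by blast
  obtain \<gamma>2 where \<gamma>2: "\<gamma>2 \<in> F Q (fst m2)" "c2 = cls Q (fst m2) \<gamma>2"
    using c2 unfolding u pair_object_def pairs_simps C_Hom by blast
  note \<gamma>1c = F_closed[OF Q' R1(2) \<gamma>1(1)] and \<gamma>2c = F_closed[OF Q' R2(2) \<gamma>2(1)]
  have \<gamma>1S: "\<gamma>1 u \<in> carrier S" and \<gamma>2S: "\<gamma>2 u \<in> carrier S" if "u \<in> Q" for u
    using that \<gamma>1c \<gamma>2c R1(2) R2(2) by auto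
  obtain y1 where y1: "y1 \<in> P" "\<And>u. u \<in> Q \<Longrightarrow> \<beta> u = cj y1 (\<gamma>1 u)"
    and a1: "agree Q (\<lambda>u. snd m1 (\<gamma>1 u)) \<alpha>"
    using c1 hom[OF max[OF m1] \<gamma>1(1)] \<gamma>1(2) by auto
  obtain y2 where y2: "y2 \<in> P" "\<And>u. u \<in> Q \<Longrightarrow> \<beta> u = cj y2 (\<gamma>2 u)"
    and a2: "agree Q (\<lambda>u. snd m2 (\<gamma>2 u)) \<alpha>"
    using c2 hom[OF max[OF m2] \<gamma>2(1)] \<gamma>2(2) by auto
  \<comment> \<open>\<open>\<beta>\<close> is conjugate to \<open>\<gamma>1\<close> by
    \<open>y1\<close> and to \<open>\<gamma>2\<close> by \<open>y2\<close>, so x conjugates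
    \<open>\<gamma>1\<close> to \<open>\<gamma>2\<close>.\<close>
  define x where "x = inv y2 \<otimes> y1"
  have ys: "y1 \<in> carrier S" "y2 \<in> carrier S" using y1 y2 P by auto
  have x: "x \<in> P" using y1 y2 P by (simp add: x_def subgroup.m_closed subgroup.m_inv_closed)
  then have xS: "x \<in> carrier S" using P by simp
  have ix: "inv x \<in> P" "inv x \<in> carrier S" using x P subgroup.m_inv_closed by auto
  have \<gamma>12: "\<gamma>2 u = cj x (\<gamma>1 u)" if u: "u \<in> Q" for u
  proof -
    have "cj (inv y2) (cj y2 (\<gamma>2 u)) = cj (inv y2) (cj y1 (\<gamma>1 u))" using y1(2)[OF u] y2(2)[OF u] by simp
    then show ?thesis using ys \<gamma>1S[OF u] \<gamma>2S[OF u] by (simp add: x_def cj_mult)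
  qed
  have a12: "agree Q (\<lambda>u. snd m1 (\<gamma>1 u)) (\<lambda>u. snd m2 (\<gamma>2 u))"
    by (rule agree_trans[OF a1 agree_sym[OF a2]]) (use \<gamma>1c \<gamma>2c R1(5) R2(5) in auto)
  let ?Q = "\<gamma>1 ` Q"
  have sQ: "sub ?Q" by (rule F_image_sub[OF Q' R1(2) \<gamma>1(1)])
  have QR: "?Q \<subseteq> fst m1" using \<gamma>1c by auto
  have \<phi>: "restrict (snd m1) ?Q \<in> F ?Q (carrier S)" by (rule F_restrict[OF R1(2) T sQ R1(4) QR])
  note t = translate_F[OF R2(2,4) ix(2)]
  have tr: "translate (inv x) (fst m2) (snd m2) v = snd m2 (cj x v)" if "cj x v \<in> fst m2" "v \<in> carrier S" for v
    using t(3)[OF that(1)] that(2) xS by simp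
  have x\<gamma>: "cj x (\<gamma>1 u) \<in> fst m2" if "u \<in> Q" for u using \<gamma>12[OF that] \<gamma>2c[OF that] by simp
  \<comment> \<open>Both m1 and the translate of m2 by the inverse of x are maximal above the
    restriction of m1 to the image of \<open>\<gamma>1\<close>.\<close>
  have uniq: "fst m1 = cj (inv x) ` fst m2 \<and> agree (fst m1) (snd m1) (translate (inv x) (fst m2) (snd m2))"
  proof (rule maximal_unique[OF P centric_image[OF Q R1(2) \<gamma>1(1)] \<phi> max[OF m1] QR _
        maximal_translate[OF P max[OF m2] ix(1)]])
    show "agree ?Q (restrict (snd m1) ?Q) (snd m1)"
      using agree_refl[of ?Q "restrict (snd m1) ?Q"] F_carrier[OF sQ T \<phi>] by (auto simp: agree_def)
    show "?Q \<subseteq> cj (inv x) ` fst m2"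
    proof clarify
      fix u assume u: "u \<in> Q"
      then have "\<gamma>1 u = cj (inv x) (cj x (\<gamma>1 u))" using xS \<gamma>1S by simp
      then show "\<gamma>1 u \<in> cj (inv x) ` fst m2" using x\<gamma>[OF u] by blast
    qed
    obtain s where "s \<in> carrier S" "\<And>u. u \<in> Q \<Longrightarrow> snd m2 (\<gamma>2 u) = cj s (snd m1 (\<gamma>1 u))"
      using a12 by (auto simp: agree_def)
    then show "agree ?Q (restrict (snd m1) ?Q) (translate (inv x) (fst m2) (snd m2))"
      using tr x\<gamma> \<gamma>1S \<gamma>12 by (auto simp: agree_def)
  qed
  have eq: "fst m2 = cj x ` fst m1"
  proof -
    have "cj x ` cj (inv x) ` fst m2 = fst m2" unfolding image_image using xS R2(2) by simp
    then show ?thesis using uniq by simp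
  qed
  have agr: "agree (fst m1) (snd m1) (\<lambda>u. snd m2 (cj x u))"
    using uniq tr eq R1(2) by (auto simp: agree_def)
  have "same_orbit P m1 m2" unfolding same_orbit_def using x eq agr by blast
  then have mm: "m1 = m2" by (rule pair_reps_unique[OF P m1 m2])
  have stab: "cj x u \<in> fst m1" if "u \<in> fst m1" for u
    using imageI[OF that, of "cj x"] unfolding eq[symmetric] mm[symmetric] .
  \<comment> \<open>As x stabilizes the pair it lies in the domain, so \<open>\<gamma>1\<close> and
    \<open>\<gamma>2\<close> have the same class.\<close>
  have "x \<in> fst m1"
    by (rule maximal_stabilizer[OF P max[OF m1] x stab agr[folded mm]])
  then have "\<exists>q\<in>fst m1. \<forall>u\<in>Q. \<gamma>2 u = cj q (\<gamma>1 u)" using \<gamma>12 by blast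
  then have "cls Q (fst m1) \<gamma>1 = cls Q (fst m1) \<gamma>2"
    unfolding cls_eq_iff[OF Q' R1(2) \<gamma>1(1) \<gamma>2(1)[folded mm]] .
  then have "c1 = c2" unfolding \<gamma>1(2) \<gamma>2(2) mm[symmetric] .
  with mm show "m1 = m2 \<and> c1 = c2" by simp
qed

text \<open>With domain P every pair is maximal, and translating it by x in P changes the map only
  by conjugation with a value of the map. So the orbits with domain P are the morphism classes from
  P to S.\<close>

lemma card_top_pair_reps:
  assumes Pc: "P \<in> centrics S F"
  shows "card {m \<in> pair_reps P. fst m = P} = card (Hom C P (carrier S))"
proof (rule bij_betw_same_card)
  note T = subgroup_self
  have P: "sub P" using Pc by simp
  note max = pair_reps_maximal[OF P]
  have F: "snd m \<in> F P (carrier S)" if "m \<in> pair_reps P" "fst m = P" for m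
    using maximalD(4)[OF max[OF that(1)]] that(2) by simp
  show "bij_betw (\<lambda>m. cls P (carrier S) (snd m)) {m \<in> pair_reps P. fst m = P} (Hom C P (carrier S))"
    unfolding bij_betw_def
  proof (intro conjI inj_onI subset_antisym)
    fix m1 m2 assume m: "m1 \<in> {m \<in> pair_reps P. fst m = P}" "m2 \<in> {m \<in> pair_reps P. fst m = P}"
      and "cls P (carrier S) (snd m1) = cls P (carrier S) (snd m2)"
    then have "agree P (snd m1) (snd m2)" using F by (simp add: cls_eq_iff_agree[OF P])
    then have "same_orbit P m1 m2"
      using m P subgroup.one_closed[OF P] unfolding same_orbit_def
      by (intro bexI[of _ \<one>]) (auto simp: agree_def)
    then show "m1 = m2" using pair_reps_unique[OF P] m by blast
  next
    show "(\<lambda>m. cls P (carrier S) (snd m)) ` {m \<in> pair_reps P. fst m = P} \<subseteq> Hom C P (carrier S)"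
      using F by (auto simp: C_Hom)
    show "Hom C P (carrier S) \<subseteq> (\<lambda>m. cls P (carrier S) (snd m)) ` {m \<in> pair_reps P. fst m = P}"
    proof
      fix a assume "a \<in> Hom C P (carrier S)"
      then obtain \<phi> where \<phi>: "\<phi> \<in> F P (carrier S)" "a = cls P (carrier S) \<phi>" unfolding C_Hom by blast
      have m: "maximal P P \<phi>" unfolding maximal_def using Pc \<phi> by auto
      define m' where "m' = pair_rep P (P, \<phi>)"
      have m': "m' \<in> pair_reps P" "same_orbit P (P, \<phi>) m'"
        using pair_rep[OF P, of "(P, \<phi>)"] m by (auto simp: m'_def pair_reps_def)
      obtain x s where x: "x \<in> P" "fst m' = cj x ` P" "s \<in> carrier S"
        "\<And>u. u \<in> P \<Longrightarrow> snd m' (cj x u) = cj s (\<phi> u)"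
        using m'(2) by (auto simp: same_orbit_def agree_def)
      have xS: "x \<in> carrier S" and ix: "inv x \<in> P" using x P subgroup.m_inv_closed by auto
      have top: "fst m' = P"
      proof
        show "fst m' \<subseteq> P" using x cj_self[OF P] by auto
        have "u = cj x (cj (inv x) u)" if "u \<in> P" for u using that xS P by simp
        then show "P \<subseteq> fst m'" using x cj_self[OF P ix] by blast
      qed
      \<comment> \<open>Undoing the translation by x costs a conjugation by the value of
        \<open>\<phi>\<close> at the inverse of x, which \<open>agree\<close> absorbs.\<close>
      have "snd m' u = cj (s \<otimes> \<phi> (inv x)) (\<phi> u)" if u: "u \<in> P" for u
        using x(4)[OF cj_self[OF P ix u]] u xS P x(3) F_cj[OF P T \<phi>(1) u ix]
          F_carrier[OF P T \<phi>(1)] ix by (simp add: cj_mult)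
      moreover have "s \<otimes> \<phi> (inv x) \<in> carrier S" using x(3) F_carrier[OF P T \<phi>(1) ix] by simp
      ultimately have "agree P \<phi> (snd m')" unfolding agree_def by blast
      then have "a = cls P (carrier S) (snd m')"
        using \<phi> F[OF m'(1) top] by (simp add: cls_eq_iff_agree[OF P])
      then show "a \<in> (\<lambda>m. cls P (carrier S) (snd m)) ` {m \<in> pair_reps P. fst m = P}"
        using m'(1) top by blast
    qed
  qed
qed

end

section \<open>Transfers along the projection from a product\<close>

section \<open>Mackey functors\<close>

lemma (in abelian_monoid) finsum_Sigma:
  assumes "finite A" "\<And>a. a \<in> A \<Longrightarrow> finite (B a)"
    and "\<And>a b. a \<in> A \<Longrightarrow> b \<in> B a \<Longrightarrow> f a b \<in> carrier G"
  shows "finsum G (\<lambda>(a, b). f a b) (Sigma A B) = finsum G (\<lambda>a. finsum G (f a) (B a)) A"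
  using assms
proof (induction rule: finite_induct)
  case empty
  then show ?case by simp
next
  case (insert a A)
  have eq: "Sigma (insert a A) B = (Pair a ` B a) \<union> Sigma A B" by auto
  have "finsum G (\<lambda>(a, b). f a b) (Sigma (insert a A) B) =
      finsum G (\<lambda>(a, b). f a b) (Pair a ` B a) \<oplus> finsum G (\<lambda>(a, b). f a b) (Sigma A B)"
    unfolding eq using insert by (intro finsum_Un_disjoint) (auto intro: finite_SigmaI)
  also have "finsum G (\<lambda>(a, b). f a b) (Pair a ` B a) = finsum G (f a) (B a)"
    using insert by (subst finsum_reindex) (auto intro: inj_onI)
  also have "finsum G (\<lambda>(a, b). f a b) (Sigma A B) = finsum G (\<lambda>a. finsum G (f a) (B a)) A"
    using insert by auto
  also have "finsum G (f a) (B a) \<oplus> \<dots> = finsum G (\<lambda>a. finsum G (f a) (B a)) (insert a A)"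
    using insert by (intro finsum_insert[symmetric]) (auto intro!: finsum_closed)
  finally show ?case .
qed

definition pair_postcomp :: "('o, 'a) category \<Rightarrow> 'o \<Rightarrow> 'o \<Rightarrow> 'a \<Rightarrow> 'o \<times> 'a \<times> 'a \<Rightarrow> 'o \<times> 'a \<times> 'a" where
  "pair_postcomp C y z g = (\<lambda>(w, a, b). (w, a, Comp C w y z g b))"

lemma pair_postcomp_simps [simp]:
  "fst (pair_postcomp C y z g i) = fst i"
  "fst (snd (pair_postcomp C y z g i)) = fst (snd i)"
  "snd (snd (pair_postcomp C y z g i)) = Comp C (fst i) y z g (snd (snd i))"
  by (simp_all add: pair_postcomp_def split: prod.splits)

lemma families_Ar:
  "i \<in> Obj (pairs C x y) \<Longrightarrow> Ar (families C x M) y z g s i = s (pair_postcomp C y z g i)"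
  by (cases i) (simp add: families_simps pair_postcomp_def)

context small_category
begin

lemma pair_postcomp_Obj:
  assumes "x \<in> Obj C" "y \<in> Obj C" "z \<in> Obj C" "g \<in> Hom C y z" "i \<in> Obj (pairs C x y)"
  shows "pair_postcomp C y z g i \<in> Obj (pairs C x z)"
  using pairs_postcomp[OF assms(1-4)] assms(5) by (cases i) (simp add: pair_postcomp_def)

lemma pair_postcomp_Hom:
  assumes "x \<in> Obj C" "y \<in> Obj C" "z \<in> Obj C" "g \<in> Hom C y z" "i \<in> Obj (pairs C x y)" "j \<in> Obj (pairs C x y)"
    "c \<in> Hom (pairs C x y) i j"
  shows "c \<in> Hom (pairs C x z) (pair_postcomp C y z g i) (pair_postcomp C y z g j)"
  using pairs_hom_postcomp[OF assms(1-4)] assms(5-) by (cases i; cases j) (simp add: pair_postcomp_def)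

lemma pair_postcomp_inverse:
  assumes "x \<in> Obj C" "y \<in> Obj C" "z \<in> Obj C" "inverse_arrows C y z g h" "i \<in> Obj (pairs C x y)"
  shows "pair_postcomp C z y h (pair_postcomp C y z g i) = i"
proof (cases i)
  case (fields w a b)
  then have "w \<in> Obj C" "b \<in> Hom C w y" using assms by (auto simp: pairs_simps)
  then have "Comp C w z y h (Comp C w y z g b) = b"
    using assms by (simp add: inverse_arrows_def ide_left flip: comp_assoc)
  then show ?thesis by (simp add: fields pair_postcomp_def)
qed

text \<open>An isomorphism y to z identifies the pairs over y with those over z, arrows included,
  and so preserves terminal objects.\<close>

lemma product_system_postcomp:
  assumes x: "x \<in> Obj C" and y: "y \<in> Obj C" and z: "z \<in> Obj C" and gh: "inverse_arrows C y z g h"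
    and K: "product_system C x y K r"
  shows "product_system C x z K (\<lambda>i. pair_postcomp C y z g (r i))"
proof (rule product_systemI)
  note Kd = product_systemD[OF K]
  have g: "g \<in> Hom C y z" and h: "h \<in> Hom C z y" and hg: "inverse_arrows C z y h g"
    using gh by (auto simp: inverse_arrows_def)
  note inv = pair_postcomp_inverse[OF x y z gh] and inv' = pair_postcomp_inverse[OF x z y hg]
  show "finite K" by (rule Kd(1))
  show obj: "pair_postcomp C y z g (r i) \<in> Obj (pairs C x z)" if "i \<in> K" for i
    using pair_postcomp_Obj[OF x y z g Kd(2)[OF that]] .
  fix u assume u: "u \<in> Obj (pairs C x z)"
  let ?u = "pair_postcomp C z y h u"
  have u': "?u \<in> Obj (pairs C x y)" by (rule pair_postcomp_Obj[OF x z y h u])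
  obtain i c where i: "i \<in> K" "c \<in> Hom (pairs C x y) ?u (r i)" using Kd(3)[OF u'] by blast
  then have "c \<in> Hom (pairs C x z) u (pair_postcomp C y z g (r i))"
    using pair_postcomp_Hom[OF x y z g u' Kd(2)[OF i(1)] i(2)] inv'[OF u] by simp
  with i(1) show "\<exists>i\<in>K. \<exists>c. c \<in> Hom (pairs C x z) u (pair_postcomp C y z g (r i))" by blast
  fix i j c d assume *: "i \<in> K" "c \<in> Hom (pairs C x z) u (pair_postcomp C y z g (r i))"
    "j \<in> K" "d \<in> Hom (pairs C x z) u (pair_postcomp C y z g (r j))"
  have "c \<in> Hom (pairs C x y) ?u (r i)" "d \<in> Hom (pairs C x y) ?u (r j)"
    using pair_postcomp_Hom[OF x z y h u obj[OF *(1)] *(2)] pair_postcomp_Hom[OF x z y h u obj[OF *(3)] *(4)]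
      inv[OF Kd(2)[OF *(1)]] inv[OF Kd(2)[OF *(3)]] by auto
  then show "i = j \<and> c = d" using Kd(4)[OF u' *(1) _ *(3)] by blast
qed

text \<open>Terminal objects of the same component of \<open>pairs\<close> are isomorphic, by
  uniqueness of arrows to them.\<close>

lemma product_system_match:
  assumes x: "x \<in> Obj C" and y: "y \<in> Obj C"
    and K: "product_system C x y K r" and K': "product_system C x y K' r'"
  obtains f c c' where "bij_betw f K K'"
    "\<And>i. i \<in> K \<Longrightarrow> c i \<in> Hom (pairs C x y) (r i) (r' (f i))"
    "\<And>i. i \<in> K \<Longrightarrow> inverse_arrows C (fst (r i)) (fst (r' (f i))) (c i) (c' i)"
proof -
  let ?E = "pairs C x y"
  note Kd = product_systemD[OF K] and Kd' = product_systemD[OF K']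
  obtain f c where f: "f i \<in> K'" "c i \<in> Hom ?E (r i) (r' (f i))" if "i \<in> K" for i
    using Kd'(3)[OF Kd(2)] by metis
  obtain h c' where h: "h j \<in> K" "c' j \<in> Hom ?E (r' j) (r (h j))" if "j \<in> K'" for j
    using Kd(3)[OF Kd'(2)] by metis
  have fstC: "fst i \<in> Obj C" if "i \<in> Obj ?E" for i using that by (cases i) (simp add: pairs_simps)
  have homC: "c \<in> Hom C (fst i) (fst j)" if "c \<in> Hom ?E i j" for i j c
    using that by (cases i; cases j) (simp add: pairs_simps)
  have comp: "Comp C (fst i) (fst j) (fst l) b a \<in> Hom ?E i l"
    if "i \<in> Obj ?E" "j \<in> Obj ?E" "l \<in> Obj ?E" "a \<in> Hom ?E i j" "b \<in> Hom ?E j l" for i j l a b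
    using that x y by (cases i; cases j; cases l) (auto simp: pairs_simps comp_closed simp flip: comp_assoc)
  have ide: "Ide C (fst i) \<in> Hom ?E i i" if "i \<in> Obj ?E" for i
    using that x y by (cases i) (auto simp: pairs_simps ide_closed ide_right)
  have hf: "h (f i) = i \<and> Comp C (fst (r i)) (fst (r' (f i))) (fst (r i)) (c' (f i)) (c i) = Ide C (fst (r i))"
    if i: "i \<in> K" for i
  proof -
    have "Comp C (fst (r i)) (fst (r' (f i))) (fst (r (h (f i)))) (c' (f i)) (c i) \<in> Hom ?E (r i) (r (h (f i)))"
      using f[OF i] h[OF f(1)[OF i]] Kd(2) Kd'(2) i by (intro comp) auto
    from Kd(4)[OF Kd(2)[OF i] h(1)[OF f(1)[OF i]] this i ide[OF Kd(2)[OF i]]]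
    show ?thesis by auto
  qed
  have fh: "f (h j) = j \<and> Comp C (fst (r' j)) (fst (r (h j))) (fst (r' j)) (c (h j)) (c' j) = Ide C (fst (r' j))"
    if j: "j \<in> K'" for j
  proof -
    have "Comp C (fst (r' j)) (fst (r (h j))) (fst (r' (f (h j)))) (c (h j)) (c' j) \<in> Hom ?E (r' j) (r' (f (h j)))"
      using h[OF j] f[OF h(1)[OF j]] Kd(2) Kd'(2) j by (intro comp) auto
    from Kd'(4)[OF Kd'(2)[OF j] f(1)[OF h(1)[OF j]] this j ide[OF Kd'(2)[OF j]]]
    show ?thesis by auto
  qed
  show thesis
  proof (rule that)
    show "bij_betw f K K'"
      by (rule bij_betw_byWitness[where f' = h]) (use f h hf fh in auto)
    show "c i \<in> Hom ?E (r i) (r' (f i))" if "i \<in> K" for i using f that by simp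
    show "inverse_arrows C (fst (r i)) (fst (r' (f i))) (c i) (c' (f i))" if i: "i \<in> K" for i
      using homC[OF f(2)[OF i]] homC[OF h(2)[OF f(1)[OF i]]] hf[OF i] fh[OF f(1)[OF i]]
      by (simp add: inverse_arrows_def)
  qed
qed

end

text \<open>A Mackey functor short of the double coset formula, over any finite category; enough for
  transfers to be defined and compared along isomorphisms.\<close>

locale double_functor = small_category C
  for C :: "('o, 'a) category" and k :: "('k, 'z) ring_scheme" and U L :: "('o, 'a, 'k, 'm) mod_functor" and x +
  assumes U: "contravariant_functor C k U" and L: "covariant_functor C k L"
    and Ob_eq: "\<And>y. y \<in> Obj C \<Longrightarrow> Ob L y = Ob U y"
    and inverse: "\<And>y z a b v. y \<in> Obj C \<Longrightarrow> z \<in> Obj C \<Longrightarrow> inverse_arrows C y z a b \<Longrightarrow>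
        v \<in> carrier (Ob U z) \<Longrightarrow> Ar U y z a v = Ar L z y b v"
    and x: "x \<in> Obj C"
begin

lemma L_linear: "y \<in> Obj C \<Longrightarrow> z \<in> Obj C \<Longrightarrow> a \<in> Hom C y z \<Longrightarrow> Ar L y z a \<in> linear_maps k (Ob U y) (Ob U z)"
  using L Ob_eq by (auto simp: covariant_functor_def)

lemma L_closed: "y \<in> Obj C \<Longrightarrow> z \<in> Obj C \<Longrightarrow> a \<in> Hom C y z \<Longrightarrow> v \<in> carrier (Ob U y) \<Longrightarrow> Ar L y z a v \<in> carrier (Ob U z)"
  using linear_closed[OF L_linear] .

lemma L_ide: "y \<in> Obj C \<Longrightarrow> v \<in> carrier (Ob U y) \<Longrightarrow> Ar L y y (Ide C y) v = v"
  using L Ob_eq by (auto simp: covariant_functor_def)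

lemma L_comp: "w \<in> Obj C \<Longrightarrow> y \<in> Obj C \<Longrightarrow> z \<in> Obj C \<Longrightarrow> a \<in> Hom C w y \<Longrightarrow> b \<in> Hom C y z \<Longrightarrow>
    v \<in> carrier (Ob U w) \<Longrightarrow> Ar L w z (Comp C w y z b a) v = Ar L y z b (Ar L w y a v)"
  using L Ob_eq by (auto simp: covariant_functor_def)

text \<open>The covariant map from M(x times y) to M(y) along the second projection: the sum of the
  transfers from the summands of the product.\<close>

definition transfer :: "'o \<Rightarrow> 'i set \<Rightarrow> ('i \<Rightarrow> 'o \<times> 'a \<times> 'a) \<Rightarrow> ('o \<times> 'a \<times> 'a \<Rightarrow> 'm) \<Rightarrow> 'm" where
  "transfer y K r s = finsum (Ob U y) (\<lambda>i. Ar L (fst (r i)) y (snd (snd (r i))) (s (r i))) K"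

lemma pairD:
  assumes "i \<in> Obj (pairs C x y)"
  shows "fst i \<in> Obj C" "fst (snd i) \<in> Hom C (fst i) x" "snd (snd i) \<in> Hom C (fst i) y"
  using assms by (cases i; simp add: pairs_simps)+

lemma transfer_term_closed:
  assumes "y \<in> Obj C" "s \<in> carrier (Ob (families C x U) y)" "i \<in> Obj (pairs C x y)"
  shows "Ar L (fst i) y (snd (snd i)) (s i) \<in> carrier (Ob U y)"
  using L_closed[OF pairD(1)[OF assms(3)] assms(1) pairD(3)[OF assms(3)] familiesD(1)[OF assms(2,3)]] .

lemma transfer_linear:
  assumes y: "y \<in> Obj C" and K: "product_system C x y K r"
  shows "transfer y K r \<in> linear_maps k (Ob (families C x U) y) (Ob U y)"
proof -
  note Kd = product_systemD[OF K]
  interpret m: module k "Ob U y" by (rule contra_module[OF U y])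
  note summand = transfer_term_closed[OF y]
  show ?thesis
  proof (rule linear_mapsI)
    fix s assume "s \<in> carrier (Ob (families C x U) y)"
    then show "transfer y K r s \<in> carrier (Ob U y)"
      unfolding transfer_def using summand Kd by (intro m.M.finsum_closed) auto
  next
    fix s s' assume s: "s \<in> carrier (Ob (families C x U) y)" "s' \<in> carrier (Ob (families C x U) y)"
    have "Ar L (fst (r i)) y (snd (snd (r i))) ((s \<oplus>\<^bsub>Ob (families C x U) y\<^esub> s') (r i)) =
       Ar L (fst (r i)) y (snd (snd (r i))) (s (r i)) \<oplus>\<^bsub>Ob U y\<^esub> Ar L (fst (r i)) y (snd (snd (r i))) (s' (r i))"
      if "i \<in> K" for i
      using linear_add[OF L_linear[OF pairD(1)[OF Kd(2)[OF that]] y pairD(3)[OF Kd(2)[OF that]]]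
          familiesD(1)[OF s(1) Kd(2)[OF that]] familiesD(1)[OF s(2) Kd(2)[OF that]]] Kd(2)[OF that]
      by (simp add: families_simps limit_simps(3) on_pairs_simps)
    then have "transfer y K r (s \<oplus>\<^bsub>Ob (families C x U) y\<^esub> s') = finsum (Ob U y) (\<lambda>i.
        Ar L (fst (r i)) y (snd (snd (r i))) (s (r i)) \<oplus>\<^bsub>Ob U y\<^esub> Ar L (fst (r i)) y (snd (snd (r i))) (s' (r i))) K"
      unfolding transfer_def using summand[OF s(1)] summand[OF s(2)] Kd(2) by (intro m.M.finsum_cong') auto
    also have "\<dots> = transfer y K r s \<oplus>\<^bsub>Ob U y\<^esub> transfer y K r s'"
      unfolding transfer_def using summand[OF s(1)] summand[OF s(2)] Kd(2) by (intro m.M.finsum_addf) auto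
    finally show "transfer y K r (s \<oplus>\<^bsub>Ob (families C x U) y\<^esub> s') = transfer y K r s \<oplus>\<^bsub>Ob U y\<^esub> transfer y K r s'" .
  next
    fix q s assume q: "q \<in> carrier k" and s: "s \<in> carrier (Ob (families C x U) y)"
    have "Ar L (fst (r i)) y (snd (snd (r i))) ((q \<odot>\<^bsub>Ob (families C x U) y\<^esub> s) (r i)) =
       q \<odot>\<^bsub>Ob U y\<^esub> Ar L (fst (r i)) y (snd (snd (r i))) (s (r i))"
      if "i \<in> K" for i
      using linear_smult[OF L_linear[OF pairD(1)[OF Kd(2)[OF that]] y pairD(3)[OF Kd(2)[OF that]]]
          q familiesD(1)[OF s Kd(2)[OF that]]] Kd(2)[OF that]
      by (simp add: families_simps limit_simps(4) on_pairs_simps)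
    then have "transfer y K r (q \<odot>\<^bsub>Ob (families C x U) y\<^esub> s) = finsum (Ob U y) (\<lambda>i.
        q \<odot>\<^bsub>Ob U y\<^esub> Ar L (fst (r i)) y (snd (snd (r i))) (s (r i))) K"
      unfolding transfer_def using summand[OF s] Kd(2) q by (intro m.M.finsum_cong') auto
    also have "\<dots> = q \<odot>\<^bsub>Ob U y\<^esub> transfer y K r s"
      unfolding transfer_def using summand[OF s] Kd q
      by (intro linear_finsum[OF contra_module[OF U y] contra_module[OF U y] linear_scale[OF contra_module[OF U y] q], symmetric]) auto
    finally show "transfer y K r (q \<odot>\<^bsub>Ob (families C x U) y\<^esub> s) = q \<odot>\<^bsub>Ob U y\<^esub> transfer y K r s" .
  qed
qed

text \<open>Two decompositions are matched by isomorphisms, and along these restriction is transfer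
  along the inverse, so matching summands contribute equally. Hence a transfer may be computed with
  whichever decomposition is convenient.\<close>

lemma transfer_independent:
  assumes y: "y \<in> Obj C" and K: "product_system C x y K r" and K': "product_system C x y K' r'"
    and s: "s \<in> carrier (Ob (families C x U) y)"
  shows "transfer y K r s = transfer y K' r' s"
proof -
  note Kd = product_systemD[OF K] and Kd' = product_systemD[OF K']
  interpret m: module k "Ob U y" by (rule contra_module[OF U y])
  obtain f c c' where bij: "bij_betw f K K'"
    and c: "\<And>i. i \<in> K \<Longrightarrow> c i \<in> Hom (pairs C x y) (r i) (r' (f i))"
    and inv: "\<And>i. i \<in> K \<Longrightarrow> inverse_arrows C (fst (r i)) (fst (r' (f i))) (c i) (c' i)"
    using product_system_match[OF x y K K'] by blast
  let ?h = "\<lambda>j. Ar L (fst (r' j)) y (snd (snd (r' j))) (s (r' j))"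
  have f: "f i \<in> K'" if "i \<in> K" for i using bij that by (auto simp: bij_betw_def)
  have closed: "?h j \<in> carrier (Ob U y)" if "j \<in> K'" for j using transfer_term_closed[OF y s Kd'(2)[OF that]] .
  have "transfer y K' r' s = finsum (Ob U y) ?h (f ` K)"
    using bij by (simp add: transfer_def bij_betw_def)
  also have "\<dots> = finsum (Ob U y) (\<lambda>i. ?h (f i)) K"
    using bij closed by (intro m.M.finsum_reindex) (auto simp: bij_betw_def)
  also have "\<dots> = transfer y K r s"
    unfolding transfer_def
  proof (rule m.M.finsum_cong')
    fix i assume i: "i \<in> K"
    note ri = Kd(2)[OF i] and ri' = Kd'(2)[OF f[OF i]]
    note p = pairD[OF ri] and p' = pairD[OF ri']
    have hom: "c i \<in> Hom C (fst (r i)) (fst (r' (f i)))" "c' i \<in> Hom C (fst (r' (f i))) (fst (r i))"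
      and cc': "Comp C (fst (r' (f i))) (fst (r i)) (fst (r' (f i))) (c i) (c' i) = Ide C (fst (r' (f i)))"
      using inv[OF i] by (auto simp: inverse_arrows_def)
    have "Comp C (fst (r i)) (fst (r' (f i))) y (snd (snd (r' (f i)))) (c i) = snd (snd (r i))"
      using c[OF i] by (cases "r i"; cases "r' (f i)") (simp add: pairs_simps)
    \<comment> \<open>Compatibility of s gives a restriction along \<open>c i\<close>, which becomes
      the transfer along its inverse \<open>c' i\<close> and then cancels against the transfer along
      \<open>c i\<close>.\<close>
    moreover have "s (r i) = Ar L (fst (r' (f i))) (fst (r i)) (c' i) (s (r' (f i)))"
      using familiesD(2)[OF s ri ri' c[OF i]] inverse[OF p(1) p'(1) inv[OF i] familiesD(1)[OF s ri']] by simp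
    ultimately show "?h (f i) = Ar L (fst (r i)) y (snd (snd (r i))) (s (r i))"
      using L_comp[OF p(1) p'(1) y hom(1) p'(3), of "s (r i)"] L_comp[OF p'(1) p(1) p'(1) hom(2,1), of "s (r' (f i))"]
        familiesD(1)[OF s ri] familiesD(1)[OF s ri'] L_ide[OF p'(1)] cc' by simp
  qed (use transfer_term_closed[OF y s] Kd in auto)
  finally show ?thesis by simp
qed

lemma transfer_iso:
  assumes y: "y \<in> Obj C" and z: "z \<in> Obj C" and gh: "inverse_arrows C y z g h"
    and K: "product_system C x y K r" and K': "product_system C x z K' r'"
    and s: "s \<in> carrier (Ob (families C x U) z)"
  shows "transfer y K r (Ar (families C x U) y z g s) = Ar U y z g (transfer z K' r' s)"
proof -
  have g: "g \<in> Hom C y z" and h: "h \<in> Hom C z y" and hg: "inverse_arrows C z y h g"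
    using gh by (auto simp: inverse_arrows_def)
  note Kd = product_systemD[OF K] and Kd' = product_systemD[OF K']
  interpret U: module k "Ob U y" by (rule contra_module[OF U y])
  interpret U': module k "Ob U z" by (rule contra_module[OF U z])
  interpret f: module k "Ob (families C x U) y"
    by (rule contra_module[OF families_functor[OF U.R.is_cring U x] y])
  have fs: "Ar (families C x U) y z g s \<in> carrier (Ob (families C x U) y)"
    by (rule contra_closed[OF families_functor[OF U.R.is_cring U x] y z g s])
  \<comment> \<open>Over y the decomposition carried over from z along \<open>h\<close> is used
    instead, so that both sides have the same index set.\<close>
  have "transfer y K r (Ar (families C x U) y z g s) =
      transfer y K' (\<lambda>i. pair_postcomp C z y h (r' i)) (Ar (families C x U) y z g s)"
    by (rule transfer_independent[OF y K product_system_postcomp[OF x z y hg K'] fs])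
  also have "\<dots> = finsum (Ob U y) (\<lambda>i. Ar L z y h (Ar L (fst (r' i)) z (snd (snd (r' i))) (s (r' i)))) K'"
    unfolding transfer_def
  proof (rule U.M.finsum_cong'[OF refl], rule Pi_I)
    fix i assume i: "i \<in> K'"
    note ri = Kd'(2)[OF i]
    show "Ar L z y h (Ar L (fst (r' i)) z (snd (snd (r' i))) (s (r' i))) \<in> carrier (Ob U y)"
      by (rule L_closed[OF z y h transfer_term_closed[OF z s ri]])
  next
    fix i assume i: "i \<in> K'"
    note ri = Kd'(2)[OF i]
    note p = pairD[OF ri]
    show "Ar L (fst (pair_postcomp C z y h (r' i))) y (snd (snd (pair_postcomp C z y h (r' i))))
        (Ar (families C x U) y z g s (pair_postcomp C z y h (r' i))) =
      Ar L z y h (Ar L (fst (r' i)) z (snd (snd (r' i))) (s (r' i)))"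
      using familiesD(1)[OF s ri] p
      by (simp add: families_Ar[OF pair_postcomp_Obj[OF x z y h ri]] pair_postcomp_inverse[OF x z y hg ri]
          L_comp[OF p(1) z y p(3) h])
  qed
  also have "\<dots> = Ar L z y h (transfer z K' r' s)"
    unfolding transfer_def
    by (rule linear_finsum[OF contra_module[OF U z] contra_module[OF U y] L_linear[OF z y h], symmetric])
      (use Kd' transfer_term_closed[OF z s] in auto)
  also have "\<dots> = Ar U y z g (transfer z K' r' s)"
    using inverse[OF y z gh] linear_closed[OF transfer_linear[OF z K'] s] by simp
  finally show ?thesis .
qed

end

section \<open>Restricting a product decomposition along an inclusion\<close>

context saturated_fusion
begin

text \<open>An injective map from the finite group S to a subgroup of S is onto S.\<close>

lemma S_centric: "carrier S \<in> centrics S F"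
proof (rule centricsI[OF subgroup_self])
  fix Q \<phi> g assume Q: "sub Q" and \<phi>: "\<phi> \<in> F (carrier S) Q" and g: "g \<in> carrier S"
  have "\<phi> ` carrier S = carrier S"
    using F_carrier[OF subgroup_self Q \<phi>] F_inj[OF subgroup_self Q \<phi>] finite_S by (intro endo_inj_surj) auto
  then show "g \<in> \<phi> ` carrier S" using g by simp
qed

lemma double_coset_iff: "y \<in> Q <#> (x <# R) \<longleftrightarrow> (\<exists>q\<in>Q. \<exists>r\<in>R. y = q \<otimes> (x \<otimes> r))"
  by (auto simp: set_mult_def l_coset_def)

text \<open>The Mackey formula speaks about given representatives, so some must be produced before
  it can be applied.\<close>

lemma double_coset_reps_exist:
  assumes P: "sub P" and Q: "sub Q" "Q \<subseteq> P" and R: "sub R" "R \<subseteq> P"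
  shows "\<exists>D. double_coset_reps S P Q R D"
proof -
  define dc where "dc x y \<longleftrightarrow> (\<exists>q\<in>Q. \<exists>r\<in>R. y = q \<otimes> (x \<otimes> r))" for x y
  note car = sub_carrier[OF P] sub_carrier[OF Q(1)] sub_carrier[OF R(1)]
  have refl: "dc x x" if "x \<in> P" for x
    using that car subgroup.one_closed[OF Q(1)] subgroup.one_closed[OF R(1)]
    unfolding dc_def by (intro bexI[of _ \<one>]) auto
  have sym: "dc y x" if xy: "x \<in> P" "dc x y" for x y
  proof -
    obtain q r where qr: "q \<in> Q" "r \<in> R" "y = q \<otimes> (x \<otimes> r)" using xy by (auto simp: dc_def)
    then have "x = inv q \<otimes> (y \<otimes> inv r)"
      using car xy(1) by (simp add: m_assoc) (simp add: m_assoc[symmetric])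
    then show ?thesis
      using qr subgroup.m_inv_closed[OF Q(1)] subgroup.m_inv_closed[OF R(1)] unfolding dc_def by blast
  qed
  have trans: "dc x z" if xyz: "x \<in> P" "dc x y" "dc y z" for x y z
  proof -
    obtain q r where qr: "q \<in> Q" "r \<in> R" "y = q \<otimes> (x \<otimes> r)" using xyz by (auto simp: dc_def)
    obtain q' r' where qr': "q' \<in> Q" "r' \<in> R" "z = q' \<otimes> (y \<otimes> r')" using xyz by (auto simp: dc_def)
    have "z = (q' \<otimes> q) \<otimes> (x \<otimes> (r \<otimes> r'))" using qr qr' car xyz(1) by (simp add: m_assoc)
    then show ?thesis
      using qr qr' subgroup.m_closed[OF Q(1)] subgroup.m_closed[OF R(1)] unfolding dc_def by blast
  qed
  define rep where "rep y = (SOME x. x \<in> P \<and> dc x y)" for y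
  have rep: "rep y \<in> P" "dc (rep y) y" if "y \<in> P" for y
    using someI[of "\<lambda>x. x \<in> P \<and> dc x y" y] refl[OF that] that by (auto simp: rep_def)
  have rep_eq: "rep y = rep z" if "y \<in> P" "z \<in> P" "dc y z" for y z
  proof -
    have "(x \<in> P \<and> dc x y) \<longleftrightarrow> (x \<in> P \<and> dc x z)" for x
      using trans[of x y z] trans[of x z y] sym[of y z] that by blast
    then show ?thesis by (simp add: rep_def)
  qed
  have "double_coset_reps S P Q R (rep ` P)"
    unfolding double_coset_reps_def double_coset_iff dc_def[symmetric]
  proof (intro conjI ballI)
    show "rep ` P \<subseteq> P" using rep by auto
    fix y assume y: "y \<in> P"
    show "\<exists>!x. x \<in> rep ` P \<and> dc x y"
    proof (rule ex1I[of _ "rep y"])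
      show "rep y \<in> rep ` P \<and> dc (rep y) y" using rep y by auto
      fix x assume "x \<in> rep ` P \<and> dc x y"
      then obtain z where z: "z \<in> P" "x = rep z" "dc x y" by auto
      then have "dc z y" using trans[of z x y] sym[of x z] rep[OF z(1)] by blast
      then show "x = rep y" using rep_eq[OF z(1) y] z by simp
    qed
  qed
  then show ?thesis by blast
qed

text \<open>A summand of the pullback: the translate of (R, \<psi>) by x, cut down to Q.\<close>

definition restricted_pair :: "'a set \<Rightarrow> ('a set \<times> ('a \<Rightarrow> 'a)) \<times> 'a \<Rightarrow> 'a set \<times> ('a \<Rightarrow> 'a) set \<times> ('a \<Rightarrow> 'a) set" where
  "restricted_pair Q = (\<lambda>((R, \<psi>), x). let W = Q \<inter> cj x ` R in
     (W, cls W (carrier S) (\<lambda>u\<in>W. \<psi> (cj (inv x) u)), cls W Q (incl W)))"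

text \<open>The pullback along an inclusion \<open>Q \<le> P\<close> of a product decomposition over \<open>P\<close> is described by
  double cosets, exactly as in the Mackey formula.\<close>

lemma restricted_product_system:
  assumes Pc: "P \<in> centrics S F" and Qc: "Q \<in> centrics S F" and QP: "Q \<subseteq> P"
    and D: "\<And>m. m \<in> pair_reps P \<Longrightarrow> double_coset_reps S P Q (fst m) (D m)"
  shows "product_system C (carrier S) Q
    (SIGMA m:pair_reps P. {x \<in> D m. Q \<inter> cj x ` fst m \<in> centrics S F}) (restricted_pair Q)"
proof (rule product_systemI)
  note T = subgroup_self
  have P: "sub P" and Q: "sub Q" using Pc Qc by auto
  note max = pair_reps_maximal[OF P]
  note sys = product_systemD[OF pair_reps_product_system[OF Pc]]
  define K where "K = (SIGMA m:pair_reps P. {x \<in> D m. Q \<inter> cj x ` fst m \<in> centrics S F})"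
  have DP: "D m \<subseteq> P" if "m \<in> pair_reps P" for m using D[OF that] by (simp add: double_coset_reps_def)
  have i: "incl R \<in> F R P'" if "sub R" "sub P'" "R \<subseteq> P'" for R P' using F_incl[OF that] .
  show "finite K" unfolding K_def
    by (rule finite_SigmaI[OF sys(1)]) (use DP sub_finite[OF P] in \<open>auto intro: finite_subset\<close>)
  define W where "W m x = Q \<inter> cj x ` fst m" for m :: "'a set \<times> ('a \<Rightarrow> 'a)" and x
  define \<psi>' where "\<psi>' m x = (\<lambda>u\<in>W m x. snd m (cj (inv x) u))" for m :: "'a set \<times> ('a \<Rightarrow> 'a)" and x
  have rp: "restricted_pair Q (m, x) = (W m x, cls (W m x) (carrier S) (\<psi>' m x), cls (W m x) Q (incl (W m x)))" for m x
    by (cases m) (simp add: restricted_pair_def W_def \<psi>'_def Let_def)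
  have Wsub: "sub (W m x)" and \<psi>': "\<psi>' m x \<in> F (W m x) (carrier S)"
    and Winv: "u \<in> W m x \<Longrightarrow> cj (inv x) u \<in> fst m"
    if m: "m \<in> pair_reps P" and x: "x \<in> P" for m x u
  proof -
    note R = maximalD[OF max[OF m]]
    have xS: "x \<in> carrier S" using x P by simp
    show s: "sub (W m x)" unfolding W_def by (rule subgroups_Inter_pair[OF Q cj_image_subgroup[OF R(2) xS]])
    show inv: "cj (inv x) u \<in> fst m" if "u \<in> W m x" for u
      using that xS R(2) by (auto simp: W_def)
    have "compose (W m x) (snd m) (restrict (cj (inv x)) (W m x)) \<in> F (W m x) (carrier S)"
      by (rule F_comp[OF s R(2) T F_conj[OF s R(2)] R(4)]) (use xS inv in auto)
    moreover have "compose (W m x) (snd m) (restrict (cj (inv x)) (W m x)) = \<psi>' m x"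
      by (auto simp: compose_def \<psi>'_def)
    ultimately show "\<psi>' m x \<in> F (W m x) (carrier S)" by simp
  qed
  have WQ: "W m x \<subseteq> Q" for m x by (auto simp: W_def)
  show "restricted_pair Q j \<in> Obj (pairs C (carrier S) Q)" if j: "j \<in> K" for j
  proof -
    obtain m x where mx: "j = (m, x)" "m \<in> pair_reps P" "x \<in> D m" "W m x \<in> centrics S F"
      using j by (auto simp: K_def W_def)
    then have "x \<in> P" using DP[OF mx(2)] by blast
    then show ?thesis
      unfolding mx(1) rp pairs_iff[OF Qc] using mx Wsub \<psi>' i[OF _ Q WQ] by blast
  qed
  fix u assume "u \<in> Obj (pairs C (carrier S) Q)"
  then obtain V \<alpha> \<beta> where Vc: "V \<in> centrics S F" and \<alpha>: "\<alpha> \<in> F V (carrier S)" and \<beta>: "\<beta> \<in> F V Q"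
    and u: "u = (V, cls V (carrier S) \<alpha>, cls V Q \<beta>)" unfolding pairs_iff[OF Qc] by blast
  have V: "sub V" using Vc by simp
  note \<beta>Q = F_closed[OF V Q \<beta>]
  have \<beta>P: "\<beta> \<in> F V P" by (rule F_corestrict[OF V Q P \<beta>]) (use \<beta>Q QP in auto)
  have \<beta>S: "\<beta> v \<in> carrier S" if "v \<in> V" for v using F_carrier[OF V Q \<beta> that] .
  \<comment> \<open>Viewed over P, the object has a unique arrow to a summand; arrows over Q are
    found and compared through it.\<close>
  define uP where "uP = (V, cls V (carrier S) \<alpha>, cls V P \<beta>)"
  have uP: "uP \<in> Obj (pairs C (carrier S) P)"
    unfolding uP_def pairs_iff[OF Pc] using Vc \<alpha> \<beta>P by blast
  have homP: "cls V (fst m) \<gamma> \<in> Hom (pairs C (carrier S) P) uP (pair_object P m) \<longleftrightarrow>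
      agree V (\<lambda>v. snd m (\<gamma> v)) \<alpha> \<and> (\<exists>y\<in>P. \<forall>v\<in>V. \<beta> v = cj y (\<gamma> v))"
    if m: "m \<in> pair_reps P" and \<gamma>: "\<gamma> \<in> F V (fst m)" for m \<gamma>
  proof -
    note R = maximalD[OF max[OF m]]
    have "\<gamma> v \<in> fst m" if "v \<in> V" for v using F_closed[OF V R(2) \<gamma> that] .
    then show ?thesis
      unfolding uP_def pair_object_def pairs_hom_iff[OF V R(2) P \<alpha> \<beta>P R(4) i[OF R(2) P R(3)] \<gamma>]
      by (auto simp: agree_def compose_def incl_def)
  qed
  have homQ: "cls V (W m x) \<gamma> \<in> Hom (pairs C (carrier S) Q) u (restricted_pair Q (m, x)) \<longleftrightarrow>
      agree V (\<lambda>v. snd m (cj (inv x) (\<gamma> v))) \<alpha> \<and> (\<exists>y\<in>Q. \<forall>v\<in>V. \<beta> v = cj y (\<gamma> v))"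
    if m: "m \<in> pair_reps P" and x: "x \<in> P" and \<gamma>: "\<gamma> \<in> F V (W m x)" for m x \<gamma>
  proof -
    have "\<gamma> v \<in> W m x" if "v \<in> V" for v using F_closed[OF V Wsub[OF m x] \<gamma> that] .
    then show ?thesis
      unfolding u rp pairs_hom_iff[OF V Wsub[OF m x] Q \<alpha> \<beta> \<psi>'[OF m x] i[OF Wsub[OF m x] Q WQ] \<gamma>]
      by (auto simp: agree_def compose_def incl_def \<psi>'_def)
  qed
  show "\<exists>j\<in>K. \<exists>c. c \<in> Hom (pairs C (carrier S) Q) u (restricted_pair Q j)"
  proof -
    obtain m c where m: "m \<in> pair_reps P" and c: "c \<in> Hom (pairs C (carrier S) P) uP (pair_object P m)"
      using sys(3)[OF uP] by blast
    note R = maximalD[OF max[OF m]]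
    obtain \<gamma> where \<gamma>: "\<gamma> \<in> F V (fst m)" "c = cls V (fst m) \<gamma>"
      using c unfolding uP_def pair_object_def pairs_simps C_Hom by blast
    note \<gamma>R = F_closed[OF V R(2) \<gamma>(1)]
    have \<gamma>S: "\<gamma> v \<in> carrier S" if "v \<in> V" for v using \<gamma>R[OF that] R(2) by simp
    obtain y where y: "y \<in> P" "\<And>v. v \<in> V \<Longrightarrow> \<beta> v = cj y (\<gamma> v)" and ag: "agree V (\<lambda>v. snd m (\<gamma> v)) \<alpha>"
      using c homP[OF m \<gamma>(1)] \<gamma>(2) by auto
    \<comment> \<open>The conjugating element y is split along its double coset: r is absorbed by
      the summand, q by Q, and x selects the piece of the pullback.\<close>
    obtain x q r where x: "x \<in> D m" and q: "q \<in> Q" and r: "r \<in> fst m" and yqr: "y = q \<otimes> (x \<otimes> r)"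
      using D[OF m] y(1) unfolding double_coset_reps_def double_coset_iff by blast
    have xP: "x \<in> P" using x DP[OF m] by auto
    have car: "x \<in> carrier S" "q \<in> carrier S" "r \<in> carrier S" using xP q r P Q R(2) by auto
    define \<gamma>' where "\<gamma>' = (\<lambda>v\<in>V. cj (inv q) (\<beta> v))"
    have g1: "\<gamma>' v = cj x (cj r (\<gamma> v))" if "v \<in> V" for v
      using that car \<gamma>S[OF that] y(2)[OF that] by (simp add: \<gamma>'_def yqr cj_mult)
    have \<gamma>'W: "\<gamma>' v \<in> W m x" if v: "v \<in> V" for v
    proof -
      have "\<gamma>' v \<in> Q" using v cj_self[OF Q subgroup.m_inv_closed[OF Q q] \<beta>Q[OF v]] by (simp add: \<gamma>'_def)
      moreover have "\<gamma>' v \<in> cj x ` fst m" using g1[OF v] cj_self[OF R(2) r \<gamma>R[OF v]] by blast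
      ultimately show ?thesis by (simp add: W_def)
    qed
    have \<gamma>': "\<gamma>' \<in> F V (W m x)"
      unfolding \<gamma>'_def by (rule F_conj_comp[OF V Q Wsub[OF m xP] \<beta>]) (use car \<gamma>'W in \<open>auto simp: \<gamma>'_def\<close>)
    \<comment> \<open>This is why dropping the non-centric intersections loses nothing: one that
      receives a centric subgroup is centric.\<close>
    have "\<gamma>' ` V \<in> centrics S F" by (rule centric_image[OF Vc Wsub[OF m xP] \<gamma>'])
    then have Wc: "W m x \<in> centrics S F" by (rule centric_mono[OF _ Wsub[OF m xP]]) (use \<gamma>'W in auto)
    have "agree V (\<lambda>v. snd m (cj (inv x) (\<gamma>' v))) (\<lambda>v. snd m (\<gamma> v))"
    proof -
      have "snd m (\<gamma> v) = cj (inv (snd m r)) (snd m (cj (inv x) (\<gamma>' v)))" if v: "v \<in> V" for v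
        using g1[OF v] car \<gamma>S[OF v] F_cj[OF R(2) T R(4) \<gamma>R[OF v] r] R(5)[OF r] R(5)[OF \<gamma>R[OF v]] by simp
      moreover have "inv (snd m r) \<in> carrier S" using R(5)[OF r] by simp
      ultimately show ?thesis unfolding agree_def by blast
    qed
    moreover have c1: "snd m (cj (inv x) (\<gamma>' v)) \<in> carrier S" if "v \<in> V" for v
      using R(5)[OF Winv[OF m xP \<gamma>'W[OF that]]] .
    ultimately have "agree V (\<lambda>v. snd m (cj (inv x) (\<gamma>' v))) \<alpha>"
      using agree_trans[OF _ ag] by blast
    moreover have "\<exists>y\<in>Q. \<forall>v\<in>V. \<beta> v = cj y (\<gamma>' v)"
      using q car \<beta>S by (intro bexI[of _ q]) (auto simp: \<gamma>'_def)
    ultimately have "cls V (W m x) \<gamma>' \<in> Hom (pairs C (carrier S) Q) u (restricted_pair Q (m, x))"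
      unfolding homQ[OF m xP \<gamma>'] by blast
    moreover have "(m, x) \<in> K" using m x Wc by (simp add: K_def W_def)
    ultimately show ?thesis by blast
  qed
  fix j1 c1 j2 c2
  assume j1: "j1 \<in> K" and c1: "c1 \<in> Hom (pairs C (carrier S) Q) u (restricted_pair Q j1)"
    and j2: "j2 \<in> K" and c2: "c2 \<in> Hom (pairs C (carrier S) Q) u (restricted_pair Q j2)"
  have arrow: "\<exists>m x \<gamma> q. j = (m, x) \<and> m \<in> pair_reps P \<and> x \<in> D m \<and> x \<in> P \<and> \<gamma> \<in> F V (W m x) \<and> c = cls V (W m x) \<gamma> \<and>
      q \<in> Q \<and> (\<forall>v\<in>V. \<beta> v = cj q (\<gamma> v)) \<and> (\<lambda>v\<in>V. cj (inv x) (\<gamma> v)) \<in> F V (fst m) \<and>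
      cls V (fst m) (\<lambda>v\<in>V. cj (inv x) (\<gamma> v)) \<in> Hom (pairs C (carrier S) P) uP (pair_object P m)"
    if j: "j \<in> K" and c: "c \<in> Hom (pairs C (carrier S) Q) u (restricted_pair Q j)" for j c
  proof -
    obtain m x where mx: "j = (m, x)" "m \<in> pair_reps P" "x \<in> D m" using j by (auto simp: K_def)
    have xP: "x \<in> P" using mx(3) DP[OF mx(2)] by blast
    have xS: "x \<in> carrier S" using xP P by simp
    note R = maximalD[OF max[OF mx(2)]]
    note Ws = Wsub[OF mx(2) xP]
    obtain \<gamma> where \<gamma>: "\<gamma> \<in> F V (W m x)" "c = cls V (W m x) \<gamma>"
      using c unfolding u mx(1) rp pairs_simps C_Hom by blast
    note \<gamma>W = F_closed[OF V Ws \<gamma>(1)]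
    obtain q where q: "q \<in> Q" "\<And>v. v \<in> V \<Longrightarrow> \<beta> v = cj q (\<gamma> v)"
      and ag: "agree V (\<lambda>v. snd m (cj (inv x) (\<gamma> v))) \<alpha>"
      using c homQ[OF mx(2) xP \<gamma>(1)] \<gamma>(2) mx(1) by auto
    have \<gamma>': "(\<lambda>v\<in>V. cj (inv x) (\<gamma> v)) \<in> F V (fst m)"
      by (rule F_conj_comp[OF V Ws R(2) \<gamma>(1)]) (use xS Winv[OF mx(2) xP \<gamma>W] in auto)
    have "q \<otimes> x \<in> P" using q QP xP subgroup.m_closed[OF P] by auto
    moreover have "\<beta> v = cj (q \<otimes> x) (cj (inv x) (\<gamma> v))" if v: "v \<in> V" for v
      using q(2)[OF v] sub_carrier[OF Q q(1)] xS sub_carrier[OF Ws \<gamma>W[OF v]] by (simp add: cj_mult)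
    ultimately have "\<exists>y\<in>P. \<forall>v\<in>V. \<beta> v = cj y ((\<lambda>v\<in>V. cj (inv x) (\<gamma> v)) v)" by auto
    moreover have "agree V (\<lambda>w. snd m ((\<lambda>v\<in>V. cj (inv x) (\<gamma> v)) w)) \<alpha>" using ag by (auto simp: agree_def)
    ultimately have "cls V (fst m) (\<lambda>v\<in>V. cj (inv x) (\<gamma> v)) \<in> Hom (pairs C (carrier S) P) uP (pair_object P m)"
      unfolding homP[OF mx(2) \<gamma>'] by blast
    then show ?thesis using mx xP \<gamma> q \<gamma>' by blast
  qed
  obtain m1 x1 \<gamma>1 q1 where 1: "j1 = (m1, x1)" "m1 \<in> pair_reps P" "x1 \<in> D m1" "x1 \<in> P"
    "\<gamma>1 \<in> F V (W m1 x1)" "c1 = cls V (W m1 x1) \<gamma>1" "q1 \<in> Q" "\<And>v. v \<in> V \<Longrightarrow> \<beta> v = cj q1 (\<gamma>1 v)"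
    "(\<lambda>v\<in>V. cj (inv x1) (\<gamma>1 v)) \<in> F V (fst m1)"
    "cls V (fst m1) (\<lambda>v\<in>V. cj (inv x1) (\<gamma>1 v)) \<in> Hom (pairs C (carrier S) P) uP (pair_object P m1)"
    using arrow[OF j1 c1] by blast
  obtain m2 x2 \<gamma>2 q2 where 2: "j2 = (m2, x2)" "m2 \<in> pair_reps P" "x2 \<in> D m2" "x2 \<in> P"
    "\<gamma>2 \<in> F V (W m2 x2)" "c2 = cls V (W m2 x2) \<gamma>2" "q2 \<in> Q" "\<And>v. v \<in> V \<Longrightarrow> \<beta> v = cj q2 (\<gamma>2 v)"
    "(\<lambda>v\<in>V. cj (inv x2) (\<gamma>2 v)) \<in> F V (fst m2)"
    "cls V (fst m2) (\<lambda>v\<in>V. cj (inv x2) (\<gamma>2 v)) \<in> Hom (pairs C (carrier S) P) uP (pair_object P m2)"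
    using arrow[OF j2 c2] by blast
  \<comment> \<open>Moved back by x1 and x2, both arrows lead to summands over P, where uniqueness
    is known.\<close>
  from sys(4)[OF uP 1(2,10) 2(2,10)]
  have mm: "m1 = m2" and cc: "cls V (fst m1) (\<lambda>v\<in>V. cj (inv x1) (\<gamma>1 v)) = cls V (fst m2) (\<lambda>v\<in>V. cj (inv x2) (\<gamma>2 v))"
    by auto
  define m where "m = m1"
  have m: "m1 = m" "m2 = m" "m \<in> pair_reps P" using mm 1(2) by (auto simp: m_def)
  note A = 1[unfolded m(1)] and B = 2[unfolded m(2)]
  note R = maximalD[OF max[OF m(3)]]
  note W1 = Wsub[OF m(3) A(4)] and W2 = Wsub[OF m(3) B(4)]
  have car: "x1 \<in> carrier S" "x2 \<in> carrier S" "q1 \<in> carrier S" "q2 \<in> carrier S" using A B P Q by auto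
  have \<gamma>1S: "\<gamma>1 v \<in> carrier S" and \<gamma>2S: "\<gamma>2 v \<in> carrier S" if "v \<in> V" for v
    using F_carrier[OF V W1 A(5) that] F_carrier[OF V W2 B(5) that] by auto
  have "\<exists>r\<in>fst m. \<forall>v\<in>V. cj (inv x2) (\<gamma>2 v) = cj r (cj (inv x1) (\<gamma>1 v))"
    using cc unfolding m cls_eq_iff[OF V R(2) A(9) B(9)] by simp
  then obtain r where r: "r \<in> fst m" "\<And>v. v \<in> V \<Longrightarrow> cj (inv x2) (\<gamma>2 v) = cj r (cj (inv x1) (\<gamma>1 v))"
    by blast
  have rS: "r \<in> carrier S" using r R(2) by simp
  \<comment> \<open>Two elements conjugate \<open>\<gamma>1\<close> to \<open>\<gamma>2\<close>: q,
    coming from Q, and g, coming from the passage through the common summand over P.\<close>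
  define q where "q = inv q2 \<otimes> q1"
  have qQ: "q \<in> Q" using A(7) B(7) Q by (simp add: q_def subgroup.m_closed subgroup.m_inv_closed)
  have qS: "q \<in> carrier S" using qQ Q by simp
  define g where "g = x2 \<otimes> r \<otimes> inv x1"
  have gS: "g \<in> carrier S" using car rS by (simp add: g_def)
  have \<gamma>2q: "\<gamma>2 v = cj q (\<gamma>1 v)" if v: "v \<in> V" for v
  proof -
    have "cj (inv q2) (cj q2 (\<gamma>2 v)) = cj (inv q2) (cj q1 (\<gamma>1 v))" using A(8)[OF v] B(8)[OF v] by simp
    then show ?thesis using car \<gamma>1S[OF v] \<gamma>2S[OF v] by (simp add: q_def cj_mult)
  qed
  have \<gamma>2g: "\<gamma>2 v = cj g (\<gamma>1 v)" if v: "v \<in> V" for v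
  proof -
    have "cj x2 (cj (inv x2) (\<gamma>2 v)) = cj x2 (cj r (cj (inv x1) (\<gamma>1 v)))" using r(2)[OF v] by simp
    then show ?thesis using car rS \<gamma>1S[OF v] \<gamma>2S[OF v] by (simp add: g_def cj_mult)
  qed
  \<comment> \<open>The quotient of the two centralizes the image of V, so centricity places it in
    that image and hence in Q. Then g is in Q too, and x1 and x2 lie in the same double
    coset.\<close>
  have "inv q \<otimes> g \<in> \<gamma>1 ` V"
  proof (rule centricsD(2)[OF Vc W1 A(5)])
    fix v assume v: "v \<in> V"
    have "cj g (\<gamma>1 v) = cj q (\<gamma>1 v)" using \<gamma>2g[OF v] \<gamma>2q[OF v] by simp
    then show "inv q \<otimes> g \<otimes> \<gamma>1 v = \<gamma>1 v \<otimes> (inv q \<otimes> g)"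
      using gS qS \<gamma>1S[OF v] by (simp add: cj_eq_iff_commutes)
  qed (use gS qS in simp)
  then have wW: "inv q \<otimes> g \<in> W m x1" using F_closed[OF V W1 A(5)] by auto
  then have "inv q \<otimes> g \<in> Q" by (simp add: W_def)
  then have "q \<otimes> (inv q \<otimes> g) \<in> Q" using qQ Q subgroup.m_closed by metis
  then have gQ: "g \<in> Q" using qS gS by (simp add: m_assoc[symmetric])
  have "x2 = g \<otimes> (x1 \<otimes> inv r)"
    using car rS by (simp add: g_def m_assoc) (simp add: m_assoc[symmetric])
  then have "x2 \<in> Q <#> (x1 <# fst m)"
    unfolding double_coset_iff using gQ subgroup.m_inv_closed[OF R(2) r(1)] by blast
  moreover have "x2 \<in> Q <#> (x2 <# fst m)"
    unfolding double_coset_iff using subgroup.one_closed[OF Q] subgroup.one_closed[OF R(2)] car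
    by (intro bexI[of _ \<one>]) auto
  ultimately have xx: "x1 = x2"
    using D[OF m(3)] A(3) B(3,4) unfolding double_coset_reps_def by blast
  \<comment> \<open>Now g is the conjugate of r by x1, so g and then q lie in the intersection W,
    and the two classes agree.\<close>
  have "g \<in> cj x1 ` fst m" using r(1) by (auto simp: g_def conj_by_def xx)
  moreover note gW = this
  have "inv (inv q \<otimes> g) \<in> W m x1" by (rule subgroup.m_inv_closed[OF W1 wW])
  moreover have "g \<in> W m x1" using gQ gW by (simp add: W_def)
  ultimately have "g \<otimes> inv (inv q \<otimes> g) \<in> W m x1" using subgroup.m_closed[OF W1] by blast
  then have "q \<in> W m x1" using gS qS by (simp add: inv_mult_group m_assoc[symmetric])
  then have "\<exists>q\<in>W m x1. \<forall>v\<in>V. \<gamma>2 v = cj q (\<gamma>1 v)" using \<gamma>2q by blast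
  then have "cls V (W m x1) \<gamma>1 = cls V (W m x1) \<gamma>2"
    using cls_eq_iff[OF V W1 A(5)] B(5) xx by simp
  then have "c1 = c2" using A(6) B(6) xx by simp
  then show "j1 = j2 \<and> c1 = c2" using A(1) B(1) xx by simp
qed

end

section \<open>Integers prime to p as units of the coefficient ring\<close>

lemma (in module) finsum_const_smult:
  assumes "finite A" "v \<in> carrier M"
  shows "finsum M (\<lambda>_. v) A = [card A] \<cdot>\<^bsub>R\<^esub> \<one>\<^bsub>R\<^esub> \<odot>\<^bsub>M\<^esub> v"
  using assms
proof (induction rule: finite_induct)
  case (insert a A)
  have "finsum M (\<lambda>_. v) (insert a A) = v \<oplus>\<^bsub>M\<^esub> finsum M (\<lambda>_. v) A"
    using insert by (intro M.finsum_insert) auto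
  then show ?case using insert by (simp add: smult_l_distr M.a_comm)
qed simp

lemma Z_localized_simps:
  "\<one>\<^bsub>Z_localized p\<^esub> = 1" "x \<otimes>\<^bsub>Z_localized p\<^esub> y = x * y" "x \<oplus>\<^bsub>Z_localized p\<^esub> y = x + y" "\<zero>\<^bsub>Z_localized p\<^esub> = 0"
  by (simp_all add: Z_localized_def)

lemma Z_localized_add_pow: "[n] \<cdot>\<^bsub>Z_localized p\<^esub> \<one>\<^bsub>Z_localized p\<^esub> = of_nat (n :: nat)"
proof (induction n)
  case (Suc n)
  then show ?case by (simp add: add_pow_def nat_pow_def Z_localized_simps)
qed (simp add: add_pow_def nat_pow_def Z_localized_simps)

lemma Z_localized_unit:
  assumes "\<not> p dvd n"
  shows "of_nat n \<in> carrier (Z_localized p)" "inverse (of_nat n) \<in> carrier (Z_localized p)"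
proof -
  have "\<not> int p dvd 1" using assms by (metis dvd_trans int_dvd_int_iff nat_dvd_1_iff_1 of_nat_1 one_dvd)
  moreover have "of_nat n = (of_int (int n) / of_int 1 :: rat)" by simp
  ultimately show "of_nat n \<in> carrier (Z_localized p)"
    unfolding Z_localized_def partial_object.simps by blast
  have "inverse (of_nat n) = (of_int 1 / of_int (int n) :: rat)" by (simp add: inverse_eq_divide)
  moreover have "\<not> int p dvd int n" using assms by simp
  ultimately show "inverse (of_nat n) \<in> carrier (Z_localized p)"
    unfolding Z_localized_def partial_object.simps by blast
qed

section \<open>The trace of a Mackey functor and its naturality\<close>

locale mackey = saturated_fusion p S F for p and S (structure) and F +
  fixes U L :: "('a set, ('a \<Rightarrow> 'a) set, rat, 'm) mod_functor"
  assumes mackey: "mackey_functor S F (Z_localized p) U L"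

sublocale mackey \<subseteq> double_functor C "Z_localized p" U L "carrier S"
proof -
  interpret small_category C by (rule C_category)
  show "double_functor C (Z_localized p) U L (carrier S)"
    using mackey S_centric unfolding mackey_functor_def Let_def
    by unfold_locales (auto simp: C_Obj)
qed

context mackey
begin

abbreviation k where "k \<equiv> Z_localized p"

lemma mackey_formula:
  assumes "P \<in> centrics S F" "Q \<in> centrics S F" "R \<in> centrics S F" "Q \<subseteq> P" "R \<subseteq> P"
    "double_coset_reps S P Q R D" "v \<in> carrier (Ob U R)"
  shows "Ar U Q P (cls Q P (incl Q)) (Ar L R P (cls R P (incl R)) v) =
    finsum (Ob U Q) (\<lambda>x. Ar L (Q \<inter> cj x ` R) Q (cls (Q \<inter> cj x ` R) Q (incl (Q \<inter> cj x ` R)))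
      (Ar U (Q \<inter> cj x ` R) (cj x ` R) (cls (Q \<inter> cj x ` R) (cj x ` R) (incl (Q \<inter> cj x ` R)))
        (Ar L R (cj x ` R) (cls R (cj x ` R) (restrict (cj x) R)) v)))
      {x \<in> D. Q \<inter> cj x ` R \<in> centrics S F}"
  using mackey assms unfolding mackey_functor_def Let_def conj_map_eq C_Obj by simp

definition trace :: "'a set \<Rightarrow> ('a set \<times> ('a \<Rightarrow> 'a) set \<times> ('a \<Rightarrow> 'a) set \<Rightarrow> 'm) \<Rightarrow> 'm" where
  "trace P = transfer P (pair_reps P) (pair_object P)"

text \<open>With the decomposition over Q restricted from that over P, the left side is a sum over
  summands and double cosets. Expanding each summand of the right side by the Mackey formula gives
  the same terms.\<close>

lemma trace_inclusion:
  assumes Pc: "P \<in> centrics S F" and Qc: "Q \<in> centrics S F" and QP: "Q \<subseteq> P"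
    and s: "s \<in> carrier (Ob (families C (carrier S) U) P)"
  shows "trace Q (Ar (families C (carrier S) U) Q P (cls Q P (incl Q)) s) =
    Ar U Q P (cls Q P (incl Q)) (trace P s)"
proof -
  note T = subgroup_self
  have P: "sub P" and Q: "sub Q" using Pc Qc by auto
  have PO: "P \<in> Obj C" and QO: "Q \<in> Obj C" using Pc Qc by (auto simp: C_Obj)
  note max = pair_reps_maximal[OF P]
  note sysP = pair_reps_product_system[OF Pc] and sysQ = pair_reps_product_system[OF Qc]
  let ?fam = "families C (carrier S) U" and ?g = "cls Q P (incl Q)"
  have iQP: "incl Q \<in> F Q P" by (rule F_incl[OF Q P QP])
  have g: "?g \<in> Hom C Q P" using iQP by (auto simp: C_Hom)
  interpret UQ: module k "Ob U Q" by (rule contra_module[OF U QO])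
  have fs: "Ar ?fam Q P ?g s \<in> carrier (Ob ?fam Q)"
    by (rule contra_closed[OF families_functor[OF UQ.R.is_cring U x] QO PO g s])
  have "\<forall>m\<in>pair_reps P. \<exists>D. double_coset_reps S P Q (fst m) D"
    using double_coset_reps_exist[OF P Q QP] maximalD(2,3)[OF max] by blast
  then obtain D where D: "double_coset_reps S P Q (fst m) (D m)" if "m \<in> pair_reps P" for m by metis
  define B where "B m = {x \<in> D m. Q \<inter> cj x ` fst m \<in> centrics S F}" for m :: "'a set \<times> ('a \<Rightarrow> 'a)"
  have sys: "product_system C (carrier S) Q (Sigma (pair_reps P) B) (restricted_pair Q)"
    unfolding B_def by (rule restricted_product_system[OF Pc Qc QP D])
  note fin = product_systemD(1)[OF sysP]
  have DP: "D m \<subseteq> P" if "m \<in> pair_reps P" for m using D[OF that] by (simp add: double_coset_reps_def)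
  have finB: "finite (B m)" if "m \<in> pair_reps P" for m
    using DP[OF that] sub_finite[OF P] unfolding B_def by (auto intro: finite_subset)
  define h where "h m x = Ar L (fst (restricted_pair Q (m, x))) Q (snd (snd (restricted_pair Q (m, x))))
      (Ar ?fam Q P ?g s (restricted_pair Q (m, x)))" for m x
  have hc: "h m x \<in> carrier (Ob U Q)" if "m \<in> pair_reps P" "x \<in> B m" for m x
    unfolding h_def using that by (intro transfer_term_closed[OF QO fs product_systemD(2)[OF sys]]) auto
  \<comment> \<open>By independence of the decomposition the trace over Q can be computed with the
    restricted one.\<close>
  have "trace Q (Ar ?fam Q P ?g s) = transfer Q (Sigma (pair_reps P) B) (restricted_pair Q) (Ar ?fam Q P ?g s)"
    unfolding trace_def by (rule transfer_independent[OF QO sysQ sys fs])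
  also have "\<dots> = finsum (Ob U Q) (\<lambda>(m, x). h m x) (Sigma (pair_reps P) B)"
    unfolding transfer_def h_def by (simp add: case_prod_beta')
  also have "\<dots> = finsum (Ob U Q) (\<lambda>m. finsum (Ob U Q) (h m) (B m)) (pair_reps P)"
    by (rule UQ.M.finsum_Sigma[OF fin finB hc])
  also have "\<dots> = finsum (Ob U Q) (\<lambda>m. Ar U Q P ?g (Ar L (fst m) P (cls (fst m) P (incl (fst m))) (s (pair_object P m)))) (pair_reps P)"
  proof (rule UQ.M.finsum_cong'[OF refl], rule Pi_I)
    fix m assume m: "m \<in> pair_reps P"
    have "Ar L (fst m) P (cls (fst m) P (incl (fst m))) (s (pair_object P m)) \<in> carrier (Ob U P)"
      using transfer_term_closed[OF PO s product_systemD(2)[OF sysP m]] by (simp add: pair_object_def)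
    then show "Ar U Q P ?g (Ar L (fst m) P (cls (fst m) P (incl (fst m))) (s (pair_object P m))) \<in> carrier (Ob U Q)"
      by (rule contra_closed[OF U QO PO g])
  next
    fix m assume m: "m \<in> pair_reps P"
    note R = maximalD[OF max[OF m]]
    let ?R = "fst m" and ?v = "s (pair_object P m)"
    have RO: "?R \<in> Obj C" using R(1) by (simp add: C_Obj)
    have mO: "pair_object P m \<in> Obj (pairs C (carrier S) P)" by (rule product_systemD(2)[OF sysP m])
    have v: "?v \<in> carrier (Ob U ?R)" using familiesD(1)[OF s mO] by (simp add: pair_object_def)
    have iRP: "incl ?R \<in> F ?R P" by (rule F_incl[OF R(2) P R(3)])
    have "finsum (Ob U Q) (h m) (B m) = finsum (Ob U Q) (\<lambda>x. Ar L (Q \<inter> cj x ` ?R) Q (cls (Q \<inter> cj x ` ?R) Q (incl (Q \<inter> cj x ` ?R)))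
      (Ar U (Q \<inter> cj x ` ?R) (cj x ` ?R) (cls (Q \<inter> cj x ` ?R) (cj x ` ?R) (incl (Q \<inter> cj x ` ?R)))
        (Ar L ?R (cj x ` ?R) (cls ?R (cj x ` ?R) (restrict (cj x) ?R)) ?v))) (B m)"
    proof (rule UQ.M.finsum_cong'[OF refl, symmetric], rule Pi_I, rule hc[OF m])
      fix x assume xB: "x \<in> B m"
      then have xP: "x \<in> P" using DP[OF m] by (auto simp: B_def)
      then have xS: "x \<in> carrier S" using P by simp
      let ?T = "cj x ` ?R" let ?W = "Q \<inter> ?T"
      have Wc: "?W \<in> centrics S F" using xB by (simp add: B_def)
      have Tc: "?T \<in> centrics S F" by (rule cj_image_centric[OF R(1) xS])
      have W: "sub ?W" and T': "sub ?T" using Wc Tc by auto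
      have WO: "?W \<in> Obj C" and TO: "?T \<in> Obj C" using Wc Tc by (auto simp: C_Obj)
      have RT: "restrict (cj x) ?R \<in> F ?R ?T" by (rule F_conj[OF R(2) T' xS]) auto
      have TR: "restrict (cj (inv x)) ?T \<in> F ?T ?R" by (rule F_conj[OF T' R(2)]) (use xS R(2) in auto)
      have WT: "incl ?W \<in> F ?W ?T" by (rule F_incl[OF W T']) auto
      have WQ: "incl ?W \<in> F ?W Q" by (rule F_incl[OF W Q]) auto
      have WP: "incl ?W \<in> F ?W P" by (rule F_incl[OF W P]) (use QP in auto)
      have WR: "restrict (cj (inv x)) ?W \<in> F ?W ?R" by (rule F_conj[OF W R(2)]) (use xS R(2) in auto)
      have rp: "restricted_pair Q (m, x) = (?W, cls ?W (carrier S) (\<lambda>u\<in>?W. snd m (cj (inv x) u)), cls ?W Q (incl ?W))"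
        by (cases m) (simp add: restricted_pair_def Let_def)
      let ?b = "cls ?T ?R (restrict (cj (inv x)) ?T)" and ?a = "cls ?R ?T (restrict (cj x) ?R)"
      have "compose ?R (restrict (cj (inv x)) ?T) (restrict (cj x) ?R) = incl ?R"
        "compose ?T (restrict (cj x) ?R) (restrict (cj (inv x)) ?T) = incl ?T"
        using xS R(2) by (auto simp: compose_def incl_def fun_eq_iff)
      then have "inverse_arrows C ?T ?R ?b ?a"
        using RT TR R(2) T' by (auto simp: inverse_arrows_def C_Hom C_Ide C_Comp)
      \<comment> \<open>The transfer along conjugation by x is restriction along the inverse
        conjugation, which merges with the restriction that follows.\<close>
      then have "Ar L ?R ?T ?a ?v = Ar U ?T ?R ?b ?v" using inverse[OF TO RO _ v] by simp
      then have "Ar U ?W ?T (cls ?W ?T (incl ?W)) (Ar L ?R ?T ?a ?v) =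
          Ar U ?W ?R (Comp C ?W ?T ?R ?b (cls ?W ?T (incl ?W))) ?v"
        using contra_comp[OF U WO TO RO _ _ v] WT TR by (simp add: C_Hom)
      also have "Comp C ?W ?T ?R ?b (cls ?W ?T (incl ?W)) = cls ?W ?R (restrict (cj (inv x)) ?W)"
      proof -
        have "compose ?W (restrict (cj (inv x)) ?T) (incl ?W) = restrict (cj (inv x)) ?W"
          by (auto simp: compose_def incl_def fun_eq_iff)
        then show ?thesis by (simp add: C_Comp[OF W T' R(2) WT TR])
      qed
      \<comment> \<open>Conjugation by the inverse of x is an arrow of pairs over P from the
        restricted piece to the summand m, so the compatibility of s identifies the two
        values.\<close>
      also have "Ar U ?W ?R \<dots> ?v = Ar ?fam Q P ?g s (restricted_pair Q (m, x))"
      proof -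
        have rO: "restricted_pair Q (m, x) \<in> Obj (pairs C (carrier S) Q)"
          using m xB by (intro product_systemD(2)[OF sys]) auto
        let ?i = "(?W, cls ?W (carrier S) (\<lambda>u\<in>?W. snd m (cj (inv x) u)), cls ?W P (incl ?W))"
        have "compose ?W (incl Q) (incl ?W) = incl ?W" by (auto simp: compose_def incl_def fun_eq_iff)
        then have pc: "pair_postcomp C Q P ?g (restricted_pair Q (m, x)) = ?i"
          unfolding rp pair_postcomp_def by (simp add: C_Comp[OF W Q P WQ iQP])
        have iO: "?i \<in> Obj (pairs C (carrier S) P)"
          using pair_postcomp_Obj[OF _ QO PO g rO] S_centric by (simp add: pc C_Obj)
        have "compose ?W (snd m) (restrict (cj (inv x)) ?W) = (\<lambda>u\<in>?W. snd m (cj (inv x) u))"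
          by (auto simp: compose_def fun_eq_iff)
        then have \<psi>': "(\<lambda>u\<in>?W. snd m (cj (inv x) u)) \<in> F ?W (carrier S)"
          using F_comp[OF W R(2) T WR R(4)] by simp
        have "cls ?W ?R (restrict (cj (inv x)) ?W) \<in> Hom (pairs C (carrier S) P) ?i (pair_object P m)"
          unfolding pair_object_def pairs_hom_iff[OF W R(2) P \<psi>' WP R(4) iRP WR]
        proof
          have "\<And>u. u \<in> ?W \<Longrightarrow> snd m (cj (inv x) u) \<in> carrier S" using F_carrier[OF W T \<psi>'] by auto
          then show "agree ?W (compose ?W (snd m) (restrict (cj (inv x)) ?W)) (\<lambda>u\<in>?W. snd m (cj (inv x) u))"
            unfolding agree_def by (intro bexI[of _ \<one>]) (auto simp: compose_def)
          show "\<exists>y\<in>P. \<forall>u\<in>?W. incl ?W u = cj y (incl ?R (restrict (cj (inv x)) ?W u))"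
            using xP xS R(2) by (intro bexI[of _ x]) (auto simp: incl_def)
        qed
        from familiesD(2)[OF s iO mO this] show ?thesis
          unfolding families_Ar[OF rO] pc by (simp add: pair_object_def)
      qed
      finally have eq: "Ar U ?W ?T (cls ?W ?T (incl ?W)) (Ar L ?R ?T ?a ?v) = Ar ?fam Q P ?g s (restricted_pair Q (m, x))" .
      show "Ar L ?W Q (cls ?W Q (incl ?W)) (Ar U ?W ?T (cls ?W ?T (incl ?W)) (Ar L ?R ?T ?a ?v)) = h m x"
        unfolding eq h_def rp fst_conv snd_conv by (rule refl)
    qed
    then show "finsum (Ob U Q) (h m) (B m) = Ar U Q P ?g (Ar L ?R P (cls ?R P (incl ?R)) ?v)"
      using mackey_formula[OF Pc Qc R(1) QP R(3) D[OF m] v] by (simp add: B_def)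
  qed
  also have "\<dots> = Ar U Q P ?g (trace P s)"
    unfolding trace_def transfer_def pair_object_def
    using transfer_term_closed[OF PO s product_systemD(2)[OF sysP]] fin
    by (subst linear_finsum[OF contra_module[OF U PO] contra_module[OF U QO] contra_linear[OF U QO PO g]])
      (auto simp: pair_object_def)
  finally show ?thesis .
qed

text \<open>Every morphism is an isomorphism onto its image followed by an inclusion;
  \<open>transfer_iso\<close> handles the first factor and \<open>trace_inclusion\<close> the
  second.\<close>

lemma trace_natural: "trace \<in> natural_maps C k (families C (carrier S) U) U"
  unfolding natural_maps_def mem_Collect_eq
proof (intro conjI ballI)
  let ?fam = "families C (carrier S) U"
  show "trace P \<in> linear_maps k (Ob ?fam P) (Ob U P)" if "P \<in> Obj C" for P
    using that pair_reps_product_system unfolding trace_def by (intro transfer_linear) (auto simp: C_Obj)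
  fix P' P g s
  assume PO': "P' \<in> Obj C" and PO: "P \<in> Obj C" and g: "g \<in> Hom C P' P" and s: "s \<in> carrier (Ob ?fam P)"
  have Pc': "P' \<in> centrics S F" and Pc: "P \<in> centrics S F" using PO PO' by (auto simp: C_Obj)
  have P': "sub P'" and P: "sub P" using Pc' Pc by auto
  interpret UP: module k "Ob U P" by (rule contra_module[OF U PO])
  note FF = families_functor[OF UP.R.is_cring U x]
  obtain \<gamma> where \<gamma>: "\<gamma> \<in> F P' P" "g = cls P' P \<gamma>" using g unfolding C_Hom by blast
  let ?Q = "\<gamma> ` P'"
  have Qc: "?Q \<in> centrics S F" by (rule centric_image[OF Pc' P \<gamma>(1)])
  then have Q: "sub ?Q" and QO: "?Q \<in> Obj C" by (auto simp: C_Obj)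
  have QP: "?Q \<subseteq> P" using F_closed[OF P' P \<gamma>(1)] by auto
  have iQ: "incl ?Q \<in> F ?Q P" by (rule F_incl[OF Q P QP])
  note iso = F_onto_image[OF P' P \<gamma>(1)]
  let ?\<delta> = "restrict (inv_into P' \<gamma>) ?Q"
  have "compose P' ?\<delta> \<gamma> = incl P'" "compose ?Q \<gamma> ?\<delta> = incl ?Q"
    using F_inj[OF P' P \<gamma>(1)] by (auto simp: compose_def incl_def fun_eq_iff f_inv_into_f)
  then have inv: "inverse_arrows C P' ?Q (cls P' ?Q \<gamma>) (cls ?Q P' ?\<delta>)"
    using iso P' Q by (auto simp: inverse_arrows_def C_Hom C_Ide C_Comp)
  have "compose P' (incl ?Q) \<gamma> = \<gamma>"
    using F_ext[OF P' P \<gamma>(1)] by (intro extensionalityI[of _ P']) (auto simp: compose_def incl_def)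
  then have gc: "g = Comp C P' ?Q P (cls ?Q P (incl ?Q)) (cls P' ?Q \<gamma>)"
    using \<gamma>(2) by (simp add: C_Comp[OF P' Q P iso(1) iQ])
  have h1: "cls P' ?Q \<gamma> \<in> Hom C P' ?Q" and h2: "cls ?Q P (incl ?Q) \<in> Hom C ?Q P"
    using iso iQ by (auto simp: C_Hom)
  have s': "Ar ?fam ?Q P (cls ?Q P (incl ?Q)) s \<in> carrier (Ob ?fam ?Q)"
    by (rule contra_closed[OF FF QO PO h2 s])
  have tc: "trace P s \<in> carrier (Ob U P)"
    unfolding trace_def by (rule linear_closed[OF transfer_linear[OF PO pair_reps_product_system[OF Pc]] s])
  have "trace P' (Ar ?fam P' P g s) = trace P' (Ar ?fam P' ?Q (cls P' ?Q \<gamma>) (Ar ?fam ?Q P (cls ?Q P (incl ?Q)) s))"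
    unfolding gc by (simp only: contra_comp[OF FF PO' QO PO h1 h2 s])
  also have "\<dots> = Ar U P' ?Q (cls P' ?Q \<gamma>) (trace ?Q (Ar ?fam ?Q P (cls ?Q P (incl ?Q)) s))"
    unfolding trace_def
    by (rule transfer_iso[OF PO' QO inv pair_reps_product_system[OF Pc'] pair_reps_product_system[OF Qc] s'])
  also have "\<dots> = Ar U P' ?Q (cls P' ?Q \<gamma>) (Ar U ?Q P (cls ?Q P (incl ?Q)) (trace P s))"
    by (simp only: trace_inclusion[OF Pc Qc QP s])
  also have "\<dots> = Ar U P' P g (trace P s)"
    unfolding gc by (simp only: contra_comp[OF U PO' QO PO h1 h2 tc])
  finally show "trace P' (Ar ?fam P' P g s) = Ar U P' P g (trace P s)" .
qed

section \<open>Inverting the composite of restriction and trace\<close>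

definition tau :: "'a set \<Rightarrow> 'm \<Rightarrow> 'm" where
  "tau P v = trace P (restrict_family C (carrier S) U P v)"

lemma tau_natural: "tau \<in> natural_maps C k U U"
  unfolding tau_def
  by (rule natural_comp[OF restrict_family_natural[OF U x] trace_natural])

text \<open>Each summand restricts v to its domain and transfers it back. Proper domains contribute
  zero by assumption, the domain P contributes v itself, and \<open>card_top_pair_reps\<close>
  counts how often.\<close>

lemma tau_eq:
  assumes Pc: "P \<in> centrics S F" and v: "v \<in> carrier (Ob U P)"
    and zero: "\<And>R. R \<in> centrics S F \<Longrightarrow> R \<subset> P \<Longrightarrow> Ar U R P (cls R P (incl R)) v = \<zero>\<^bsub>Ob U R\<^esub>"
  shows "tau P v = of_nat (card (Hom C P (carrier S))) \<odot>\<^bsub>Ob U P\<^esub> v"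
proof -
  have P: "sub P" and PO: "P \<in> Obj C" using Pc by (auto simp: C_Obj)
  note max = pair_reps_maximal[OF P]
  note sys = pair_reps_product_system[OF Pc]
  note fin = product_systemD(1)[OF sys]
  interpret UP: module k "Ob U P" by (rule contra_module[OF U PO])
  let ?A = "{m \<in> pair_reps P. fst m = P}" and ?B = "{m \<in> pair_reps P. fst m \<noteq> P}"
  let ?h = "\<lambda>m. Ar L (fst m) P (cls (fst m) P (incl (fst m))) (Ar U (fst m) P (cls (fst m) P (incl (fst m))) v)"
  have hom: "fst m \<in> Obj C" "cls (fst m) P (incl (fst m)) \<in> Hom C (fst m) P" if "m \<in> pair_reps P" for m
    using maximalD[OF max[OF that]] F_incl[OF _ P] by (auto simp: C_Obj C_Hom)
  have hc: "?h m \<in> carrier (Ob U P)" if "m \<in> pair_reps P" for m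
    using hom[OF that] PO v by (intro L_closed contra_closed[OF U])
  have top: "?h m = v" if "m \<in> ?A" for m
  proof -
    have "cls P P (incl P) = Ide C P" by (simp add: C_Ide)
    then show ?thesis using that PO v by (simp add: L_ide contra_ide[OF U])
  qed
  have bot: "?h m = \<zero>\<^bsub>Ob U P\<^esub>" if m: "m \<in> ?B" for m
  proof -
    have mr: "m \<in> pair_reps P" and "fst m \<subset> P" using m maximalD(3)[OF max[of m]] by auto
    then have "Ar U (fst m) P (cls (fst m) P (incl (fst m))) v = \<zero>\<^bsub>Ob U (fst m)\<^esub>"
      using zero maximalD(1)[OF max] by blast
    then show ?thesis
      using linear_zero[OF contra_module[OF U hom(1)[OF mr]] contra_module[OF U PO] L_linear[OF hom(1)[OF mr] PO hom(2)[OF mr]]]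
      by simp
  qed
  have "tau P v = finsum (Ob U P) ?h (pair_reps P)"
    unfolding tau_def trace_def transfer_def
  proof (rule UP.M.finsum_cong'[OF refl])
    fix m assume m: "m \<in> pair_reps P"
    have "pair_object P m \<in> Obj (pairs C (carrier S) P)" using product_systemD(2)[OF sys m] .
    then show "Ar L (fst (pair_object P m)) P (snd (snd (pair_object P m))) (restrict_family C (carrier S) U P v (pair_object P m)) = ?h m"
      by (simp add: restrict_family_def pair_object_def)
  qed (use hc in auto)
  also have "pair_reps P = ?A \<union> ?B" by auto
  also have "finsum (Ob U P) ?h (?A \<union> ?B) = finsum (Ob U P) ?h ?A \<oplus>\<^bsub>Ob U P\<^esub> finsum (Ob U P) ?h ?B"
    using fin hc by (intro UP.M.finsum_Un_disjoint) auto
  also have "finsum (Ob U P) ?h ?B = \<zero>\<^bsub>Ob U P\<^esub>"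
    using bot by (intro UP.M.add.finprod_one_eqI)
  also have "finsum (Ob U P) ?h ?A = finsum (Ob U P) (\<lambda>_. v) ?A"
    using top v by (intro UP.M.finsum_cong') auto
  also have "\<dots> = of_nat (card (Hom C P (carrier S))) \<odot>\<^bsub>Ob U P\<^esub> v"
    using UP.finsum_const_smult[of ?A v] fin v by (simp add: Z_localized_add_pow card_top_pair_reps[OF Pc])
  moreover have "(of_nat (card (Hom C P (carrier S))) :: rat) \<in> carrier k"
    using Z_localized_unit(1)[OF card_Hom_S_not_dvd[OF Pc]] .
  ultimately show ?thesis using v by simp
qed

text \<open>If \<open>\<sigma> \<tau> = c\<close> on the proper subgroups of \<open>P\<close>, then \<open>(\<tau> - m) (c - \<sigma> \<tau>) = 0\<close> on \<open>P\<close> as well,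
  where \<open>m\<close> is the number of morphisms from \<open>P\<close> to \<open>S\<close>; solving for \<open>m c\<close> gives the new \<open>\<sigma>\<close>.\<close>

lemma tau_left_inverse_on:
  assumes "finite A" "A \<subseteq> centrics S F" "\<And>P R. P \<in> A \<Longrightarrow> R \<in> centrics S F \<Longrightarrow> R \<subseteq> P \<Longrightarrow> R \<in> A"
  shows "\<exists>\<sigma>\<in>natural_maps C k U U. \<exists>c\<in>carrier k. inverse c \<in> carrier k \<and> c \<noteq> 0 \<and>
    (\<forall>P\<in>A. \<forall>v\<in>carrier (Ob U P). \<sigma> P (tau P v) = c \<odot>\<^bsub>Ob U P\<^esub> v)"
  using assms
proof (induction "card A" arbitrary: A rule: less_induct)
  case less
  interpret US: module k "Ob U (carrier S)" by (rule contra_module[OF U x])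
  show ?case
  proof (cases "A = {}")
    case True
    then show ?thesis using natural_id US.R.one_closed by (auto simp: Z_localized_simps intro!: bexI[of _ "1 :: rat"])
  next
    case False
    \<comment> \<open>Removing a subgroup of largest order keeps A closed under passing to centric
      subgroups.\<close>
    obtain P where PA: "P \<in> A" and max: "\<And>R. R \<in> A \<Longrightarrow> card R \<le> card P"
    proof -
      have "finite (card ` A)" "card ` A \<noteq> {}" using less.prems(1) False by auto
      then obtain P where "P \<in> A" "card P = Max (card ` A)" using Max_in[of "card ` A"] by fastforce
      then show thesis using that less.prems(1) by simp
    qed
    have Pc: "P \<in> centrics S F" using PA less.prems by auto
    let ?A = "A - {P}"
    have "card ?A < card A" using PA less.prems(1) by (simp add: card_gt_0_iff False)
    moreover have "R \<in> ?A" if "Q \<in> ?A" "R \<in> centrics S F" "R \<subseteq> Q" for Q R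
    proof -
      have "R \<noteq> P"
      proof
        assume "R = P"
        then have "P \<subset> Q" using that by auto
        then have "card P < card Q"
          using that(1) less.prems(2) sub_finite[of Q] centric_sub[of Q] by (intro psubset_card_mono) auto
        then show False using max[of Q] that(1) by auto
      qed
      then show ?thesis using less.prems(3) that by blast
    qed
    ultimately obtain \<sigma> c where \<sigma>: "\<sigma> \<in> natural_maps C k U U" and c: "c \<in> carrier k" "inverse c \<in> carrier k" "c \<noteq> 0"
      and eq: "\<And>R v. R \<in> ?A \<Longrightarrow> v \<in> carrier (Ob U R) \<Longrightarrow> \<sigma> R (tau R v) = c \<odot>\<^bsub>Ob U R\<^esub> v"
      using less.hyps[of ?A] less.prems(1,2) by blast
    define m :: rat where "m = of_nat (card (Hom C P (carrier S)))"
    have m: "m \<in> carrier k" "inverse m \<in> carrier k" "m \<noteq> 0"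
    proof -
      have "card (Hom C P (carrier S)) \<noteq> 0" using card_Hom_S_not_dvd[OF Pc] by (metis dvd_0_right)
      then show "m \<in> carrier k" "inverse m \<in> carrier k" "m \<noteq> 0"
        using Z_localized_unit[OF card_Hom_S_not_dvd[OF Pc]] by (auto simp: m_def)
    qed
    \<comment> \<open>The defect of \<open>\<sigma>\<close> as a left inverse up to c. It vanishes
      on the members of A other than P; by naturality its values on P restrict to zero on all
      smaller centric subgroups, which is the hypothesis of \<open>tau_eq\<close>.\<close>
    define \<epsilon> where "\<epsilon> R v = c \<odot>\<^bsub>Ob U R\<^esub> v \<ominus>\<^bsub>Ob U R\<^esub> \<sigma> R (tau R v)" for R v
    note tau = tau_natural
    have \<epsilon>: "\<epsilon> \<in> natural_maps C k U U"
      unfolding \<epsilon>_def by (rule natural_diff[OF U U natural_scale[OF U c(1)] natural_comp[OF tau \<sigma>]])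
    have \<epsilon>0: "\<epsilon> R v = \<zero>\<^bsub>Ob U R\<^esub>" if R: "R \<in> ?A" and v: "v \<in> carrier (Ob U R)" for R v
    proof -
      have RO: "R \<in> Obj C" using R less.prems by (auto simp: C_Obj)
      interpret UR: module k "Ob U R" by (rule contra_module[OF U RO])
      show ?thesis using eq[OF R v] v c by (simp add: \<epsilon>_def UR.M.minus_eq_zero_iff)
    qed
    have key: "tau R (\<epsilon> R v) = m \<odot>\<^bsub>Ob U R\<^esub> \<epsilon> R v" if R: "R \<in> A" and v: "v \<in> carrier (Ob U R)" for R v
    proof (cases "R = P")
      case True
      have PO: "P \<in> Obj C" using Pc by (simp add: C_Obj)
      have vP: "v \<in> carrier (Ob U P)" using v True by simp
      have "Ar U R P (cls R P (incl R)) (\<epsilon> P v) = \<zero>\<^bsub>Ob U R\<^esub>" if R: "R \<in> centrics S F" "R \<subset> P" for R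
      proof -
        have RO: "R \<in> Obj C" using R by (simp add: C_Obj)
        have h: "cls R P (incl R) \<in> Hom C R P"
          using F_incl[of R P] R Pc by (auto simp: C_Hom)
        have "R \<in> ?A" using less.prems(3)[OF PA R(1)] R(2) by auto
        then show ?thesis
          using natural_natural[OF \<epsilon> RO PO h vP] \<epsilon>0 contra_closed[OF U RO PO h vP] by simp
      qed
      then show ?thesis
        using tau_eq[OF Pc natural_closed[OF \<epsilon> PO vP]] True by (simp add: m_def)
    next
      case False
      then have RA: "R \<in> ?A" using R by simp
      have RO: "R \<in> Obj C" using R less.prems by (auto simp: C_Obj)
      interpret UR: module k "Ob U R" by (rule contra_module[OF U RO])
      show ?thesis using \<epsilon>0[OF RA v] m by (simp add: natural_zero[OF tau U U RO])
    qed
    \<comment> \<open>In the notation of the preceding text, \<open>key\<close> reads \<tau> (c -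
      \<sigma> \<tau>) = m (c - \<sigma> \<tau>). Collecting the terms that end in \<tau> gives (c -
      \<tau> \<sigma> + m \<sigma>) \<tau> = m c; the factor in front is the new map.\<close>
    define \<sigma>' where "\<sigma>' R w = (c \<odot>\<^bsub>Ob U R\<^esub> w \<ominus>\<^bsub>Ob U R\<^esub> tau R (\<sigma> R w)) \<oplus>\<^bsub>Ob U R\<^esub> m \<odot>\<^bsub>Ob U R\<^esub> \<sigma> R w" for R w
    have \<sigma>': "\<sigma>' \<in> natural_maps C k U U"
      unfolding \<sigma>'_def
      by (intro natural_plus[OF U U] natural_diff[OF U U] natural_scale[OF U c(1)] natural_comp[OF \<sigma> tau]
          natural_comp[OF \<sigma> natural_scale[OF U m(1)]])
    have "\<sigma>' R (tau R v) = (m * c) \<odot>\<^bsub>Ob U R\<^esub> v" if R: "R \<in> A" and v: "v \<in> carrier (Ob U R)" for R v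
    proof -
      have RO: "R \<in> Obj C" using R less.prems by (auto simp: C_Obj)
      interpret UR: module k "Ob U R" by (rule contra_module[OF U RO])
      define a where "a = c \<odot>\<^bsub>Ob U R\<^esub> tau R v"
      define b where "b = tau R (\<sigma> R (tau R v))"
      define e where "e = m \<odot>\<^bsub>Ob U R\<^esub> (c \<odot>\<^bsub>Ob U R\<^esub> v)"
      define f where "f = m \<odot>\<^bsub>Ob U R\<^esub> \<sigma> R (tau R v)"
      have tv: "tau R v \<in> carrier (Ob U R)" and stv: "\<sigma> R (tau R v) \<in> carrier (Ob U R)"
        using natural_closed[OF tau RO v] natural_closed[OF \<sigma> RO] by auto
      have car: "a \<in> carrier (Ob U R)" "b \<in> carrier (Ob U R)" "e \<in> carrier (Ob U R)" "f \<in> carrier (Ob U R)"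
        using tv stv v c m natural_closed[OF tau RO stv] by (auto simp: a_def b_def e_def f_def)
      have "tau R (\<epsilon> R v) = a \<ominus>\<^bsub>Ob U R\<^esub> b"
        using v c stv by (simp add: \<epsilon>_def a_def b_def natural_minus[OF tau U U RO] linear_smult[OF natural_linear[OF tau RO]])
      moreover have "m \<odot>\<^bsub>Ob U R\<^esub> \<epsilon> R v = e \<ominus>\<^bsub>Ob U R\<^esub> f"
        using v c m stv by (simp add: \<epsilon>_def e_def f_def linear_minus[OF UR.module_axioms UR.module_axioms linear_scale[OF UR.module_axioms m(1)]])
      ultimately have "a \<ominus>\<^bsub>Ob U R\<^esub> b = e \<ominus>\<^bsub>Ob U R\<^esub> f" using key[OF R v] by simp
      then have "(a \<ominus>\<^bsub>Ob U R\<^esub> b) \<oplus>\<^bsub>Ob U R\<^esub> f = e"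
        using car by (simp add: a_minus_def UR.M.a_assoc UR.M.l_neg)
      then show ?thesis
        using v c m UR.smult_assoc1[OF m(1) c(1) v] by (simp add: \<sigma>'_def a_def b_def e_def f_def Z_localized_simps)
    qed
    moreover have "m * c \<in> carrier k" "inverse (m * c) \<in> carrier k"
      using US.R.m_closed[OF m(1) c(1)] US.R.m_closed[OF m(2) c(2)] by (simp_all add: Z_localized_simps)
    ultimately show ?thesis
      using \<sigma>' m(3) c(3) by (intro bexI[of _ \<sigma>'] bexI[of _ "m * c"]) auto
  qed
qed

lemma retraction:
  obtains t where "t \<in> natural_maps C k (families C (carrier S) U) U"
    "\<And>P v. P \<in> Obj C \<Longrightarrow> v \<in> carrier (Ob U P) \<Longrightarrow> t P (restrict_family C (carrier S) U P v) = v"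
proof -
  obtain \<sigma> c where \<sigma>: "\<sigma> \<in> natural_maps C k U U" and c: "c \<in> carrier k" "inverse c \<in> carrier k" "c \<noteq> 0"
    and eq: "\<And>P v. P \<in> centrics S F \<Longrightarrow> v \<in> carrier (Ob U P) \<Longrightarrow> \<sigma> P (tau P v) = c \<odot>\<^bsub>Ob U P\<^esub> v"
    using tau_left_inverse_on[of "centrics S F"] finite_Obj by (auto simp: C_Obj)
  show thesis
  proof (rule that)
    \<comment> \<open>Dividing by the unit c turns a left inverse up to c into a retraction.\<close>
    show "(\<lambda>P s. inverse c \<odot>\<^bsub>Ob U P\<^esub> \<sigma> P (trace P s)) \<in> natural_maps C k (families C (carrier S) U) U"
      by (rule natural_comp[OF natural_comp[OF trace_natural \<sigma>] natural_scale[OF U c(2)]])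
    fix P v assume P: "P \<in> Obj C" and v: "v \<in> carrier (Ob U P)"
    interpret UP: module k "Ob U P" by (rule contra_module[OF U P])
    show "inverse c \<odot>\<^bsub>Ob U P\<^esub> \<sigma> P (trace P (restrict_family C (carrier S) U P v)) = v"
      using eq[of P v] P v UP.smult_assoc1[OF c(2,1) v, symmetric] c(3) UP.smult_one[OF v]
      by (simp add: C_Obj tau_def Z_localized_simps)
  qed
qed

end

theorem theoremA:
  fixes p i :: nat
    and S :: "('g, 'x) monoid_scheme"
    and F :: "'g fusion"
    and U L :: "('g set, ('g \<Rightarrow> 'g) set, rat, 'm) mod_functor"
    and J :: "nat \<Rightarrow> ('g set, ('g \<Rightarrow> 'g) set, rat, 'n) mod_functor"
    and e :: "'g set \<Rightarrow> 'm \<Rightarrow> 'n"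
    and d :: "nat \<Rightarrow> 'g set \<Rightarrow> 'n \<Rightarrow> 'n"
  assumes "Factorial_Ring.prime p"
    and "fusion_system p S F"
    and "saturated p S F"
    and "mackey_functor S F (Z_localized p) U L"
    and "infinite (UNIV :: 'n set)"
    and "injective_resolution (centric_orbit_category S F) (Z_localized p) U J e d"
    and "i > 0"
  shows "trivial_group (higher_limit (centric_orbit_category S F) J d i)"
proof -
  interpret mackey p S F U L
    by unfold_locales (use assms in auto)
  obtain t where t: "t \<in> natural_maps C k (families C (carrier S) U) U"
    "\<And>P v. P \<in> Obj C \<Longrightarrow> v \<in> carrier (Ob U P) \<Longrightarrow> t P (restrict_family C (carrier S) U P v) = v"
    using retraction by blast
  interpret US: module k "Ob U (carrier S)" by (rule contra_module[OF U x])
  interpret retract_resolution C k "carrier S" pair_reps pair_object U t J e d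
    by unfold_locales (use assms t US.R.is_cring x pair_reps_product_system in \<open>auto simp: C_Obj\<close>)
  obtain n where "i = Suc n" using assms(7) gr0_implies_Suc by blast
  then show ?thesis using trivial_higher_limit by simp
qed

end
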